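(* For $|q|<1$ the following four identities hold: $$F(q,q^3,q^6,q^8)=\frac{1}{(q,q^3,q^4,q^6,q^8,q^9,q^{11};q^{12})_\infty},$$ $$F(q^3,q^5,q^6,q^{12})=\frac{1}{(q^3,q^4,q^5,q^6,q^7,q^8,q^9;q^{12})_\infty},$$ $$F(q^2,q^3,q^5,q^8)=\frac{1}{(q^2,q^3,q^4,q^5,q^8,q^9,q^{11};q^{12})_\infty},$$ and $$F(q^2,q^3,q^4,q^8)+qF(q^3,q^5,q^7,q^{12})+q^3F(q^4,q^7,q^{10},q^{16})-q^7F(q^5,q^9,q^{13},q^{20})=\frac{1}{(q,q^3,q^4,q^7,q^8,q^9,q^{10};q^{12})_\infty}.$$
   Context: Here $q$ is a complex number with $|q|<1$. For a base $p$ with $|p|<1$: $(a;p)_\infty=\prod_{k\ge 0}(1-ap^k)$, $(a;p)_n=\prod_{k=0}^{n-1}(1-ap^k)$ for integers $n\ge 0$, and $(a_1,\dots,a_m;p)_\infty=(a_1;p)_\infty\cdots(a_m;p)_\infty$. The quadruple series $F$ is defined by $$F(u,v,w,t)=F(u,v,w,t;q):=\sum_{i,j,k,\ell \geq 0}\frac{(-1)^{\ell}u^{i}v^{j}w^{k}t^{\ell}q^{\binom{i+2j+3k+4\ell}{2}+2\ell^2-2\ell}}{(q;q)_{i}(q^2;q^2)_{j}(q^3;q^3)_{k}(q^4;q^4)_{\ell}},$$ where $\binom{N}{2}=N(N-1)/2$. *)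

theory Defs
  imports "HOL-Analysis.Analysis"
begin

definition qpoch :: "complex \<Rightarrow> complex \<Rightarrow> nat \<Rightarrow> complex" where
  "qpoch a p n = (\<Prod>k<n. 1 - a * p ^ k)"

definition qpoch_inf :: "complex \<Rightarrow> complex \<Rightarrow> complex" where
  "qpoch_inf a p = (\<Prod>k. 1 - a * p ^ k)"

definition qpoch_inf_list :: "complex list \<Rightarrow> complex \<Rightarrow> complex" where
  "qpoch_inf_list as p = (\<Prod>a\<leftarrow>as. qpoch_inf a p)"

(* The subtraction in the exponent is on nat; it never truncates, as l <= l^2. *)
definition F_term ::
  "complex \<Rightarrow> complex \<Rightarrow> complex \<Rightarrow> complex \<Rightarrow> complex \<Rightarrow> nat \<times> nat \<times> nat \<times> nat \<Rightarrow> complex" where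
  "F_term q u v w t = (\<lambda>(i, j, k, l).
     (-1) ^ l * u ^ i * v ^ j * w ^ k * t ^ l
       * q ^ (((i + 2 * j + 3 * k + 4 * l) choose 2) + (2 * l\<^sup>2 - 2 * l))
     / (qpoch q q i * qpoch (q ^ 2) (q ^ 2) j * qpoch (q ^ 3) (q ^ 3) k * qpoch (q ^ 4) (q ^ 4) l))"

definition F :: "complex \<Rightarrow> complex \<Rightarrow> complex \<Rightarrow> complex \<Rightarrow> complex \<Rightarrow> complex" where
  "F q u v w t = (\<Sum>\<^sub>\<infinity>x\<in>UNIV. F_term q u v w t x)"

lemma has_prod_qpoch_inf:
  assumes "norm p < 1"
  shows "(\<lambda>k. 1 - a * p ^ k) has_prod qpoch_inf a p"
proof -
  have "summable (\<lambda>k. norm a * norm p ^ k)"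
    using assms by (intro summable_mult summable_geometric) simp
  hence "abs_convergent_prod (\<lambda>k. 1 + (- (a * p ^ k)))"
    by (intro summable_imp_abs_convergent_prod) (simp add: norm_mult norm_power)
  hence "convergent_prod (\<lambda>k. 1 - a * p ^ k)"
    using abs_convergent_prod_imp_convergent_prod by fastforce
  thus ?thesis unfolding qpoch_inf_def by (rule convergent_prod_has_prod)
qed

lemma norm_qpoch_ge:
  assumes "norm p \<le> r" "r < 1"
  shows "(1 - r) ^ n \<le> norm (qpoch p p n)"
proof -
  have r0: "0 \<le> r" using assms(1) norm_ge_zero order_trans by blast
  have 1: "1 - r \<le> norm (1 - p * p ^ k)" for k
  proof -
    have "norm (p ^ Suc k) \<le> norm p * 1"
      unfolding power_Suc norm_mult norm_power using assms by (intro mult_left_mono power_le_one) auto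
    moreover have "1 - norm (p ^ Suc k) \<le> norm (1 - p ^ Suc k)"
      using norm_triangle_ineq2[of 1 "p ^ Suc k"] by simp
    ultimately show ?thesis using assms by simp
  qed
  have "(\<Prod>k<n. 1 - r) \<le> (\<Prod>k<n. norm (1 - p * p ^ k))"
    using 1 assms by (intro prod_mono) auto
  thus ?thesis by (simp add: qpoch_def prod_norm)
qed

lemma F_term_summable:
  assumes q: "norm q < 1"
  shows "(\<lambda>x. norm (F_term q u v w t x)) summable_on UNIV"
proof -
  define r where "r = norm q"
  have r: "0 \<le> r" "r < 1" using q by (auto simp: r_def)
  define A where "A = Max {1, norm u, norm v, norm w, norm t}"
  have A: "1 \<le> A" "norm u \<le> A" "norm v \<le> A" "norm w \<le> A" "norm t \<le> A"
    by (auto simp: A_def)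
  define M where "M = A / (1 - r)"
  have M1: "1 \<le> M" using A r by (simp add: M_def field_simps)
  have "(\<lambda>N. (2 * M) ^ N * r ^ (N choose 2)) \<longlonglongrightarrow> 0"
  proof -
    have "\<forall>\<^sub>F k in sequentially. r ^ k < 1 / (4 * M)"
      using r M1 by (intro order_tendstoD[OF LIMSEQ_power_zero]) auto
    then obtain K where K: "\<And>k. k \<ge> K \<Longrightarrow> r ^ k < 1 / (4 * M)"
      by (auto simp: eventually_sequentially)
    have "summable (\<lambda>N. (2 * M) ^ N * r ^ (N choose 2))"
    proof (rule summable_ratio_test[where c = "1/2" and N = K])
      fix n assume "K \<le> n"
      have "(2 * M) ^ Suc n * r ^ (Suc n choose 2)
            = (2 * M * r ^ n) * ((2 * M) ^ n * r ^ (n choose 2))"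
        by (simp add: numeral_2_eq_2 power_add)
      also have "\<dots> \<le> 1 / 2 * ((2 * M) ^ n * r ^ (n choose 2))"
        using K[OF \<open>K \<le> n\<close>] M1 r by (intro mult_right_mono) (auto simp: field_simps)
      finally show "norm ((2 * M) ^ Suc n * r ^ (Suc n choose 2))
                    \<le> 1 / 2 * norm ((2 * M) ^ n * r ^ (n choose 2))"
        using M1 r by simp
    qed simp
    thus ?thesis by (rule summable_LIMSEQ_zero)
  qed
  hence "Bseq (\<lambda>N. (2 * M) ^ N * r ^ (N choose 2))"
    by (intro convergent_imp_Bseq) (auto simp: convergent_def)
  then obtain C where C0: "C > 0" and C': "\<And>N. norm ((2 * M) ^ N * r ^ (N choose 2)) \<le> C"
    by (auto simp: Bseq_def)
  have C: "M ^ N * r ^ (N choose 2) \<le> C * (1 / 2) ^ N" for N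
    using C'[of N] M1 r by (simp add: power_mult_distrib field_simps)
  have bound: "norm (F_term q u v w t (i, j, k, l))
        \<le> C * ((1/2)^i * ((1/2)^j * ((1/2)^k * (1/2)^l)))" for i j k l
  proof -
    define N where "N = i + 2 * j + 3 * k + 4 * l"
    define n where "n = i + j + k + l"
    have nN: "n \<le> N" by (simp add: n_def N_def)
    have d: "norm (q ^ m) \<le> r" if "m \<ge> 1" for m
      using power_decreasing[of 1 m r] that r by (simp add: norm_power r_def)
    have num: "norm ((-1) ^ l * u ^ i * v ^ j * w ^ k * t ^ l * q ^ ((N choose 2) + (2 * l\<^sup>2 - 2 * l)))
               \<le> 1 * A ^ i * A ^ j * A ^ k * A ^ l * r ^ (N choose 2)"
      unfolding norm_mult norm_power r_def[symmetric] using A r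
      by (intro mult_mono power_mono mult_nonneg_nonneg power_decreasing) auto
    have den: "(1 - r) ^ i * (1 - r) ^ j * (1 - r) ^ k * (1 - r) ^ l
       \<le> norm (qpoch q q i * qpoch (q ^ 2) (q ^ 2) j * qpoch (q ^ 3) (q ^ 3) k * qpoch (q ^ 4) (q ^ 4) l)"
      unfolding norm_mult using r d[of 1] d[of 2] d[of 3] d[of 4]
      by (intro mult_mono norm_qpoch_ge mult_nonneg_nonneg) auto
    have "norm (F_term q u v w t (i, j, k, l)) \<le>
       (1 * A ^ i * A ^ j * A ^ k * A ^ l * r ^ (N choose 2)) /
       ((1 - r) ^ i * (1 - r) ^ j * (1 - r) ^ k * (1 - r) ^ l)"
      unfolding F_term_def prod.case norm_divide N_def[symmetric] using r A
      by (intro frac_le num den) (auto intro!: mult_nonneg_nonneg)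
    also have "\<dots> = M ^ n * r ^ (N choose 2)"
      by (simp add: M_def n_def power_divide power_add)
    also have "\<dots> \<le> M ^ N * r ^ (N choose 2)"
      using M1 r nN by (intro mult_right_mono power_increasing) auto
    also have "\<dots> \<le> C * (1/2) ^ N" by (rule C)
    also have "\<dots> \<le> C * (1/2) ^ n"
      using C0 nN by (intro mult_left_mono power_decreasing) auto
    finally show ?thesis by (simp add: n_def power_add mult_ac)
  qed
  have s: "(\<lambda>(x,y). f x * g y) summable_on (UNIV :: ('a \<times> 'b) set)"
    if "f summable_on UNIV" "g summable_on UNIV" "\<And>x. f x \<ge> 0" "\<And>x. g x \<ge> 0"
    for f :: "'a \<Rightarrow> real" and g :: "'b \<Rightarrow> real"
    using that
    by (subst UNIV_Times_UNIV[symmetric], intro summable_on_SigmaI[where g="\<lambda>x. f x * infsum g UNIV"])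
       (auto intro: has_sum_cmult_right summable_on_cmult_left has_sum_infsum)
  have h': "(\<lambda>n. (1 / 2 :: real) ^ n) summable_on UNIV"
    by (simp add: summable_on_UNIV_nonneg_real_iff)
  have "(\<lambda>(i,x). (1/2) ^ i * (case x of (j,y) \<Rightarrow> (1/2) ^ j * (case y of (k,l) \<Rightarrow> (1/2) ^ k * (1/2::real) ^ l))) summable_on UNIV"
    by (intro s h') (auto split: prod.splits)
  hence S: "(\<lambda>x. C * (case x of (i, j, k, l) \<Rightarrow> (1/2) ^ i * ((1/2) ^ j * ((1/2) ^ k * (1/2::real) ^ l)))) summable_on UNIV"
    by (intro summable_on_cmult_right) (simp add: case_prod_unfold)
  show ?thesis
    by (rule summable_on_comparison_test[OF S]) (use bound in auto)
qed

end

theory Submission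
  imports Defs
begin

text \<open>
Let L be the linear functional on power series with L(x^N) = q^(N(N+1)/2); it satisfies
L(x f(x)) = q L(f(qx)). By Euler's expansions, F(qu, q^2 v, q^3 w, q^4 t) is the value of L at
(t x^4; q^4) / ((u x; q) (v x^2; q^2) (w x^3; q^3)). All sums in question are special values of
two families,
A(c) = L((-qx; q) (c x^2; q^2) / ((-c x^3; q^3) (q x^2; q^2))) and
B(e) = L((1 + e x) (e^2 x^2; q^2) (-q^2 e^3 x^2; q^2) / ((x; q) (q e^2 x^2; q^2) (e^3 x^3; q^3))):
the third one is A(-q^2), the fourth one A(-q^(-2)), the first minus q times the second is A(-1),
and the first plus q times the second is B(1). Applying L(x f(x)) = q L(f(qx)) to a suitable
multiple of the argument gives the first-order recurrences A(c) = (1 - c q^3) A(c q^6) and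
(1 + q^2 e) B(e) = (1 + q e) (1 + q^6 e^3) B(e q^2). Hence both families are infinite products
times A(0) and B(0). The latter is Euler's sum, the former Bressoud's sum for the modulus 6, which
reduces to the triple product identity. A 2-dissection of theta series separates the first two sums.
\<close>

text \<open>Formal series are used because 1 / (x; q) has poles, while L reads coefficients only:
  the weight q^(n(n+1)/2) beats every geometric growth, so coefficient bounds C R^n are the whole
  analytic input. The parameters c and e are deformations, inserted so that c -> c q^6 and e -> e
  q^2 alter each infinite product by finitely many factors. Once the common series is divided out, a
  recurrence is a polynomial identity, certified by a series C for which q C(qx) - x C(x) is q times
  the wanted difference of arguments. The first sum and q times the second come from one series with
  prefactors 1 + x + x^2 and x. It is the difference 1 + x^2 and the sum (1 + x)^2 of the prefactors
  that complete the products to members of A and B, so these combinations are evaluated instead of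
  the sums themselves. A(0) obeys a three-term recurrence; both it and the inner sum of the triple
  product are identified by uniqueness, as two solutions with equal limit coincide. The value q = 0
  is set apart because the argument divides by q.\<close>

unbundle no vec_syntax
unbundle fps_syntax

section \<open>Formal power series, the dilation x -> qx and Euler's expansions\<close>

definition dilate :: "complex \<Rightarrow> complex fps \<Rightarrow> complex fps" where
  "dilate q f = Abs_fps (\<lambda>n. q ^ n * fps_nth f n)"

lemma dil_nth [simp]: "fps_nth (dilate q f) n = q ^ n * fps_nth f n"
  by (simp add: dilate_def)

lemma dil_mult: "dilate q (f * g) = dilate q f * dilate q g"
proof (rule fps_ext)
  fix n
  have "q ^ n * (f $ i * g $ (n - i)) = q ^ i * f $ i * (q ^ (n - i) * g $ (n - i))" if "i \<le> n" for i
    using that by (simp add: power_add [symmetric] mult_ac)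
  thus "dilate q (f * g) $ n = (dilate q f * dilate q g) $ n"
    by (auto simp: fps_mult_nth sum_distrib_left intro!: sum.cong)
qed

lemma dil_add: "dilate q (f + g) = dilate q f + dilate q g"
  by (rule fps_ext) (simp add: algebra_simps)

lemma dil_diff: "dilate q (f - g) = dilate q f - dilate q g"
  by (rule fps_ext) (simp add: algebra_simps)

lemma dil_const [simp]: "dilate q (fps_const c) = fps_const c"
  by (rule fps_ext) auto

lemma dil_1 [simp]: "dilate q 1 = 1"
  by (rule fps_ext) auto

lemma dil_X: "dilate q fps_X = fps_const q * fps_X"
  by (rule fps_ext) (auto simp: fps_X_def)

lemma dil_power: "dilate q (f ^ n) = dilate q f ^ n"
  by (induction n) (auto simp: dil_mult)

lemmas dil_simps = dil_mult dil_add dil_diff dil_X dil_power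

text \<open>The coefficient of x^n gives (1 - q^n) f_n in terms of lower coefficients, and q^n
  differs from 1 for n > 0, so A and f(0) determine f. This replaces the manipulation of infinite
  products: a product identity is checked on functional equations.\<close>

lemma fps_dil_unique:
  assumes q: "norm q < 1" and f: "f = A * dilate q f" and g: "g = A * dilate q g"
    and 0: "fps_nth A 0 = 1" "fps_nth f 0 = fps_nth g 0"
  shows "f = g"
proof (rule fps_ext)
  fix n
  show "f $ n = g $ n"
  proof (induction n rule: less_induct)
    case (less n)
    show ?case
    proof (cases "n = 0")
      case False
      have *: "h $ n * (1 - q ^ n) = (\<Sum>i=1..n. A $ i * (q ^ (n - i) * h $ (n - i)))"
        if "h = A * dilate q h" for h
      proof -
        have "h $ n = (A * dilate q h) $ n" using that by simp
        also have "\<dots> = (\<Sum>i=0..n. A $ i * (q ^ (n - i) * h $ (n - i)))"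
          by (simp add: fps_mult_nth)
        also have "\<dots> = q ^ n * h $ n + (\<Sum>i=1..n. A $ i * (q ^ (n - i) * h $ (n - i)))"
          using 0 by (subst sum.atLeast_Suc_atMost) auto
        finally show ?thesis by (simp add: algebra_simps)
      qed
      have "f $ n * (1 - q ^ n) = g $ n * (1 - q ^ n)"
        unfolding *[OF f] *[OF g] using less by (intro sum.cong) auto
      moreover have "q ^ n \<noteq> 1"
      proof
        assume "q ^ n = 1"
        hence "norm q ^ n = 1" by (metis norm_one norm_power)
        moreover have "norm q ^ n < 1" using q False by (simp add: power_less_one_iff)
        ultimately show False by simp
      qed
      ultimately show ?thesis by simp
    qed (use 0 in auto)
  qed
qed

definition sparse_fps :: "nat \<Rightarrow> (nat \<Rightarrow> complex) \<Rightarrow> complex fps" where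
  "sparse_fps d c = Abs_fps (\<lambda>n. if d dvd n then c (n div d) else 0)"

lemma ser_nth: "fps_nth (sparse_fps d c) n = (if d dvd n then c (n div d) else 0)"
  by (simp add: sparse_fps_def)

text \<open>The expansions of 1 / (a x^d; q^d) and of (a x^d; q^d).\<close>

definition inv_poch_fps :: "complex \<Rightarrow> complex \<Rightarrow> nat \<Rightarrow> complex fps" where
  "inv_poch_fps q a d = sparse_fps d (\<lambda>m. a ^ m / qpoch (q ^ d) (q ^ d) m)"

definition poch_fps :: "complex \<Rightarrow> complex \<Rightarrow> nat \<Rightarrow> complex fps" where
  "poch_fps q a d = sparse_fps d (\<lambda>m. (- a) ^ m * (q ^ d) ^ (m choose 2) / qpoch (q ^ d) (q ^ d) m)"

lemma dil_ser: "dilate q (sparse_fps d c) = sparse_fps d (\<lambda>m. (q ^ d) ^ m * c m)"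
  by (rule fps_ext) (auto simp: ser_nth power_mult [symmetric])

lemma dil_ip: "dilate q (inv_poch_fps q a d) = inv_poch_fps q (a * q ^ d) d"
  by (simp add: inv_poch_fps_def dil_ser power_mult_distrib mult_ac)

lemma dil_np: "dilate q (poch_fps q a d) = poch_fps q (a * q ^ d) d"
proof -
  have "(- (a * q ^ d)) ^ m = (q ^ d) ^ m * (- a) ^ m" for m
    by (metis mult.commute mult_minus_left power_mult_distrib)
  thus ?thesis by (simp add: poch_fps_def dil_ser mult_ac)
qed

lemma qpoch_Suc: "qpoch a p (Suc n) = qpoch a p n * (1 - a * p ^ n)"
  by (simp add: qpoch_def)

lemma qpoch_0 [simp]: "qpoch a p 0 = 1"
  by (simp add: qpoch_def)

lemma qpoch_nonzero: "norm p < 1 \<Longrightarrow> qpoch p p n \<noteq> 0"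
  using norm_qpoch_ge[of p "norm p" n] by (auto simp: power_le_zero_eq)

lemma norm_power_less_1: "norm (q :: complex) < 1 \<Longrightarrow> 1 \<le> d \<Longrightarrow> norm (q ^ d) < 1"
  by (simp add: norm_power power_less_one_iff)

lemma one_minus_X_ser:
  assumes "1 \<le> d"
  shows "(1 - fps_const a * fps_X ^ d) * sparse_fps d c =
    sparse_fps d (\<lambda>m. c m - (if m = 0 then 0 else a * c (m - 1)))"
proof (rule fps_ext)
  fix n
  have "((1 - fps_const a * fps_X ^ d) * sparse_fps d c) $ n
      = sparse_fps d c $ n - a * (if n < d then 0 else sparse_fps d c $ (n - d))"
    by (simp add: left_diff_distrib mult.assoc fps_X_power_mult_nth)
  also have "\<dots> = sparse_fps d (\<lambda>m. c m - (if m = 0 then 0 else a * c (m - 1))) $ n"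
  proof (cases "d dvd n")
    case True
    then obtain m where n: "n = d * m" by auto
    show ?thesis
    proof (cases m)
      case (Suc k)
      have "n - d = d * k" by (simp add: n Suc)
      thus ?thesis using assms by (simp add: ser_nth n Suc)
    qed (use assms in \<open>simp add: n ser_nth\<close>)
  next
    case False
    hence "\<not> d dvd n - d" if "\<not> n < d"
      using that by (metis dvd_minus_self)
    thus ?thesis using False by (auto simp: ser_nth)
  qed
  finally show "((1 - fps_const a * fps_X ^ d) * sparse_fps d c) $ n =
    sparse_fps d (\<lambda>m. c m - (if m = 0 then 0 else a * c (m - 1))) $ n" .
qed

context
  fixes q :: complex
  assumes q: "norm q < 1"
begin

text \<open>With p = q^d, the factor 1 - p^m in the difference of the coefficients a^m / (p; p)_m
  and (a p)^m / (p; p)_m is the last factor of (p; p)_m, so the difference is a times the previous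
  coefficient.\<close>

lemma ip_shift:
  assumes "1 \<le> d"
  shows "inv_poch_fps q (a * q ^ d) d = (1 - fps_const a * fps_X ^ d) * inv_poch_fps q a d"
proof -
  define p where "p = q ^ d"
  have nz: "qpoch p p m \<noteq> 0" for m
    unfolding p_def by (intro qpoch_nonzero norm_power_less_1 q assms)
  have "(a * p) ^ m / qpoch p p m
      = a ^ m / qpoch p p m - (if m = 0 then 0 else a * (a ^ (m - 1) / qpoch p p (m - 1)))" for m
  proof (cases m)
    case (Suc k)
    have "1 - p * p ^ k \<noteq> 0" using nz[of "Suc k"] by (simp add: qpoch_Suc)
    thus ?thesis using nz[of k] by (simp add: Suc qpoch_Suc field_simps power_mult_distrib)
  qed auto
  thus ?thesis
    unfolding inv_poch_fps_def one_minus_X_ser[OF assms] p_def [symmetric] by simp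
qed

lemma np_shift:
  assumes "1 \<le> d"
  shows "poch_fps q a d = (1 - fps_const a * fps_X ^ d) * poch_fps q (a * q ^ d) d"
proof -
  define p where "p = q ^ d"
  have nz: "qpoch p p m \<noteq> 0" for m
    unfolding p_def by (intro qpoch_nonzero norm_power_less_1 q assms)
  have "(- a) ^ m * p ^ (m choose 2) / qpoch p p m
      = (- (a * p)) ^ m * p ^ (m choose 2) / qpoch p p m -
        (if m = 0 then 0 else a * ((- (a * p)) ^ (m - 1) * p ^ ((m - 1) choose 2) / qpoch p p (m - 1)))" for m
  proof (cases m)
    case (Suc k)
    have "1 - p * p ^ k \<noteq> 0" using nz[of "Suc k"] by (simp add: qpoch_Suc)
    moreover have "(- (a * p)) ^ k = (- a) ^ k * p ^ k"
      by (metis mult_minus_left power_mult_distrib)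
    moreover have "Suc k choose 2 = k + (k choose 2)"
      by (simp add: numeral_2_eq_2)
    ultimately show ?thesis using nz[of k]
      by (simp add: Suc qpoch_Suc power_add divide_simps) (simp add: algebra_simps)
  qed auto
  thus ?thesis
    unfolding poch_fps_def one_minus_X_ser[OF assms] p_def [symmetric] by simp
qed

lemma ip_nth_0 [simp]: "inv_poch_fps q a d $ 0 = 1" and np_nth_0 [simp]: "poch_fps q a d $ 0 = 1"
  by (simp_all add: inv_poch_fps_def poch_fps_def ser_nth numeral_2_eq_2)

text \<open>Under x -> qx the factor 1 - a x^d leaves one expansion and enters the other, so the
  product is invariant; an invariant series is constant.\<close>

lemma np_ip: "1 \<le> d \<Longrightarrow> poch_fps q a d * inv_poch_fps q a d = 1"
proof (rule fps_dil_unique[OF q, where A = 1])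
  assume d: "1 \<le> d"
  show "poch_fps q a d * inv_poch_fps q a d = 1 * dilate q (poch_fps q a d * inv_poch_fps q a d)"
    unfolding dil_mult dil_np dil_ip ip_shift[OF d]
    by (subst np_shift[OF d, of a]) (simp only: mult_ac mult_1)
qed auto

text \<open>Both sides solve f(x) = (1 - a^2 x^(2d)) f(qx): a difference of squares in each factor
  of the products.\<close>

lemma np_mult_minus:
  assumes "1 \<le> d"
  shows "poch_fps q a d * poch_fps q (- a) d = poch_fps q (a ^ 2) (2 * d)"
proof (rule fps_dil_unique[OF q, where A = "1 - fps_const (a ^ 2) * fps_X ^ (2 * d)"])
  have e: "1 - fps_const (a ^ 2) * fps_X ^ (2 * d)
      = (1 - fps_const a * fps_X ^ d) * (1 - fps_const (- a) * (fps_X :: complex fps) ^ d)"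
  proof -
    have "1 - A ^ 2 * x ^ 2 = (1 - A * x) * (1 - (- A) * x)" for A x :: "complex fps"
      by (simp add: algebra_simps power2_eq_square)
    from this[of "fps_const a" "fps_X ^ d"] show ?thesis
      by (simp only: fps_const_power fps_const_neg power_mult [symmetric] mult.commute[of d 2])
  qed
  show "poch_fps q a d * poch_fps q (- a) d
      = (1 - fps_const (a ^ 2) * fps_X ^ (2 * d)) * dilate q (poch_fps q a d * poch_fps q (- a) d)"
    unfolding e dil_mult dil_np
    by (subst np_shift[OF assms, of a], subst np_shift[OF assms, of "- a"]) (simp only: mult_ac)
  show "poch_fps q (a ^ 2) (2 * d) = (1 - fps_const (a ^ 2) * fps_X ^ (2 * d)) * dilate q (poch_fps q (a ^ 2) (2 * d))"
    unfolding dil_np using assms by (intro np_shift) auto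
qed (use assms in auto)

end

section \<open>Geometric coefficient bounds\<close>

definition coeff_bound :: "real \<Rightarrow> real \<Rightarrow> complex fps \<Rightarrow> bool" where
  "coeff_bound C R f \<longleftrightarrow> (\<forall>n. norm (fps_nth f n) \<le> C * R ^ n)"

text \<open>The n + 1 summands of the Cauchy product are absorbed by 2^n, hence the growth rate 2
  R.\<close>

lemma bd_mult:
  assumes f: "coeff_bound C R f" and g: "coeff_bound D R g" and R: "0 \<le> R"
  shows "coeff_bound (C * D) (2 * R) (f * g)"
  unfolding coeff_bound_def
proof
  fix n
  have C: "0 \<le> C" using f unfolding coeff_bound_def by (metis mult.right_neutral norm_ge_zero order_trans power_0)
  have "norm ((f * g) $ n) \<le> (\<Sum>i=0..n. norm (f $ i * g $ (n - i)))"
    unfolding fps_mult_nth by (rule norm_sum)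
  also have "\<dots> \<le> (\<Sum>i=0..n. C * D * R ^ n)"
  proof (rule sum_mono)
    fix i assume "i \<in> {0..n}"
    hence n: "R ^ n = R ^ i * R ^ (n - i)" by (simp flip: power_add)
    have "norm (f $ i * g $ (n - i)) \<le> (C * R ^ i) * (D * R ^ (n - i))"
      unfolding norm_mult using f g C R by (intro mult_mono) (auto simp: coeff_bound_def)
    thus "norm (f $ i * g $ (n - i)) \<le> C * D * R ^ n" by (simp add: n mult_ac)
  qed
  also have "\<dots> = real (Suc n) * (C * D * R ^ n)" by simp
  also have "\<dots> \<le> 2 ^ n * (C * D * R ^ n)"
  proof (rule mult_right_mono)
    have "Suc n \<le> 2 ^ n" by (metis Suc_leI less_exp)
    thus "real (Suc n) \<le> 2 ^ n" by (metis of_nat_le_iff of_nat_numeral of_nat_power)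
    have "0 \<le> D" using g unfolding coeff_bound_def by (metis mult.right_neutral norm_ge_zero order_trans power_0)
    thus "0 \<le> C * D * R ^ n" using C R by simp
  qed
  finally show "norm ((f * g) $ n) \<le> C * D * (2 * R) ^ n"
    by (simp add: power_mult_distrib mult_ac)
qed

lemma bd_mono:
  assumes "coeff_bound C R f" "C \<le> D" "R \<le> S" "0 \<le> R" "0 \<le> C"
  shows "coeff_bound D S f"
  unfolding coeff_bound_def
proof
  fix n
  have "norm (f $ n) \<le> C * R ^ n" using assms by (auto simp: coeff_bound_def)
  also have "\<dots> \<le> D * S ^ n" using assms by (intro mult_mono power_mono) auto
  finally show "norm (f $ n) \<le> D * S ^ n" .
qed

text \<open>Equivalent to a positive radius of convergence. The class is closed under the ring
  operations and is small enough for L to converge on it.\<close>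

definition geometric :: "complex fps \<Rightarrow> bool" where
  "geometric f \<longleftrightarrow> (\<exists>C R. coeff_bound C R f)"

lemma geoI: "coeff_bound C R f \<Longrightarrow> geometric f" by (auto simp: geometric_def)

lemma geoE:
  assumes "geometric f"
  obtains C R where "coeff_bound C R f" "0 \<le> C" "1 \<le> R"
proof -
  obtain C R where f: "coeff_bound C R f" using assms by (auto simp: geometric_def)
  have C: "0 \<le> C" using f unfolding coeff_bound_def by (metis mult.right_neutral norm_ge_zero order_trans power_0)
  have "coeff_bound C (max 1 \<bar>R\<bar>) f" unfolding coeff_bound_def
  proof
    fix n
    have "norm (f $ n) \<le> C * R ^ n" using f by (auto simp: coeff_bound_def)
    also have "\<dots> \<le> C * \<bar>R\<bar> ^ n" using C by (intro mult_left_mono) (auto simp flip: power_abs)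
    also have "\<dots> \<le> C * max 1 \<bar>R\<bar> ^ n" using C by (intro mult_left_mono power_mono) auto
    finally show "norm (f $ n) \<le> C * max 1 \<bar>R\<bar> ^ n" .
  qed
  thus ?thesis using C that by auto
qed

lemma geo_mult [intro!]: assumes "geometric f" "geometric g" shows "geometric (f * g)"
proof -
  obtain C R where f: "coeff_bound C R f" "0 \<le> C" "1 \<le> R" using assms(1) by (rule geoE)
  obtain D S where g: "coeff_bound D S g" "0 \<le> D" "1 \<le> S" using assms(2) by (rule geoE)
  have "coeff_bound C (max R S) f" "coeff_bound D (max R S) g"
    using f g by (auto intro: bd_mono[OF f(1)] bd_mono[OF g(1)])
  hence "coeff_bound (C * D) (2 * max R S) (f * g)" using f(3) by (intro bd_mult) auto
  thus ?thesis by (rule geoI)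
qed

lemma geo_add [intro!]: assumes "geometric f" "geometric g" shows "geometric (f + g)"
proof -
  obtain C R where f: "coeff_bound C R f" "0 \<le> C" "1 \<le> R" using assms(1) by (rule geoE)
  obtain D S where g: "coeff_bound D S g" "0 \<le> D" "1 \<le> S" using assms(2) by (rule geoE)
  have "coeff_bound C (max R S) f" "coeff_bound D (max R S) g"
    using f g by (auto intro: bd_mono[OF f(1)] bd_mono[OF g(1)])
  hence "coeff_bound (C + D) (max R S) (f + g)" unfolding coeff_bound_def fps_add_nth ring_distribs
    by (blast intro: norm_triangle_mono)
  thus ?thesis by (rule geoI)
qed

lemma geo_const [intro!]: "geometric (fps_const c)"
proof -
  have "coeff_bound (norm c) 1 (fps_const c)" by (auto simp: coeff_bound_def)
  thus ?thesis by (rule geoI)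
qed

lemma geo_1 [intro!]: "geometric 1" using geo_const[of 1] by simp

lemma geo_X [intro!]: "geometric fps_X"
proof -
  have "coeff_bound 1 1 fps_X" by (auto simp: coeff_bound_def fps_X_def)
  thus ?thesis by (rule geoI)
qed

lemma geo_power [intro!]: "geometric f \<Longrightarrow> geometric (f ^ n)"
  by (induction n) auto

lemma geo_diff [intro!]: assumes "geometric f" "geometric g" shows "geometric (f - g)"
proof -
  have *: "f - g = f + fps_const (-1) * g" by (rule fps_ext) simp
  show ?thesis unfolding * using assms by (intro geo_add geo_mult geo_const)
qed

section \<open>The functional L\<close>

context
  fixes q :: complex
  assumes q: "norm q < 1"
begin

lemma bd_ser:
  assumes A: "1 \<le> A" and c: "\<And>m. norm (c m) \<le> A ^ m" and d: "1 \<le> d"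
  shows "coeff_bound 1 A (sparse_fps d c)"
  unfolding coeff_bound_def
proof
  fix n
  show "norm (sparse_fps d c $ n) \<le> 1 * A ^ n"
  proof (cases "d dvd n")
    case True
    have "norm (c (n div d)) \<le> A ^ (n div d)" by (rule c)
    also have "\<dots> \<le> A ^ n" using A by (intro power_increasing) auto
    finally show ?thesis using True by (simp add: ser_nth)
  qed (use A in \<open>auto simp: ser_nth\<close>)
qed

lemma norm_qpoch_power_ge:
  assumes "1 \<le> d"
  shows "(1 - norm q) ^ m \<le> norm (qpoch (q ^ d) (q ^ d) m)"
proof (rule norm_qpoch_ge[OF _ q])
  show "norm (q ^ d) \<le> norm q"
    using power_decreasing[of 1 d "norm q"] assms q by (simp add: norm_power)
qed

lemma bd_ip:
  assumes "norm a \<le> A" "1 \<le> A" "1 \<le> d"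
  shows "coeff_bound 1 (A / (1 - norm q)) (inv_poch_fps q a d)"
  unfolding inv_poch_fps_def
proof (rule bd_ser)
  show "1 \<le> A / (1 - norm q)" using assms q norm_ge_zero[of q] by (simp add: field_simps del: norm_ge_zero)
  fix m
  have "norm (a ^ m / qpoch (q ^ d) (q ^ d) m) \<le> A ^ m / (1 - norm q) ^ m"
    unfolding norm_divide norm_power using assms q norm_qpoch_power_ge
    by (intro frac_le power_mono) auto
  thus "norm (a ^ m / qpoch (q ^ d) (q ^ d) m) \<le> (A / (1 - norm q)) ^ m" by (simp add: power_divide)
qed (use assms in auto)

lemma bd_np:
  assumes "norm a \<le> A" "1 \<le> A" "1 \<le> d"
  shows "coeff_bound 1 (A / (1 - norm q)) (poch_fps q a d)"
  unfolding poch_fps_def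
proof (rule bd_ser)
  show "1 \<le> A / (1 - norm q)" using assms q norm_ge_zero[of q] by (simp add: field_simps del: norm_ge_zero)
  fix m
  have "norm ((q ^ d) ^ (m choose 2)) \<le> 1"
    unfolding norm_power using q by (intro power_le_one) (auto intro: power_le_one)
  moreover have "norm a ^ m \<le> A ^ m" using assms by (intro power_mono) auto
  ultimately have "norm a ^ m * norm ((q ^ d) ^ (m choose 2)) \<le> A ^ m * 1"
    using assms by (intro mult_mono) auto
  hence "norm ((- a) ^ m * (q ^ d) ^ (m choose 2) / qpoch (q ^ d) (q ^ d) m) \<le> A ^ m / (1 - norm q) ^ m"
    unfolding norm_divide norm_mult norm_power[of "- a"] norm_minus_cancel
    using assms q norm_qpoch_power_ge by (intro frac_le) auto
  thus "norm ((- a) ^ m * (q ^ d) ^ (m choose 2) / qpoch (q ^ d) (q ^ d) m) \<le> (A / (1 - norm q)) ^ m"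
    by (simp add: power_divide)
qed (use assms in auto)

lemma geo_ip [intro!]: "1 \<le> d \<Longrightarrow> geometric (inv_poch_fps q a d)"
  and geo_np [intro!]: "1 \<le> d \<Longrightarrow> geometric (poch_fps q a d)"
  by (rule geoI[OF bd_ip[of a "max 1 (norm a)"]], auto)
     (rule geoI[OF bd_np[of a "max 1 (norm a)"]], auto)

text \<open>The quotient of consecutive terms is |q|^(n+1) R, which tends to 0 however large R
  is.\<close>

lemma summable_weight:
  assumes "0 \<le> R"
  shows "summable (\<lambda>n. C * (norm q ^ (Suc n choose 2) * R ^ n))"
proof (rule summable_mult)
  define r where "r = norm q"
  have r: "0 \<le> r" "r < 1" using q by (auto simp: r_def)
  have "(\<lambda>n. r ^ Suc n * R) \<longlonglongrightarrow> 0 * R"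
    using r by (intro tendsto_mult tendsto_const LIMSEQ_Suc LIMSEQ_power_zero) auto
  hence "\<forall>\<^sub>F n in sequentially. r ^ Suc n * R < 1 / 2"
    by (intro order_tendstoD) auto
  then obtain K where K: "\<And>n. n \<ge> K \<Longrightarrow> r ^ Suc n * R < 1 / 2"
    by (auto simp: eventually_sequentially)
  have "summable (\<lambda>n. r ^ (Suc n choose 2) * R ^ n)"
  proof (rule summable_ratio_test[where c = "1/2" and N = K])
    fix n assume n: "K \<le> n"
    have "r ^ (Suc (Suc n) choose 2) * R ^ Suc n
        = (r ^ Suc n * R) * (r ^ (Suc n choose 2) * R ^ n)"
      by (simp add: numeral_2_eq_2 power_add)
    also have "\<dots> \<le> 1 / 2 * (r ^ (Suc n choose 2) * R ^ n)"
      using K[OF n] assms r by (intro mult_right_mono) auto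
    finally show "norm (r ^ (Suc (Suc n) choose 2) * R ^ Suc n) \<le> 1 / 2 * norm (r ^ (Suc n choose 2) * R ^ n)"
      using assms r by simp
  qed simp
  thus "summable (\<lambda>n. norm q ^ (Suc n choose 2) * R ^ n)" by (simp add: r_def)
qed

definition L :: "complex fps \<Rightarrow> complex" where
  "L f = (\<Sum>n. q ^ (Suc n choose 2) * fps_nth f n)"

lemma norm_weight_le:
  assumes "coeff_bound C R f"
  shows "norm (q ^ (Suc n choose 2) * f $ n) \<le> C * (norm q ^ (Suc n choose 2) * R ^ n)"
proof -
  have "norm (f $ n) \<le> C * R ^ n" using assms by (auto simp: coeff_bound_def)
  hence "norm (q ^ (Suc n choose 2)) * norm (f $ n) \<le> norm (q ^ (Suc n choose 2)) * (C * R ^ n)"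
    by (intro mult_left_mono) auto
  thus ?thesis by (simp add: norm_mult norm_power mult_ac)
qed

lemma L_sums: 
  assumes "geometric f"
  shows "(\<lambda>n. q ^ (Suc n choose 2) * f $ n) sums L f"
proof -
  obtain C R where f: "coeff_bound C R f" "0 \<le> C" "1 \<le> R" using assms by (rule geoE)
  have "summable (\<lambda>n. q ^ (Suc n choose 2) * f $ n)"
    by (rule summable_comparison_test'[OF summable_weight[of R C]])
       (use f norm_weight_le[OF f(1)] in auto)
  thus ?thesis unfolding L_def by (rule summable_sums)
qed

lemma L_add:
  assumes "geometric f" "geometric g"
  shows "L (f + g) = L f + L g"
proof -
  have "(\<lambda>n. q ^ (Suc n choose 2) * (f + g) $ n) sums (L f + L g)"
    using sums_add[OF L_sums[OF assms(1)] L_sums[OF assms(2)]] by (simp add: algebra_simps)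
  with L_sums[OF geo_add[OF assms]] show ?thesis by (rule sums_unique2)
qed

lemma L_diff:
  assumes "geometric f" "geometric g"
  shows "L (f - g) = L f - L g"
proof -
  have "(\<lambda>n. q ^ (Suc n choose 2) * (f - g) $ n) sums (L f - L g)"
    using sums_diff[OF L_sums[OF assms(1)] L_sums[OF assms(2)]] by (simp add: algebra_simps)
  with L_sums[OF geo_diff[OF assms]] show ?thesis by (rule sums_unique2)
qed

lemma L_const:
  assumes "geometric f"
  shows "L (fps_const c * f) = c * L f"
proof -
  have "(\<lambda>n. q ^ (Suc n choose 2) * (fps_const c * f) $ n) sums (c * L f)"
    using sums_mult[OF L_sums[OF assms], of c] by (simp add: mult_ac)
  with L_sums[OF geo_mult[OF geo_const assms]] show ?thesis by (rule sums_unique2)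
qed

lemma L_X:
  assumes "geometric f"
  shows "L (fps_X * f) = q * L (dilate q f)"
proof -
  have g: "geometric (dilate q f)"
  proof -
    obtain C R where f: "coeff_bound C R f" "0 \<le> C" "1 \<le> R" using assms by (rule geoE)
    have "coeff_bound C R (dilate q f)" unfolding coeff_bound_def
    proof
      fix n
      have "norm (q ^ n) * norm (f $ n) \<le> 1 * (C * R ^ n)"
        using f q by (intro mult_mono) (auto simp: coeff_bound_def norm_power power_le_one)
      thus "norm (dilate q f $ n) \<le> C * R ^ n" by (simp add: norm_mult)
    qed
    thus ?thesis by (rule geoI)
  qed
  \<comment> \<open>The constant coefficient of x f vanishes, so the sum may start at 1; then (n+2
    choose 2) = (n+1 choose 2) + n + 1 splits the weight into q, the dilation factor q^n and the
    weight at n.\<close>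
  have "(\<lambda>n. q ^ (Suc (Suc n) choose 2) * (fps_X * f) $ Suc n) sums (L (fps_X * f) - q ^ (Suc 0 choose 2) * (fps_X * f) $ 0)"
    by (subst sums_Suc_iff) (use L_sums[OF geo_mult[OF geo_X assms]] in simp)
  also have "(\<lambda>n. q ^ (Suc (Suc n) choose 2) * (fps_X * f) $ Suc n) = (\<lambda>n. q * (q ^ (Suc n choose 2) * dilate q f $ n))"
    by (auto simp: numeral_2_eq_2 power_add mult_ac)
  finally show ?thesis using sums_mult[OF L_sums[OF g], of q] sums_unique2 by fastforce
qed

text \<open>Tannery's theorem: a bound C R^n uniform in k yields a summable majorant, so
  coefficientwise convergence passes through L. This is what allows the limits c -> 0 and e ->
  0.\<close>

lemma L_tendsto:
  assumes b: "\<And>k. coeff_bound C R (f k)" and R: "0 \<le> R" and t: "\<And>n. (\<lambda>k. f k $ n) \<longlonglongrightarrow> g $ n"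
  shows "(\<lambda>k. L (f k)) \<longlonglongrightarrow> L g"
  unfolding L_def
proof (rule tannerys_theorem[where M = "\<lambda>n. C * (norm q ^ (Suc n choose 2) * R ^ n)",
    THEN conjunct2, THEN conjunct2])
  show "\<forall>\<^sub>F (x, y) in at_top \<times>\<^sub>F sequentially.
     norm (q ^ (Suc x choose 2) * f y $ x) \<le> C * (norm q ^ (Suc x choose 2) * R ^ x)"
    using norm_weight_le[OF b] by (auto intro!: always_eventually)
  show "summable (\<lambda>n. C * (norm q ^ (Suc n choose 2) * R ^ n))" by (rule summable_weight[OF R])
qed (auto intro!: tendsto_intros t)

end

section \<open>Quadruple sums and first-order recurrences\<close>

text \<open>Expresses that g is the generating series of the weights c graded by \<open>dg\<close>.
  Finiteness of the fibres is part of it because a sum over an infinite set would default to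
  0.\<close>

definition fibre_sums :: "('i \<Rightarrow> nat) \<Rightarrow> ('i \<Rightarrow> complex) \<Rightarrow> complex fps \<Rightarrow> bool" where
  "fibre_sums dg c g \<longleftrightarrow> (\<forall>N. finite {i. dg i = N} \<and> fps_nth g N = (\<Sum>i | dg i = N. c i))"

lemma rep_ser:
  assumes "1 \<le> d"
  shows "fibre_sums (\<lambda>m. d * m) c (sparse_fps d c)"
  unfolding fibre_sums_def
proof
  fix N
  have "{m. d * m = N} = (if d dvd N then {N div d} else {})" using assms by auto
  thus "finite {m. d * m = N} \<and> sparse_fps d c $ N = (\<Sum>m | d * m = N. c m)" by (simp add: ser_nth)
qed

lemma rep_mult:
  assumes f: "fibre_sums dg c f" and g: "fibre_sums dh e g"
  shows "fibre_sums (\<lambda>(i, j). dg i + dh j) (\<lambda>(i, j). c i * e j) (f * g)"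
  unfolding fibre_sums_def
proof
  fix N
  have S: "{x. (case x of (i, j) \<Rightarrow> dg i + dh j) = N} = (\<Union>a\<in>{0..N}. {i. dg i = a} \<times> {j. dh j = N - a})"
    by auto
  have fin: "finite {i. dg i = a}" "finite {j. dh j = a}" for a using f g by (auto simp: fibre_sums_def)
  have "(\<Sum>x | (case x of (i, j) \<Rightarrow> dg i + dh j) = N. case x of (i, j) \<Rightarrow> c i * e j)
      = (\<Sum>a=0..N. \<Sum>x\<in>{i. dg i = a} \<times> {j. dh j = N - a}. case x of (i, j) \<Rightarrow> c i * e j)"
    unfolding S by (rule sum.UNION_disjoint) (auto simp: fin)
  also have "\<dots> = (\<Sum>a=0..N. f $ a * g $ (N - a))"
    using f g by (intro sum.cong) (auto simp: fibre_sums_def sum_product sum.cartesian_product)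
  finally show "finite {x. (case x of (i, j) \<Rightarrow> dg i + dh j) = N} \<and>
      (f * g) $ N = (\<Sum>x | (case x of (i, j) \<Rightarrow> dg i + dh j) = N. case x of (i, j) \<Rightarrow> c i * e j)"
    unfolding S by (auto simp: fin fps_mult_nth)
qed

lemma fps_mult_tendsto:
  assumes "\<And>n. (\<lambda>k. f k $ n) \<longlonglongrightarrow> f0 $ n" "\<And>n. (\<lambda>k. g k $ n) \<longlonglongrightarrow> (g0 :: complex fps) $ n"
  shows "(\<lambda>k. (f k * g k) $ n) \<longlonglongrightarrow> (f0 * g0) $ n"
  unfolding fps_mult_nth by (intro tendsto_intros assms)

lemma ser_tendsto_1:
  assumes "1 \<le> d" "a \<longlonglongrightarrow> 0" "w 0 = 1"
  shows "(\<lambda>k. sparse_fps d (\<lambda>m. a k ^ m * w m) $ n) \<longlonglongrightarrow> (1 :: complex fps) $ n"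
proof (cases "d dvd n")
  case True
  have "(\<lambda>k. a k ^ (n div d) * w (n div d)) \<longlonglongrightarrow> 0 ^ (n div d) * w (n div d)"
    by (intro tendsto_intros assms)
  moreover have "0 ^ (n div d) * w (n div d) = (1 :: complex fps) $ n"
    using True assms by (auto simp: power_0_left elim: dvdE)
  ultimately show ?thesis using True by (simp add: ser_nth)
next
  case False
  hence "n \<noteq> 0" by (metis dvd_0_right)
  thus ?thesis using False by (simp add: ser_nth)
qed

lemma ip_tendsto_1: "1 \<le> d \<Longrightarrow> a \<longlonglongrightarrow> 0 \<Longrightarrow> (\<lambda>k. inv_poch_fps q (a k) d $ n) \<longlonglongrightarrow> (1 :: complex fps) $ n"
  unfolding inv_poch_fps_def using ser_tendsto_1[of d a "\<lambda>m. 1 / qpoch (q ^ d) (q ^ d) m"] by simp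

lemma np_tendsto_1:
  assumes "1 \<le> d" "a \<longlonglongrightarrow> 0"
  shows "(\<lambda>k. poch_fps q (a k) d $ n) \<longlonglongrightarrow> (1 :: complex fps) $ n"
proof -
  have "(\<lambda>k. - a k) \<longlonglongrightarrow> 0" using tendsto_minus[OF assms(2)] by simp
  thus ?thesis
    unfolding poch_fps_def
    using ser_tendsto_1[of d "\<lambda>k. - a k" "\<lambda>m. (q ^ d) ^ (m choose 2) / qpoch (q ^ d) (q ^ d) m"] assms(1)
    by (simp add: numeral_2_eq_2)
qed

text \<open>Its coefficients solve the triangular linear system obtained by comparing powers of x in
the identity \<open>certificate_e\<close>.\<close>

definition certificate_poly :: "'a :: idom \<Rightarrow> 'a \<Rightarrow> 'a \<Rightarrow> 'a" where
  "certificate_poly e Q x =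
       (- (e ^ 1 * Q ^ 1) + e ^ 1 * Q ^ 2 - e ^ 3 * Q ^ 6 - e ^ 4 * Q ^ 7)
     + (e ^ 2 * Q ^ 1 - e ^ 2 * Q ^ 2 - e ^ 3 * Q ^ 4 - e ^ 3 * Q ^ 5 - e ^ 4 * Q ^ 5 - e ^ 4 * Q ^ 6 - e ^ 4 * Q ^ 7 - e ^ 5 * Q ^ 8) * x ^ 1
     + (- (e ^ 3 * Q ^ 3) - e ^ 4 * Q ^ 3 - e ^ 4 * Q ^ 4 - e ^ 4 * Q ^ 5 - e ^ 5 * Q ^ 5 + e ^ 6 * Q ^ 8) * x ^ 2
     + (- (e ^ 4 * Q ^ 2) + e ^ 5 * Q ^ 5 + e ^ 6 * Q ^ 5 + e ^ 6 * Q ^ 6 + e ^ 6 * Q ^ 7 + e ^ 7 * Q ^ 7) * x ^ 3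
     + (e ^ 5 * Q ^ 2 + e ^ 6 * Q ^ 3 + e ^ 6 * Q ^ 4 + e ^ 6 * Q ^ 5 + e ^ 7 * Q ^ 5 + e ^ 7 * Q ^ 6 + e ^ 8 * Q ^ 8 - e ^ 8 * Q ^ 9) * x ^ 4
     + (e ^ 6 * Q ^ 3 + e ^ 7 * Q ^ 4 - e ^ 9 * Q ^ 8 + e ^ 9 * Q ^ 9) * x ^ 5"

text \<open>Q and e stand for constant series, x for the variable and K for the infinite products
  shared by all terms. The left side is q C(qx) - x C(x), where C is
  \<open>certificate_poly e Q x\<close> times a series J that, like J(qx), is a polynomial multiple
  of K; the bracket on the right holds the two members of the family with the coefficients of their
  recurrence.\<close>

lemma certificate_e:
  fixes x Q e K :: "'a :: idom"
  shows "Q * (certificate_poly e Q (Q * x) * ((1 - x) * (1 - Q * e ^ 2 * x ^ 2) * (1 - e ^ 3 * x ^ 3) * K))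
      - x * (certificate_poly e Q x * ((1 - e ^ 2 * Q ^ 2 * x ^ 2) * (1 + Q ^ 6 * e ^ 3 * x ^ 2) * K))
    = Q * ((1 + Q ^ 2 * e) * ((1 + e * x) * (1 - e ^ 2 * x ^ 2) * (1 - e ^ 2 * Q ^ 2 * x ^ 2)
              * (1 + Q ^ 2 * e ^ 3 * x ^ 2) * (1 + Q ^ 4 * e ^ 3 * x ^ 2) * (1 + Q ^ 6 * e ^ 3 * x ^ 2) * K)
          - (1 + Q * e) * (1 + Q ^ 6 * e ^ 3) * ((1 + e * Q ^ 2 * x) * (1 - Q * e ^ 2 * x ^ 2)
              * (1 - Q ^ 3 * e ^ 2 * x ^ 2) * (1 - e ^ 3 * x ^ 3) * (1 - Q ^ 3 * e ^ 3 * x ^ 3) * K))"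
  unfolding certificate_poly_def by algebra

text \<open>Here i plays the role of 1/q. The sides agree only modulo Q i - 1, so the proof exhibits
  the multiple of Q i - 1 by which they differ. The certificate i x carries the argument of the
  fourth combination to the member c = -1/q^2 of the first family.\<close>

lemma certificate_4:
  fixes x Q i K :: "'a :: idom"
  assumes "Q * i = 1"
  shows "Q * (x * ((1 - Q * x ^ 2) * (1 - i ^ 2 * x ^ 3) * K)) - x * (i * x * ((1 + x) * (1 + x ^ 2) * K))
    = Q * ((1 - i ^ 2 * x ^ 3) * (1 + x + x ^ 2 - Q * x ^ 3) * K - (1 + i ^ 2 * x ^ 2) * (1 + x ^ 2) * K)"
proof -
  have "Q * (x * ((1 - Q * x ^ 2) * (1 - i ^ 2 * x ^ 3) * K)) - x * (i * x * ((1 + x) * (1 + x ^ 2) * K))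
    = Q * ((1 - i ^ 2 * x ^ 3) * (1 + x + x ^ 2 - Q * x ^ 3) * K - (1 + i ^ 2 * x ^ 2) * (1 + x ^ 2) * K)
      + (1 + x ^ 2) * x ^ 2 * (1 + x) * i * (Q * i - 1) * K"
    by algebra
  thus ?thesis using assms by simp
qed

context
  fixes q :: complex
  assumes q: "norm q < 1"
begin

text \<open>The q-power depends on the degree alone, so an absolutely convergent sum may be
  regrouped along the fibres of \<open>dg\<close>, each of which contributes one coefficient of
  g.\<close>

lemma infsum_rep:
  assumes r: "fibre_sums dg c g" and g: "geometric g"
    and s: "(\<lambda>i. norm (q ^ (Suc (dg i) choose 2) * c i)) summable_on UNIV"
  shows "(\<Sum>\<^sub>\<infinity>i\<in>UNIV. q ^ (Suc (dg i) choose 2) * c i) = L q g"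
proof -
  define f where "f = (\<lambda>i. q ^ (Suc (dg i) choose 2) * c i)"
  have "(f has_sum infsum f UNIV) UNIV"
    unfolding f_def by (rule has_sum_infsum[OF abs_summable_summable[OF s]])
  moreover have img: "Sigma UNIV (\<lambda>N. {i. dg i = N}) = (\<lambda>i. (dg i, i)) ` UNIV"
    by auto
  ultimately have "((\<lambda>(N, i). f i) has_sum infsum f UNIV) (Sigma UNIV (\<lambda>N. {i. dg i = N}))"
    unfolding img by (subst has_sum_reindex) (simp_all add: inj_on_def o_def)
  moreover have "(f has_sum (q ^ (Suc N choose 2) * g $ N)) {i. dg i = N}" for N
  proof -
    have fin: "finite {i. dg i = N}" and val: "g $ N = (\<Sum>i | dg i = N. c i)"
      using r unfolding fibre_sums_def by blast+
    have "q ^ (Suc N choose 2) * g $ N = sum f {i. dg i = N}"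
      unfolding val sum_distrib_left f_def by (rule sum.cong) simp_all
    thus ?thesis using has_sum_finite[OF fin, of f] by simp
  qed
  ultimately have "((\<lambda>N. q ^ (Suc N choose 2) * g $ N) has_sum infsum f UNIV) UNIV"
    using has_sum_SigmaD[where f = "\<lambda>(N, i). f i" and A = UNIV and B = "\<lambda>N. {i. dg i = N}"] by simp
  hence "(\<lambda>N. q ^ (Suc N choose 2) * g $ N) sums infsum f UNIV" by (rule has_sum_imp_sums)
  with L_sums[OF q g] show ?thesis unfolding f_def by (rule sums_unique2[symmetric])
qed

text \<open>The weight of L has (N+1 choose 2) = (N choose 2) + N in the exponent; the extra q^N
  comes from the factors q, q^2, q^3, q^4 of the arguments. The sign and 2 l^2 - 2 l = 4 (l choose
  2) belong to Euler's expansion of (t x^4; q^4).\<close>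

lemma F_eq_L:
  "F q (q * u) (q ^ 2 * v) (q ^ 3 * w) (q ^ 4 * t)
     = L q (inv_poch_fps q u 1 * (inv_poch_fps q v 2 * (inv_poch_fps q w 3 * poch_fps q t 4)))"
proof -
  define dg :: "nat \<times> nat \<times> nat \<times> nat \<Rightarrow> nat" where
    "dg = (\<lambda>(i, y). 1 * i + (case y of (j, z) \<Rightarrow> 2 * j + (case z of (k, l) \<Rightarrow> 3 * k + 4 * l)))"
  define c where "c = (\<lambda>(i, y). u ^ i / qpoch (q ^ 1) (q ^ 1) i * (case y of (j, z) \<Rightarrow>
     v ^ j / qpoch (q ^ 2) (q ^ 2) j * (case z of (k, l) \<Rightarrow>
       w ^ k / qpoch (q ^ 3) (q ^ 3) k * ((- t) ^ l * (q ^ 4) ^ (l choose 2) / qpoch (q ^ 4) (q ^ 4) l))))"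
  have r: "fibre_sums dg c (inv_poch_fps q u 1 * (inv_poch_fps q v 2 * (inv_poch_fps q w 3 * poch_fps q t 4)))"
    unfolding dg_def c_def inv_poch_fps_def poch_fps_def by (intro rep_mult rep_ser) auto
  have e: "F_term q (q * u) (q ^ 2 * v) (q ^ 3 * w) (q ^ 4 * t) x = q ^ (Suc (dg x) choose 2) * c x" for x
  proof -
    obtain i j k l where x: "x = (i, j, k, l)" by (cases x) auto
    have l: "2 * l\<^sup>2 - 2 * l = 4 * (l choose 2)"
    proof -
      have "even (l * (l - 1))" by (cases l) auto
      hence "2 * (l choose 2) = l * (l - 1)" by (simp add: choose_two)
      thus ?thesis by (simp add: power2_eq_square diff_mult_distrib2 algebra_simps)
    qed
    define N where "N = i + 2 * j + 3 * k + 4 * l"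
    have N: "Suc N choose 2 = N + (N choose 2)" by (simp add: numeral_2_eq_2)
    have qN: "q ^ N = q ^ i * (q ^ 2) ^ j * (q ^ 3) ^ k * (q ^ 4) ^ l"
      by (simp add: N_def power_add power_mult)
    have m: "(- t) ^ l = (- 1) ^ l * t ^ l" by (rule power_minus)
    have "dg x = N" by (simp add: dg_def x N_def)
    thus ?thesis
      by (simp only: F_term_def c_def x prod.case N_def [symmetric] N l power_add qN m power_mult power_one_right)
         (simp add: power_mult_distrib mult_ac)
  qed
  have "(\<Sum>\<^sub>\<infinity>x\<in>UNIV. q ^ (Suc (dg x) choose 2) * c x) = L q (inv_poch_fps q u 1 * (inv_poch_fps q v 2 * (inv_poch_fps q w 3 * poch_fps q t 4)))"
    using F_term_summable[OF q, of "q * u" "q ^ 2 * v" "q ^ 3 * w" "q ^ 4 * t"]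
    by (intro infsum_rep r) (auto simp: e intro!: geo_mult geo_ip geo_np q)
  thus ?thesis unfolding F_def e .
qed

text \<open>By \<open>L_X\<close>, q L(C(qx)) = L(x C), so L annihilates the left side of the
  hypothesis e. This turns a certificate C into a relation between two values of L.\<close>

lemma L_relation:
  assumes "geometric C" "geometric A" "geometric B" "q \<noteq> 0"
    and e: "fps_const q * dilate q C - fps_X * C = fps_const q * (A - fps_const k * B)"
  shows "L q A = k * L q B"
proof -
  note [simp] = L_diff[OF q] L_const[OF q] L_X[OF q] geo_diff geo_mult geo_const geo_X assms(1-3)
  \<comment> \<open>Growth of C(qx) is read off from the relation itself, solved for C(qx).\<close>
  have gd: "geometric (dilate q C)"
  proof -
    have "fps_const q * dilate q C = fps_const q * (A - fps_const k * B) + fps_X * C"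
      using e by (simp add: algebra_simps)
    hence "dilate q C = fps_const (1 / q) * (fps_const q * (A - fps_const k * B) + fps_X * C)"
      using \<open>q \<noteq> 0\<close> by (metis fps_const_1_eq_1 fps_const_mult mult.assoc mult_1 nonzero_divide_eq_eq)
    thus ?thesis by (simp add: geo_add)
  qed
  have "L q (fps_const q * dilate q C - fps_X * C) = 0" using gd by simp
  hence "q * (L q A - k * L q B) = 0" unfolding e by simp
  thus ?thesis using \<open>q \<noteq> 0\<close> by simp
qed

end

text \<open>The certificate is c Q (Q^2 + x) times a series K; K, K(qx) and both members of the
  family are polynomial multiples of H.\<close>

lemma certificate_c:
  fixes x Q c H :: "'a :: idom"
  shows "Q * (c * Q * (Q ^ 2 + Q * x) * ((1 + c * x ^ 3) * (1 - Q * x ^ 2) * H))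
      - x * (c * Q * (Q ^ 2 + x) * ((1 + x) * (1 - c * Q ^ 4 * x ^ 2) * H))
    = Q * ((1 - c * x ^ 2) * (1 - c * Q ^ 2 * x ^ 2) * (1 - c * Q ^ 4 * x ^ 2) * H
          - (1 - c * Q ^ 3) * ((1 + c * x ^ 3) * (1 + c * Q ^ 3 * x ^ 3) * H))"
  by algebra

lemma bd_mult1:
  assumes "coeff_bound 1 R f" "coeff_bound 1 S g" "1 \<le> R" "1 \<le> S"
  shows "coeff_bound 1 (2 * (R + S)) (f * g)"
proof -
  have "coeff_bound 1 (R + S) f" "coeff_bound 1 (R + S) g"
    using assms by (auto intro: bd_mono[OF assms(1)] bd_mono[OF assms(2)])
  from bd_mult[OF this] assms show ?thesis by simp
qed

lemma geo_uminus [intro!]: "geometric f \<Longrightarrow> geometric (- f)"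
  by (simp add: geometric_def coeff_bound_def)

lemma qpoch_tendsto: "norm p < 1 \<Longrightarrow> (\<lambda>n. qpoch a p n) \<longlonglongrightarrow> qpoch_inf a p"
  unfolding qpoch_def by (rule has_prod_imp_tendsto'[OF has_prod_qpoch_inf])

definition family_c :: "complex \<Rightarrow> complex \<Rightarrow> complex fps" where
  "family_c q c = poch_fps q (- q) 1 * (poch_fps q c 2 * (inv_poch_fps q (- c) 3 * inv_poch_fps q q 2))"

definition family_e :: "complex \<Rightarrow> complex \<Rightarrow> complex fps" where
  "family_e q e = (1 + fps_const e * fps_X) * (poch_fps q (e ^ 2) 2 * (poch_fps q (- (q ^ 2 * e ^ 3)) 2 *
     (inv_poch_fps q 1 1 * (inv_poch_fps q (q * e ^ 2) 2 * inv_poch_fps q (e ^ 3) 3))))"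

context
  fixes q :: complex
  assumes q: "norm q < 1"
begin

lemma np_shift':
  assumes "1 \<le> d" "b = a * q ^ d"
  shows "poch_fps q a d = (1 - fps_const a * fps_X ^ d) * poch_fps q b d"
  unfolding assms(2) by (rule np_shift[OF q assms(1)])

lemma ip_shift':
  assumes "1 \<le> d" "b = a * q ^ d"
  shows "inv_poch_fps q b d = (1 - fps_const a * fps_X ^ d) * inv_poch_fps q a d"
  unfolding assms(2) by (rule ip_shift[OF q assms(1)])

lemma geo_Gc [intro!]: "geometric (family_c q c)" and geo_Ge [intro!]: "geometric (family_e q e)"
  unfolding family_c_def family_e_def
  by (auto intro!: geo_mult geo_ip geo_np geo_add geo_1 geo_const geo_X q)

text \<open>The exponent 6 is the least common multiple of 2 and 3: under c -> c q^6 the product (c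
  x^2; q^2) loses three factors and (-c x^3; q^3) two.\<close>

lemma L_Gc_rec:
  assumes "q \<noteq> 0"
  shows "L q (family_c q c) = (1 - c * q ^ 3) * L q (family_c q (c * q ^ 6))"
proof -
  define x where "x = (fps_X :: complex fps)"
  define Q where "Q = fps_const q"
  define c' where "c' = fps_const c"
  define H where "H = poch_fps q (- q) 1 * (poch_fps q (c * q ^ 6) 2 * (inv_poch_fps q (- c) 3 * inv_poch_fps q q 2))"
  \<comment> \<open>Shifted by one step in each numerator product relative to H, so that both K and
    its dilation reduce to H by linear or polynomial factors.\<close>
  define K where "K = poch_fps q (- 1) 1 * (poch_fps q (c * q ^ 4) 2 * (inv_poch_fps q (- c) 3 * inv_poch_fps q q 2))"
  define C where "C = c' * Q * (Q ^ 2 + x) * K"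
  have n1: "poch_fps q (- 1) 1 = (1 + x) * poch_fps q (- q) 1"
    using np_shift'[of 1 "- q" "- 1"] by (simp add: x_def flip: fps_const_neg)
  have n2: "poch_fps q (c * q ^ 4) 2 = (1 - c' * Q ^ 4 * x ^ 2) * poch_fps q (c * q ^ 6) 2"
    using np_shift'[of 2 "c * q ^ 6" "c * q ^ 4"] by (simp add: x_def c'_def Q_def)
  have n3: "poch_fps q c 2 = (1 - c' * x ^ 2) * ((1 - c' * Q ^ 2 * x ^ 2) * poch_fps q (c * q ^ 4) 2)"
    using np_shift'[of 2 "c * q ^ 2" c] np_shift'[of 2 "c * q ^ 4" "c * q ^ 2"]
    by (simp add: x_def c'_def Q_def)
  have i1: "inv_poch_fps q (- (c * q ^ 3)) 3 = (1 + c' * x ^ 3) * inv_poch_fps q (- c) 3"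
    using ip_shift'[of 3 "- (c * q ^ 3)" "- c"] by (simp add: x_def c'_def flip: fps_const_neg)
  have i2: "inv_poch_fps q (- (c * q ^ 6)) 3 = (1 + c' * Q ^ 3 * x ^ 3) * inv_poch_fps q (- (c * q ^ 3)) 3"
    using ip_shift'[of 3 "- (c * q ^ 6)" "- (c * q ^ 3)"]
    by (simp add: x_def c'_def Q_def flip: fps_const_neg)
  have i3: "inv_poch_fps q (q * q ^ 2) 2 = (1 - Q * x ^ 2) * inv_poch_fps q q 2"
    using ip_shift'[of 2 "q * q ^ 2" q] by (simp add: x_def Q_def)
  have K: "K = (1 + x) * (1 - c' * Q ^ 4 * x ^ 2) * H"
    unfolding K_def H_def n1 n2 by (simp only: mult_ac)
  have dx: "dilate q x = Q * x" by (simp add: x_def Q_def dil_X)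
  have dc: "dilate q c' = c'" "dilate q Q = Q" by (simp_all add: c'_def Q_def)
  have dK: "dilate q K = (1 + c' * x ^ 3) * (1 - Q * x ^ 2) * H"
  proof -
    have "dilate q K = poch_fps q (- q) 1 * (poch_fps q (c * q ^ 6) 2 * (inv_poch_fps q (- (c * q ^ 3)) 3 * inv_poch_fps q (q * q ^ 2) 2))"
    proof -
      have a: "c * q ^ 4 * q ^ 2 = c * q ^ 6" "- 1 * q ^ 1 = - q" "- c * q ^ 3 = - (c * q ^ 3)"
        by (simp_all add: eval_nat_numeral)
      show ?thesis by (simp only: K_def dil_mult dil_np dil_ip a)
    qed
    thus ?thesis unfolding i1 i3 H_def by (simp only: mult_ac)
  qed
  have G1: "family_c q c = (1 - c' * x ^ 2) * (1 - c' * Q ^ 2 * x ^ 2) * (1 - c' * Q ^ 4 * x ^ 2) * H"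
    unfolding family_c_def H_def n3 n2 by (simp only: mult_ac)
  have G2: "family_c q (c * q ^ 6) = (1 + c' * x ^ 3) * (1 + c' * Q ^ 3 * x ^ 3) * H"
    unfolding family_c_def H_def i2 i1 by (simp only: mult_ac)
  have k: "fps_const (1 - c * q ^ 3) = 1 - c' * Q ^ 3"
    by (simp add: c'_def Q_def flip: fps_const_1_eq_1)
  have dC: "dilate q C = c' * Q * (Q ^ 2 + Q * x) * ((1 + c' * x ^ 3) * (1 - Q * x ^ 2) * H)"
    by (simp only: C_def dil_mult dil_add dil_power dx dc dK)
  have C': "C = c' * Q * (Q ^ 2 + x) * ((1 + x) * (1 - c' * Q ^ 4 * x ^ 2) * H)"
    by (simp only: C_def K)
  have "Q * dilate q C - x * C = Q * (family_c q c - fps_const (1 - c * q ^ 3) * family_c q (c * q ^ 6))"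
    unfolding dC k G1 G2 unfolding C' using certificate_c[of Q c' x H] by (simp only: mult.assoc)
  moreover have "geometric C" unfolding C_def K_def c'_def Q_def x_def
    by (auto intro!: geo_mult geo_ip geo_np geo_add geo_const geo_X geo_power q simp del: fps_const_power)
  ultimately show ?thesis unfolding Q_def x_def by (intro L_relation[OF q]) (auto simp: assms)
qed

text \<open>Iteration collects the factors 1 - c q^(6k+3), while c q^(6n) -> 0 sends the remaining
  argument coefficientwise to the member c = 0.\<close>

lemma L_Gc:
  assumes q0: "q \<noteq> 0"
  shows "L q (family_c q c) = qpoch_inf (c * q ^ 3) (q ^ 6) * L q (poch_fps q (- q) 1 * inv_poch_fps q q 2)"
proof (rule LIMSEQ_unique)
  have "L q (family_c q c) = qpoch (c * q ^ 3) (q ^ 6) n * L q (family_c q (c * (q ^ 6) ^ n))" for n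
  proof (induction n)
    case (Suc n)
    show ?case unfolding Suc.IH L_Gc_rec[OF q0, of "c * (q ^ 6) ^ n"]
      by (simp add: qpoch_Suc mult_ac)
  qed simp
  thus "(\<lambda>n. qpoch (c * q ^ 3) (q ^ 6) n * L q (family_c q (c * (q ^ 6) ^ n))) \<longlonglongrightarrow> L q (family_c q c)"
    by simp
  define R where "R = max 1 (norm c) / (1 - norm q)"
  have R: "1 \<le> R" unfolding R_def using q norm_ge_zero[of q] by (simp add: field_simps del: norm_ge_zero)
  have n6: "norm (q ^ 6) < 1" using norm_power_less_1[OF q] by simp
  have c: "norm (c * (q ^ 6) ^ n) \<le> max 1 (norm c)" for n
  proof -
    have "norm ((q ^ 6) ^ n) \<le> 1" using n6 by (simp add: norm_power power_le_one)
    hence "norm c * norm ((q ^ 6) ^ n) \<le> norm c * 1" by (intro mult_left_mono) auto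
    thus ?thesis by (simp add: norm_mult)
  qed
  \<comment> \<open>\<open>bd_mult1\<close> combines rates R and S to 2 (R + S), so the constant
    mirrors the nesting of the four factors.\<close>
  have b: "coeff_bound 1 (2 * (R + 2 * (R + 2 * (R + R)))) (family_c q (c * (q ^ 6) ^ n))" for n
    unfolding family_c_def using c[of n] R q unfolding R_def
    by (intro bd_mult1 bd_np[OF q] bd_ip[OF q]) auto
  have t0: "(\<lambda>n. c * (q ^ 6) ^ n) \<longlonglongrightarrow> 0"
    using tendsto_mult[OF tendsto_const LIMSEQ_power_zero[OF n6], of c] by simp
  have t1: "(\<lambda>n. - (c * (q ^ 6) ^ n)) \<longlonglongrightarrow> 0"
    using tendsto_minus[OF t0] by simp
  have "(\<lambda>k. family_c q (c * (q ^ 6) ^ k) $ n) \<longlonglongrightarrow> (poch_fps q (- q) 1 * (1 * (1 * inv_poch_fps q q 2))) $ n" for n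
    unfolding family_c_def
    by (intro fps_mult_tendsto tendsto_const np_tendsto_1[OF _ t0] ip_tendsto_1[OF _ t1]) auto
  hence "(\<lambda>k. L q (family_c q (c * (q ^ 6) ^ k))) \<longlonglongrightarrow> L q (poch_fps q (- q) 1 * (1 * (1 * inv_poch_fps q q 2)))"
    using R by (intro L_tendsto[OF q b]) auto
  thus "(\<lambda>n. qpoch (c * q ^ 3) (q ^ 6) n * L q (family_c q (c * (q ^ 6) ^ n))) \<longlonglongrightarrow>
      qpoch_inf (c * q ^ 3) (q ^ 6) * L q (poch_fps q (- q) 1 * inv_poch_fps q q 2)"
    by (intro tendsto_mult qpoch_tendsto n6) simp
qed

text \<open>Euler's sum of q^(n(n+1)/2) a^n / (q; q)_n. Multiplying by 1 - b x and moving x through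
  L relates the values at b and b q by the factor 1 + b q, and iteration builds the product.\<close>

lemma L_ip: "L q (inv_poch_fps q a 1) = qpoch_inf (- (a * q)) q"
proof (rule LIMSEQ_unique)
  have rec: "L q (inv_poch_fps q b 1) = (1 + b * q) * L q (inv_poch_fps q (b * q) 1)" for b
  proof -
    have g: "geometric (inv_poch_fps q d 1)" for d using geo_ip[OF q] by simp
    have "inv_poch_fps q (b * q) 1 = inv_poch_fps q b 1 - fps_const b * (fps_X * inv_poch_fps q b 1)"
    proof -
      have "inv_poch_fps q (b * q) 1 = (1 - fps_const b * fps_X) * inv_poch_fps q b 1"
        using ip_shift'[of 1 "b * q" b] by (simp only: power_one_right le_refl)
      also have "\<dots> = inv_poch_fps q b 1 - fps_const b * (fps_X * inv_poch_fps q b 1)"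
        by (simp only: left_diff_distrib mult_1 mult.assoc)
      finally show ?thesis .
    qed
    hence "L q (inv_poch_fps q (b * q) 1) = L q (inv_poch_fps q b 1 - fps_const b * (fps_X * inv_poch_fps q b 1))"
      by (rule arg_cong)
    also have "\<dots> = L q (inv_poch_fps q b 1) - b * (q * L q (dilate q (inv_poch_fps q b 1)))"
      using g by (simp only: L_diff[OF q] L_const[OF q] L_X[OF q] geo_mult geo_X geo_const)
    finally have "L q (inv_poch_fps q (b * q) 1) = L q (inv_poch_fps q b 1) - b * (q * L q (inv_poch_fps q (b * q) 1))"
      by (simp only: dil_ip power_one_right)
    thus ?thesis by (simp add: algebra_simps)
  qed
  have "L q (inv_poch_fps q a 1) = qpoch (- (a * q)) q n * L q (inv_poch_fps q (a * q ^ n) 1)" for n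
  proof (induction n)
    case (Suc n)
    show ?case unfolding Suc.IH rec[of "a * q ^ n"] by (simp add: qpoch_Suc mult_ac)
  qed simp
  thus "(\<lambda>n. qpoch (- (a * q)) q n * L q (inv_poch_fps q (a * q ^ n) 1)) \<longlonglongrightarrow> L q (inv_poch_fps q a 1)" by simp
  define R where "R = max 1 (norm a) / (1 - norm q)"
  have R: "1 \<le> R" unfolding R_def using q norm_ge_zero[of q] by (simp add: field_simps del: norm_ge_zero)
  have b: "coeff_bound 1 R (inv_poch_fps q (a * q ^ n) 1)" for n
  proof -
    have "norm (q ^ n) \<le> 1" using q by (simp add: norm_power power_le_one)
    hence "norm a * norm (q ^ n) \<le> norm a * 1" by (intro mult_left_mono) auto
    thus ?thesis unfolding R_def by (intro bd_ip[OF q]) (auto simp: norm_mult)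
  qed
  have t0: "(\<lambda>n. a * q ^ n) \<longlonglongrightarrow> 0"
    using tendsto_mult[OF tendsto_const LIMSEQ_power_zero[OF q], of a] by simp
  have L1: "L q 1 = 1"
  proof -
    have "(\<lambda>n. q ^ (Suc n choose 2) * (1 :: complex fps) $ n) sums 1"
      using sums_single[of 0 "\<lambda>n. q ^ (Suc n choose 2) * (1 :: complex fps) $ n"]
      by (simp add: numeral_2_eq_2 if_distrib cong: if_cong)
    with L_sums[OF q geo_1] show ?thesis by (rule sums_unique2)
  qed
  have "(\<lambda>k. L q (inv_poch_fps q (a * q ^ k) 1)) \<longlonglongrightarrow> L q 1"
    using R by (intro L_tendsto[OF q b] ip_tendsto_1[OF _ t0]) auto
  thus "(\<lambda>n. qpoch (- (a * q)) q n * L q (inv_poch_fps q (a * q ^ n) 1)) \<longlonglongrightarrow> qpoch_inf (- (a * q)) q"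
    using tendsto_mult[OF qpoch_tendsto[OF q, of "- (a * q)"]] L1 by fastforce
qed

text \<open>Under e -> e q^2 the products in e^2 x^2, q e^2 x^2 and e^3 x^3 lose two factors each
  and the one in -q^2 e^3 x^2 loses three, so both members are polynomial multiples of one series K
  and \<open>certificate_e\<close> applies.\<close>

lemma L_Ge_rec:
  assumes "q \<noteq> 0"
  shows "(1 + q ^ 2 * e) * L q (family_e q e) = (1 + q * e) * (1 + q ^ 6 * e ^ 3) * L q (family_e q (e * q ^ 2))"
proof -
  define x where "x = (fps_X :: complex fps)"
  define Q where "Q = fps_const q"
  define e' where "e' = fps_const e"
  define K where "K = poch_fps q (e ^ 2 * q ^ 4) 2 * (poch_fps q (- (q ^ 8 * e ^ 3)) 2 *
     (inv_poch_fps q 1 1 * (inv_poch_fps q (q * e ^ 2) 2 * inv_poch_fps q (e ^ 3) 3)))"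
  define J where "J = poch_fps q (e ^ 2 * q ^ 2) 2 * (poch_fps q (- (q ^ 6 * e ^ 3)) 2 *
     (inv_poch_fps q 1 1 * (inv_poch_fps q (q * e ^ 2) 2 * inv_poch_fps q (e ^ 3) 3)))"
  define C where "C = certificate_poly e' Q x * J"
  have n1: "poch_fps q (e ^ 2) 2 = (1 - e' ^ 2 * x ^ 2) * poch_fps q (e ^ 2 * q ^ 2) 2"
    using np_shift'[of 2 "e ^ 2 * q ^ 2" "e ^ 2"] by (simp add: x_def e'_def)
  have n2: "poch_fps q (e ^ 2 * q ^ 2) 2 = (1 - e' ^ 2 * Q ^ 2 * x ^ 2) * poch_fps q (e ^ 2 * q ^ 4) 2"
    using np_shift'[of 2 "e ^ 2 * q ^ 4" "e ^ 2 * q ^ 2"] by (simp add: x_def e'_def Q_def)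
  have m1: "poch_fps q (- (q ^ 2 * e ^ 3)) 2 = (1 + Q ^ 2 * e' ^ 3 * x ^ 2) * poch_fps q (- (q ^ 4 * e ^ 3)) 2"
    using np_shift'[of 2 "- (q ^ 4 * e ^ 3)" "- (q ^ 2 * e ^ 3)"]
    by (simp add: x_def e'_def Q_def mult_ac flip: fps_const_neg)
  have m2: "poch_fps q (- (q ^ 4 * e ^ 3)) 2 = (1 + Q ^ 4 * e' ^ 3 * x ^ 2) * poch_fps q (- (q ^ 6 * e ^ 3)) 2"
    using np_shift'[of 2 "- (q ^ 6 * e ^ 3)" "- (q ^ 4 * e ^ 3)"]
    by (simp add: x_def e'_def Q_def mult_ac flip: fps_const_neg)
  have m3: "poch_fps q (- (q ^ 6 * e ^ 3)) 2 = (1 + Q ^ 6 * e' ^ 3 * x ^ 2) * poch_fps q (- (q ^ 8 * e ^ 3)) 2"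
    using np_shift'[of 2 "- (q ^ 8 * e ^ 3)" "- (q ^ 6 * e ^ 3)"]
    by (simp add: x_def e'_def Q_def mult_ac flip: fps_const_neg)
  have i1: "inv_poch_fps q q 1 = (1 - x) * inv_poch_fps q 1 1"
    using ip_shift'[of 1 q 1] by (simp add: x_def)
  have i2: "inv_poch_fps q (q ^ 3 * e ^ 2) 2 = (1 - Q * e' ^ 2 * x ^ 2) * inv_poch_fps q (q * e ^ 2) 2"
    using ip_shift'[of 2 "q ^ 3 * e ^ 2" "q * e ^ 2"]
    by (simp add: x_def e'_def Q_def power3_eq_cube power2_eq_square mult_ac)
  have i3: "inv_poch_fps q (q ^ 5 * e ^ 2) 2 = (1 - Q ^ 3 * e' ^ 2 * x ^ 2) * inv_poch_fps q (q ^ 3 * e ^ 2) 2"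
    using ip_shift'[of 2 "q ^ 5 * e ^ 2" "q ^ 3 * e ^ 2"] by (simp add: x_def e'_def Q_def mult_ac)
  have j1: "inv_poch_fps q (q ^ 3 * e ^ 3) 3 = (1 - e' ^ 3 * x ^ 3) * inv_poch_fps q (e ^ 3) 3"
    using ip_shift'[of 3 "q ^ 3 * e ^ 3" "e ^ 3"] by (simp add: x_def e'_def mult_ac)
  have j2: "inv_poch_fps q (q ^ 6 * e ^ 3) 3 = (1 - Q ^ 3 * e' ^ 3 * x ^ 3) * inv_poch_fps q (q ^ 3 * e ^ 3) 3"
    using ip_shift'[of 3 "q ^ 6 * e ^ 3" "q ^ 3 * e ^ 3"] by (simp add: x_def e'_def Q_def mult_ac)
  have J: "J = (1 - e' ^ 2 * Q ^ 2 * x ^ 2) * (1 + Q ^ 6 * e' ^ 3 * x ^ 2) * K"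
    unfolding J_def K_def n2 m3 by (simp only: mult_ac)
  have dx: "dilate q x = Q * x" by (simp add: x_def Q_def dil_X)
  have dR: "dilate q (certificate_poly e' Q x) = certificate_poly e' Q (Q * x)"
  proof -
    have de: "dilate q (e' ^ a * Q ^ b) = e' ^ a * Q ^ b" for a b by (simp add: e'_def Q_def)
    have dm: "dilate q (- f) = - dilate q f" for f by (rule fps_ext) simp
    show ?thesis unfolding certificate_poly_def dil_add dil_diff dil_mult[of _ _ "x ^ _"] dil_power dx dm de
      by (simp only: dil_mult dil_add dil_diff dil_power dx dm de)
  qed
  have dJ: "dilate q J = (1 - x) * (1 - Q * e' ^ 2 * x ^ 2) * (1 - e' ^ 3 * x ^ 3) * K"
  proof -
    have "dilate q J = poch_fps q (e ^ 2 * q ^ 4) 2 * (poch_fps q (- (q ^ 8 * e ^ 3)) 2 *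
       (inv_poch_fps q q 1 * (inv_poch_fps q (q ^ 3 * e ^ 2) 2 * inv_poch_fps q (q ^ 3 * e ^ 3) 3)))"
    proof -
      have a: "e ^ 2 * q ^ 2 * q ^ 2 = e ^ 2 * q ^ 4" "- (q ^ 6 * e ^ 3) * q ^ 2 = - (q ^ 8 * e ^ 3)"
        "1 * q ^ 1 = q" "q * e ^ 2 * q ^ 2 = q ^ 3 * e ^ 2" "e ^ 3 * q ^ 3 = q ^ 3 * e ^ 3"
        by (simp_all add: eval_nat_numeral mult_ac)
      show ?thesis by (simp only: J_def dil_mult dil_np dil_ip a)
    qed
    thus ?thesis unfolding i1 i2 j1 K_def by (simp only: mult_ac)
  qed
  have G1: "family_e q e = (1 + e' * x) * (1 - e' ^ 2 * x ^ 2) * (1 - e' ^ 2 * Q ^ 2 * x ^ 2)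
              * (1 + Q ^ 2 * e' ^ 3 * x ^ 2) * (1 + Q ^ 4 * e' ^ 3 * x ^ 2) * (1 + Q ^ 6 * e' ^ 3 * x ^ 2) * K"
    unfolding family_e_def K_def n1 n2 m1 m2 m3 e'_def [symmetric] x_def [symmetric] by (simp only: mult_ac)
  have G2: "family_e q (e * q ^ 2) = (1 + e' * Q ^ 2 * x) * (1 - Q * e' ^ 2 * x ^ 2)
              * (1 - Q ^ 3 * e' ^ 2 * x ^ 2) * (1 - e' ^ 3 * x ^ 3) * (1 - Q ^ 3 * e' ^ 3 * x ^ 3) * K"
  proof -
    have a: "(e * q ^ 2) ^ 2 = e ^ 2 * q ^ 4" "(e * q ^ 2) ^ 3 = q ^ 6 * e ^ 3"
        "q * (e ^ 2 * q ^ 4) = q ^ 5 * e ^ 2" "q ^ 2 * (q ^ 6 * e ^ 3) = q ^ 8 * e ^ 3"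
      by (simp_all add: eval_nat_numeral mult_ac)
    have b: "fps_const (e * q ^ 2) = e' * Q ^ 2" by (simp add: e'_def Q_def)
    show ?thesis unfolding family_e_def K_def a b i3 i2 j2 j1 x_def [symmetric] by (simp only: mult_ac)
  qed
  have k: "fps_const ((1 + q * e) * (1 + q ^ 6 * e ^ 3)) = (1 + Q * e') * (1 + Q ^ 6 * e' ^ 3)"
    "fps_const (1 + q ^ 2 * e) = 1 + Q ^ 2 * e'"
    by (simp_all add: e'_def Q_def flip: fps_const_1_eq_1)
  have "Q * dilate q C - x * C = Q * (fps_const (1 + q ^ 2 * e) * family_e q e
      - fps_const ((1 + q * e) * (1 + q ^ 6 * e ^ 3)) * family_e q (e * q ^ 2))"
    unfolding C_def dil_mult dR dJ k G1 G2
    using certificate_e[of Q e' x K] unfolding J by (simp only: mult.assoc)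
  moreover have "geometric C" unfolding C_def J_def e'_def Q_def x_def certificate_poly_def
    by (auto intro!: geo_mult geo_ip geo_np geo_add geo_diff geo_const geo_X geo_power q 
        simp del: fps_const_power fps_const_mult fps_const_neg)
  ultimately have "L q (fps_const (1 + q ^ 2 * e) * family_e q e)
      = (1 + q * e) * (1 + q ^ 6 * e ^ 3) * L q (family_e q (e * q ^ 2))"
    unfolding Q_def x_def by (intro L_relation[OF q]) (auto simp: assms simp del: fps_const_add)
  thus ?thesis by (simp only: L_const[OF q geo_Ge])
qed

text \<open>At e = q^(2n) the recurrence contributes (1 + q^(2n+1)) (1 + q^(6n+6)) on the right and
  1 + q^(2n+2) on the left. As n grows only 1 / (x; q) remains in the argument, which gives the last
  factor by \<open>L_ip\<close>.\<close>

lemma L_Ge_1: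
  assumes q0: "q \<noteq> 0"
  shows "L q (family_e q 1) * qpoch_inf (- (q ^ 2)) (q ^ 2)
    = qpoch_inf (- q) (q ^ 2) * qpoch_inf (- (q ^ 6)) (q ^ 6) * qpoch_inf (- q) q"
proof (rule LIMSEQ_unique)
  have n2: "norm (q ^ 2) < 1" and n6: "norm (q ^ 6) < 1" using norm_power_less_1[OF q] by simp_all
  show "(\<lambda>n. L q (family_e q 1) * qpoch (- (q ^ 2)) (q ^ 2) n) \<longlonglongrightarrow> L q (family_e q 1) * qpoch_inf (- (q ^ 2)) (q ^ 2)"
    by (intro tendsto_intros qpoch_tendsto n2)
  have eq: "L q (family_e q 1) * qpoch (- (q ^ 2)) (q ^ 2) n
      = qpoch (- q) (q ^ 2) n * qpoch (- (q ^ 6)) (q ^ 6) n * L q (family_e q ((q ^ 2) ^ n))" for n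
  proof (induction n)
    case (Suc n)
    define e where "e = (q ^ 2) ^ n"
    have e3: "(q ^ 6) ^ n = e ^ 3" by (simp add: e_def flip: power_mult)
    have "L q (family_e q 1) * qpoch (- (q ^ 2)) (q ^ 2) (Suc n)
        = (L q (family_e q 1) * qpoch (- (q ^ 2)) (q ^ 2) n) * (1 + q ^ 2 * e)"
      by (simp add: qpoch_Suc e_def)
    also have "\<dots> = qpoch (- q) (q ^ 2) n * qpoch (- (q ^ 6)) (q ^ 6) n * ((1 + q ^ 2 * e) * L q (family_e q e))"
      unfolding Suc.IH e_def by (simp only: mult_ac)
    also have "\<dots> = qpoch (- q) (q ^ 2) (Suc n) * qpoch (- (q ^ 6)) (q ^ 6) (Suc n) * L q (family_e q ((q ^ 2) ^ Suc n))"
      unfolding L_Ge_rec[OF q0] by (simp add: qpoch_Suc e3 flip: e_def) (simp add: mult_ac)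
    finally show ?case .
  qed simp
  define R where "R = 1 / (1 - norm q)"
  have R: "1 \<le> R" unfolding R_def using q norm_ge_zero[of q] by (simp add: field_simps del: norm_ge_zero)
  define e where "e = (\<lambda>n. (q ^ 2) ^ n)"
  have e1: "norm (e n) \<le> 1" for n using n2 unfolding e_def by (simp only: norm_power[of "q ^ 2"] power_le_one norm_ge_zero less_imp_le)
  have q1: "norm (q ^ m) \<le> 1" for m using q by (simp add: norm_power power_le_one)
  have em: "norm (e n ^ m) \<le> 1" "norm (q ^ j * e n ^ m) \<le> 1" "norm (q * e n ^ m) \<le> 1" for n m j
  proof -
    show 1: "norm (e n ^ m) \<le> 1" using e1 by (simp add: norm_power power_le_one)
    show "norm (q ^ j * e n ^ m) \<le> 1" unfolding norm_mult using 1 q1[of j] by (intro mult_le_one) auto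
    show "norm (q * e n ^ m) \<le> 1" unfolding norm_mult using 1 q by (intro mult_le_one) auto
  qed
  have b: "coeff_bound 1 (2 * (1 + 2 * (R + 2 * (R + 2 * (R + 2 * (R + R)))))) (family_e q (e n))" for n
  proof -
    have "coeff_bound 1 1 (1 + fps_const (e n) * fps_X)"
      using e1[of n] by (auto simp: coeff_bound_def fps_X_def)
    moreover have "coeff_bound 1 R (poch_fps q a d)" "coeff_bound 1 R (inv_poch_fps q a d)" if "norm a \<le> 1" "1 \<le> d" for a d
      unfolding R_def using that by (auto intro: bd_np[OF q] bd_ip[OF q])
    ultimately show ?thesis unfolding family_e_def using R em q
      by (intro bd_mult1) auto
  qed
  have t: "(\<lambda>n. e n ^ Suc m) \<longlonglongrightarrow> 0" for m
    using tendsto_power[OF LIMSEQ_power_zero[OF n2], of "Suc m"] by (simp add: e_def del: power_Suc)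
  have t2: "(\<lambda>n. e n ^ 2) \<longlonglongrightarrow> 0" "(\<lambda>n. e n ^ 3) \<longlonglongrightarrow> 0" "e \<longlonglongrightarrow> 0"
    using t[of 1] t[of 2] t[of 0] by (simp_all add: numeral_2_eq_2 numeral_3_eq_3)
  have t3: "(\<lambda>n. - (q ^ 2 * e n ^ 3)) \<longlonglongrightarrow> 0" "(\<lambda>n. q * e n ^ 2) \<longlonglongrightarrow> 0"
    using tendsto_mult[OF tendsto_const t2(2), of "- (q ^ 2)"] tendsto_mult[OF tendsto_const t2(1), of q] by simp_all
  have t4: "(\<lambda>k. (1 + fps_const (e k) * fps_X) $ n) \<longlonglongrightarrow> (1 :: complex fps) $ n" for n
  proof -
    have "(\<lambda>k. (1 :: complex fps) $ n + e k * fps_X $ n) \<longlonglongrightarrow> (1 :: complex fps) $ n + 0 * fps_X $ n"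
      by (intro tendsto_intros t2)
    moreover have "(1 + fps_const (e k) * fps_X) $ n = (1 :: complex fps) $ n + e k * fps_X $ n" for k
      by simp
    ultimately show ?thesis by (simp only: mult_zero_left add_0_right)
  qed
  have "(\<lambda>k. family_e q (e k) $ n) \<longlonglongrightarrow> (1 * (1 * (1 * (inv_poch_fps q 1 1 * (1 * 1))))) $ n" for n
    unfolding family_e_def
    by (intro fps_mult_tendsto tendsto_const t4 np_tendsto_1[OF _ t2(1)] np_tendsto_1[OF _ t3(1)]
        ip_tendsto_1[OF _ t3(2)] ip_tendsto_1[OF _ t2(2)]) auto
  hence "(\<lambda>k. L q (family_e q (e k))) \<longlonglongrightarrow> L q (1 * (1 * (1 * (inv_poch_fps q 1 1 * (1 * 1)))))"
    using R by (intro L_tendsto[OF q b]) auto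
  moreover have "L q (1 * (1 * (1 * (inv_poch_fps q 1 1 * (1 * 1))))) = qpoch_inf (- q) q"
    using L_ip[of 1] by simp
  ultimately have Le: "(\<lambda>k. L q (family_e q ((q ^ 2) ^ k))) \<longlonglongrightarrow> qpoch_inf (- q) q"
    by (simp only: e_def)
  show "(\<lambda>n. L q (family_e q 1) * qpoch (- (q ^ 2)) (q ^ 2) n) \<longlonglongrightarrow>
      qpoch_inf (- q) (q ^ 2) * qpoch_inf (- (q ^ 6)) (q ^ 6) * qpoch_inf (- q) q"
    unfolding eq by (intro tendsto_mult qpoch_tendsto n2 n6 Le)
qed

end

section \<open>The triple product identity\<close>

text \<open>The maximum D n of two neighbouring norms satisfies D n <= exp (M n) D (n + 1). Since M
  is summable, D n is at most a fixed constant times D (n + k), which tends to 0 with k. Applied to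
  differences, this says that such a recurrence has at most one solution with a given limit.\<close>

lemma recurrence_zero:
  fixes d :: "nat \<Rightarrow> complex" and M :: "nat \<Rightarrow> real"
  assumes M: "\<And>n. 0 \<le> M n" "summable M"
    and d: "\<And>n. norm (d n) \<le> (1 + M n) * max (norm (d (n + 1))) (norm (d (n + 2)))"
    and lim: "d \<longlonglongrightarrow> 0"
  shows "d n = 0"
proof -
  define D where "D = (\<lambda>n. max (norm (d n)) (norm (d (n + 1))))"
  have step: "D n \<le> exp (M n) * D (n + 1)" for n
  proof -
    have D0: "0 \<le> D (n + 1)" by (simp add: D_def le_max_iff_disj)
    have "norm (d n) \<le> (1 + M n) * D (n + 1)" using d[of n] by (simp add: D_def)
    moreover have "norm (d (n + 1)) \<le> 1 * D (n + 1)" by (simp add: D_def)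
    moreover have "1 * D (n + 1) \<le> (1 + M n) * D (n + 1)" using M D0 by (intro mult_right_mono) auto
    ultimately have "max (norm (d n)) (norm (d (n + 1))) \<le> (1 + M n) * D (n + 1)"
      by (intro max.boundedI) linarith+
    hence "D n \<le> (1 + M n) * D (n + 1)" by (simp add: D_def)
    also have "\<dots> \<le> exp (M n) * D (n + 1)" using D0 by (intro mult_right_mono exp_ge_add_one_self)
    finally show ?thesis .
  qed
  have it: "D n \<le> exp (sum M {n..<n + k}) * D (n + k)" for k
  proof (induction k)
    case (Suc k)
    have "D n \<le> exp (sum M {n..<n + k}) * D (n + k)" by (rule Suc)
    also have "\<dots> \<le> exp (sum M {n..<n + k}) * (exp (M (n + k)) * D (n + k + 1))"
      using step by (intro mult_left_mono) auto
    finally show ?case by (simp add: exp_add mult_ac)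
  qed simp
  have le: "D n \<le> exp (suminf M) * D (n + k)" for k
  proof -
    have "sum M {n..<n + k} \<le> suminf M" using M by (intro sum_le_suminf) auto
    hence "exp (sum M {n..<n + k}) * D (n + k) \<le> exp (suminf M) * D (n + k)"
      by (intro mult_right_mono) (simp_all add: D_def le_max_iff_disj)
    with it[of k] show ?thesis by linarith
  qed
  have "(\<lambda>k. d (n + k)) \<longlonglongrightarrow> 0" "(\<lambda>k. d (n + k + 1)) \<longlonglongrightarrow> 0"
    using LIMSEQ_ignore_initial_segment[OF lim, of n] LIMSEQ_ignore_initial_segment[OF lim, of "n + 1"]
    by (simp_all add: add_ac)
  hence "(\<lambda>k. exp (suminf M) * max (norm (d (n + k))) (norm (d (n + k + 1)))) \<longlonglongrightarrow> exp (suminf M) * max 0 0"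
    by (intro tendsto_intros tendsto_norm_zero)
  hence lim0: "(\<lambda>k. exp (suminf M) * D (n + k)) \<longlonglongrightarrow> 0"
    unfolding D_def by (simp only: max.idem mult_zero_right)
  have "D n \<le> 0" by (rule LIMSEQ_le_const[OF lim0]) (use le in blast)
  thus ?thesis by (simp add: D_def)
qed

text \<open>Triangular numbers at integer arguments; \<open>tri (- n)\<close> is n (n - 1) / 2. Thus
  u^(tri n) v^(tri (-n)) is the summand of Ramanujan's theta function f(u, v), with natural
  exponents throughout.\<close>

definition tri :: "int \<Rightarrow> nat" where
  "tri n = nat (n * (n + 1) div 2)"

lemma tri_int: "tri (int k) = Suc k choose 2" and tri_neg: "tri (- int k) = k choose 2"
proof -
  have *: "2 * (m choose 2) = m * (m - 1)" for m
  proof -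
    have "even (m * (m - 1))" by (cases m) auto
    thus ?thesis by (simp add: choose_two)
  qed
  have "int k * (int k + 1) = 2 * int (Suc k choose 2)" using arg_cong[OF *[of "Suc k"], of int] by (simp add: algebra_simps)
  thus "tri (int k) = Suc k choose 2" unfolding tri_def by simp
  have "- int k * (- int k + 1) = 2 * int (k choose 2)"
    using arg_cong[OF *[of k], of int] by (cases k) (auto simp: algebra_simps)
  thus "tri (- int k) = k choose 2" unfolding tri_def by simp
qed

text \<open>For p = u v these are the exponents of u and of v in p^((m+k choose 2) + (m choose 2))
  u^(m+k) v^m; the common part m (m + k) is the power of p in \<open>durfee_term\<close>.\<close>

lemma choose_shift:
  "((m + k) choose 2) + (m choose 2) + (m + k) = (Suc k choose 2) + m * (m + k)"
  "((m + k) choose 2) + (m choose 2) + m = (k choose 2) + m * (m + k)"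
  by (induction m) (simp_all add: numeral_2_eq_2 algebra_simps)

lemma has_sum_times_nat:
  fixes x y :: "nat \<Rightarrow> complex"
  assumes x: "summable (\<lambda>i. norm (x i))" "x sums X" and y: "summable (\<lambda>i. norm (y i))" "y sums Y"
  shows "((\<lambda>(i, j). x i * y j) has_sum (X * Y)) UNIV"
    and "(\<lambda>(i, j). norm (x i * y j)) summable_on UNIV"
proof -
  have nx: "(\<lambda>i. norm (x i)) summable_on UNIV" and ny: "(\<lambda>i. norm (y i)) summable_on UNIV"
    using x y by (simp_all add: summable_on_UNIV_nonneg_real_iff)
  have "(\<lambda>(i, j). norm (x i) * norm (y j)) summable_on (UNIV \<times> UNIV)"
    using nx ny by (intro summable_on_SigmaI[where g = "\<lambda>i. norm (x i) * infsum (\<lambda>j. norm (y j)) UNIV"])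
      (auto intro: has_sum_cmult_right summable_on_cmult_left has_sum_infsum)
  thus n: "(\<lambda>(i, j). norm (x i * y j)) summable_on UNIV" by (simp add: norm_mult)
  have hx: "(x has_sum X) UNIV" and hy: "(y has_sum Y) UNIV"
    by (rule norm_summable_imp_has_sum[OF x], rule norm_summable_imp_has_sum[OF y])
  have s: "(\<lambda>(i, j). x i * y j) summable_on (UNIV \<times> UNIV)"
    by (rule abs_summable_summable) (use n in \<open>simp add: case_prod_unfold\<close>)
  have "((\<lambda>(i, j). x i * y j) has_sum (X * Y)) (UNIV \<times> UNIV)"
    using s by (intro has_sum_SigmaI[where g = "\<lambda>i. x i * Y"])
      (auto intro: has_sum_cmult_right[OF hy] has_sum_cmult_left[OF hx])
  thus "((\<lambda>(i, j). x i * y j) has_sum (X * Y)) UNIV" by simp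
qed

lemma qpoch_inf_nonzero:
  assumes "norm p < 1" "norm a < 1"
  shows "qpoch_inf a p \<noteq> 0"
proof
  assume "qpoch_inf a p = 0"
  with has_prod_qpoch_inf[OF assms(1), of a] have "(\<lambda>k. 1 - a * p ^ k) has_prod 0" by simp
  then obtain k where "1 - a * p ^ k = 0" by (auto simp: has_prod_0_iff)
  hence "norm (a * p ^ k) = 1" by simp
  moreover have "norm a * norm (p ^ k) \<le> norm a * 1"
    using assms by (intro mult_left_mono) (auto simp: norm_power power_le_one)
  ultimately show False using assms by (simp add: norm_mult)
qed

section \<open>Durfee rectangles: a Cauchy sum independent of n\<close>

context
  fixes p :: complex
  assumes p: "norm p < 1"
begin

lemma inverse_qpoch_bounded:
  obtains B where "0 < B" "\<And>k. norm (1 / qpoch p p k) \<le> B"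
proof -
  have "(\<lambda>k. 1 / qpoch p p k) \<longlonglongrightarrow> 1 / qpoch_inf p p"
    by (intro tendsto_intros qpoch_tendsto p qpoch_inf_nonzero)
  hence "Bseq (\<lambda>k. 1 / qpoch p p k)" by (intro convergent_imp_Bseq) (auto simp: convergent_def)
  thus ?thesis using that by (auto simp: Bseq_def)
qed

text \<open>Generating function of the partitions whose Durfee rectangle has size m times m +
  n.\<close>

definition durfee_term :: "nat \<Rightarrow> nat \<Rightarrow> complex" where
  "durfee_term n m = p ^ (m * (m + n)) / (qpoch p p m * qpoch p p (m + n))"

lemma dterm_bound:
  obtains B where "\<And>n m. norm (durfee_term n m) \<le> B * norm p ^ m"
proof -
  obtain B where B: "0 < B" "\<And>k. norm (1 / qpoch p p k) \<le> B" using inverse_qpoch_bounded by blast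
  have "norm (durfee_term n m) \<le> (B * B) * norm p ^ m" for n m
  proof -
    have "norm (durfee_term n m) = norm (1 / qpoch p p m) * norm (1 / qpoch p p (m + n)) * norm p ^ (m * (m + n))"
      by (simp add: durfee_term_def norm_mult norm_divide norm_power)
    also have "\<dots> \<le> B * B * norm p ^ m"
    proof (intro mult_mono B power_decreasing)
      show "m \<le> m * (m + n)" by (cases m) auto
    qed (use B p in auto)
    finally show ?thesis .
  qed
  thus ?thesis by (rule that)
qed

lemma dterm_summable: "summable (\<lambda>m. norm (durfee_term n m))"
proof -
  obtain B where B: "\<And>n m. norm (durfee_term n m) \<le> B * norm p ^ m" using dterm_bound by blast
  show ?thesis
    by (rule summable_comparison_test'[where g = "\<lambda>m. B * norm p ^ m"])
       (use p B in \<open>auto intro!: summable_mult summable_geometric\<close>)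
qed

text \<open>For the auxiliary terms a_m of the proof put S = sum a_m and T = sum a_m p^m. Then s_n =
  S - p^(n+1) T and s_(n+1) = T, and after an index shift p^(n+1) s_(n+2) = S - T.\<close>

lemma dterm_rec:
  assumes sums: "\<And>n. durfee_term n sums s n"
  shows "s n = (1 - p ^ (n + 1)) * s (n + 1) + p ^ (n + 1) * s (n + 2)"
proof -
  have nz: "qpoch p p m \<noteq> 0" for m by (rule qpoch_nonzero[OF p])
  define a where "a = (\<lambda>m. p ^ (m * (m + n)) / (qpoch p p m * qpoch p p (m + n + 1)))"
  have a1: "durfee_term (n + 1) m = a m * p ^ m" for m
  proof -
    have e: "m * (m + (n + 1)) = m * (m + n) + m" by (simp add: algebra_simps)
    show ?thesis unfolding durfee_term_def a_def e power_add by (simp add: add.assoc)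
  qed
  have a0: "durfee_term n m = a m - p ^ (n + 1) * (a m * p ^ m)" for m
  proof -
    define w where "w = 1 - p * p ^ (m + n)"
    have w: "w \<noteq> 0" using nz[of "Suc (m + n)"] by (simp add: qpoch_Suc w_def)
    have "p ^ (n + 1) * (a m * p ^ m) = a m * (1 - w)"
      by (simp add: w_def power_add mult_ac)
    moreover have "a m * w = durfee_term n m"
      using w nz[of m] nz[of "m + n"] unfolding a_def durfee_term_def
      by (simp add: qpoch_Suc flip: w_def)
    ultimately show ?thesis by (simp add: right_diff_distrib)
  qed
  have a2: "p ^ (n + 1) * durfee_term (n + 2) k = a (Suc k) - a (Suc k) * p ^ Suc k" for k
  proof -
    define w where "w = 1 - p * p ^ k"
    have w: "w \<noteq> 0" using nz[of "Suc k"] by (simp add: qpoch_Suc w_def)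
    have "Suc k * (Suc k + n) = (n + 1) + k * (k + (n + 2))" by (simp add: algebra_simps)
    hence e: "p ^ (Suc k * (Suc k + n)) = p ^ (n + 1) * p ^ (k * (k + (n + 2)))" by (simp only: power_add)
    have i: "Suc k + n + 1 = k + (n + 2)" by simp
    have "a (Suc k) * w = p ^ (n + 1) * durfee_term (n + 2) k"
      using w nz[of k] nz[of "k + (n + 2)"] unfolding a_def durfee_term_def e i qpoch_Suc[of p p k] w_def [symmetric]
      by (simp add: mult_ac)
    thus ?thesis by (simp add: w_def right_diff_distrib)
  qed
  have "(\<lambda>k. a (Suc k) - a (Suc k) * p ^ Suc k) sums (p ^ (n + 1) * s (n + 2))"
    using sums_mult[OF sums[of "n + 2"], of "p ^ (n + 1)"] unfolding a2 .
  \<comment> \<open>The added term with index 0 is a_0 - a_0 = 0, so the shifted and the full series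
    have the same sum.\<close>
  from sums_Suc[where f = "\<lambda>k. a k - a k * p ^ k", OF this]
  have h0: "(\<lambda>k. a k - a k * p ^ k) sums (p ^ (n + 1) * s (n + 2))" by simp
  have "durfee_term (n + 1) = (\<lambda>m. a m * p ^ m)" by (rule ext) (rule a1)
  hence h1: "(\<lambda>m. a m * p ^ m) sums s (n + 1)" using sums[of "n + 1"] by simp
  from sums_add[OF h0 h1] have h2: "a sums (p ^ (n + 1) * s (n + 2) + s (n + 1))" by simp
  have "durfee_term n = (\<lambda>m. a m - p ^ (n + 1) * (a m * p ^ m))" by (rule ext) (rule a0)
  with sums_diff[OF h2 sums_mult[OF h1, of "p ^ (n + 1)"]]
  have "durfee_term n sums (p ^ (n + 1) * s (n + 2) + s (n + 1) - p ^ (n + 1) * s (n + 1))"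
    by simp
  from sums_unique2[OF sums this]
  have "s n = p ^ (n + 1) * s (n + 2) + s (n + 1) - p ^ (n + 1) * s (n + 1)" .
  thus ?thesis by (simp add: algebra_simps)
qed

text \<open>For m > 0 the factor p^(m n) kills the term as n grows; only m = 0 survives. The bound B
  |p|^m is uniform in n, so Tannery's theorem applies.\<close>

lemma dterm_tendsto: "(\<lambda>n. \<Sum>m. durfee_term n m) \<longlonglongrightarrow> 1 / qpoch_inf p p"
proof -
  obtain B where B: "\<And>n m. norm (durfee_term n m) \<le> B * norm p ^ m" using dterm_bound by blast
  define b where "b = (\<lambda>m::nat. if m = 0 then 1 / qpoch_inf p p else 0)"
  have "(\<lambda>n. durfee_term n m) \<longlonglongrightarrow> b m" for m
  proof (cases "m = 0")
    case True
    thus ?thesis unfolding durfee_term_def b_def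
      by (simp add: tendsto_divide[OF tendsto_const qpoch_tendsto[OF p] qpoch_inf_nonzero[OF p p]])
  next
    case False
    have pm: "norm (p ^ m) < 1" using norm_power_less_1[OF p] False by simp
    have e: "p ^ (m * (m + n)) = p ^ (m * m) * (p ^ m) ^ n" for n
      by (simp only: add_mult_distrib2 power_add power_mult)
    have d: "durfee_term n m = p ^ (m * m) / qpoch p p m * ((p ^ m) ^ n / qpoch p p (n + m))" for n
      unfolding durfee_term_def e by (simp add: add.commute)
    have "(\<lambda>n. durfee_term n m) \<longlonglongrightarrow> p ^ (m * m) / qpoch p p m * (0 / qpoch_inf p p)"
      unfolding d
      by (intro tendsto_mult tendsto_divide tendsto_const LIMSEQ_power_zero pm qpoch_inf_nonzero p
          LIMSEQ_ignore_initial_segment[OF qpoch_tendsto[OF p]])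
    thus ?thesis using False by (simp add: b_def)
  qed
  hence "(\<lambda>n. \<Sum>m. durfee_term n m) \<longlonglongrightarrow> (\<Sum>m. b m)"
    by (intro tannerys_theorem[where M = "\<lambda>m. B * norm p ^ m", THEN conjunct2, THEN conjunct2])
       (use B p in \<open>auto intro!: always_eventually summable_mult summable_geometric\<close>)
  moreover have "(\<Sum>m. b m) = 1 / qpoch_inf p p"
    using sums_unique[OF sums_single[of 0 "\<lambda>_. 1 / qpoch_inf p p"]] by (simp add: b_def eq_commute)
  ultimately show ?thesis by simp
qed

text \<open>The coefficients 1 - p^(n+1) and p^(n+1) of the recurrence add up to 1, so the constant
  1 / (p; p) solves it as well; equal limits force equality.\<close>

lemma dterm_sums: "durfee_term n sums (1 / qpoch_inf p p)"
proof -
  define s where "s = (\<lambda>n. \<Sum>m. durfee_term n m)"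
  have sums: "durfee_term n sums s n" for n
    unfolding s_def by (rule summable_sums[OF summable_norm_cancel[OF dterm_summable]])
  define d where "d = (\<lambda>n. s n - 1 / qpoch_inf p p)"
  have "d n = 0"
  proof (rule recurrence_zero[where M = "\<lambda>n. 2 * norm p * norm p ^ n"])
    show "summable (\<lambda>n. 2 * norm p * norm p ^ n)" using p by (intro summable_mult summable_geometric) auto
    fix n
    define e where "e = p ^ (n + 1)"
    define m where "m = max (norm (d (n + 1))) (norm (d (n + 2)))"
    have "d n = (1 - e) * d (n + 1) + e * d (n + 2)"
      unfolding d_def dterm_rec[OF sums, of n] e_def by (simp add: algebra_simps)
    hence "norm (d n) \<le> norm (1 - e) * norm (d (n + 1)) + norm e * norm (d (n + 2))"
      using norm_triangle_ineq[of "(1 - e) * d (n + 1)" "e * d (n + 2)"] by (simp only: norm_mult)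
    also have "\<dots> \<le> (1 + norm e) * m + norm e * m"
      unfolding m_def using norm_triangle_ineq4[of 1 e] by (intro add_mono mult_mono) auto
    also have "\<dots> = (1 + 2 * norm p * norm p ^ n) * m"
      by (simp add: e_def norm_mult norm_power algebra_simps)
    finally show "norm (d n) \<le> (1 + 2 * norm p * norm p ^ n) * max (norm (d (n + 1))) (norm (d (n + 2)))"
      by (simp add: m_def)
  next
    have "s \<longlonglongrightarrow> 1 / qpoch_inf p p" unfolding s_def by (rule dterm_tendsto)
    from tendsto_diff[OF this tendsto_const[of "1 / qpoch_inf p p"]]
    show "d \<longlonglongrightarrow> 0" by (simp add: d_def)
  qed auto
  thus ?thesis using sums[of n] by (simp add: d_def)
qed

text \<open>\<open>L_ip\<close> at a = u / p: dividing by p undoes the passage from (i choose 2) to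
  (i+1 choose 2).\<close>

lemma euler_sums:
  assumes p0: "p \<noteq> 0"
  shows "(\<lambda>i. p ^ (i choose 2) * u ^ i / qpoch p p i) sums qpoch_inf (- u) p"
    and "summable (\<lambda>i. norm (p ^ (i choose 2) * u ^ i / qpoch p p i))"
proof -
  define w where "w = u / p"
  have e: "p ^ (Suc i choose 2) * inv_poch_fps p w 1 $ i = p ^ (i choose 2) * u ^ i / qpoch p p i" for i
  proof -
    have "Suc i choose 2 = i + (i choose 2)" by (simp add: numeral_2_eq_2)
    thus ?thesis using p0 by (simp add: inv_poch_fps_def ser_nth w_def power_add power_divide)
  qed
  show "(\<lambda>i. p ^ (i choose 2) * u ^ i / qpoch p p i) sums qpoch_inf (- u) p"
    using L_sums[OF p geo_ip[OF p, of 1 w]] p0 unfolding e L_ip[OF p] by (simp add: w_def)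
  obtain C R where f: "coeff_bound C R (inv_poch_fps p w 1)" "0 \<le> C" "1 \<le> R" using geo_ip[OF p, of 1 w] by (auto elim: geoE)
  show "summable (\<lambda>i. norm (p ^ (i choose 2) * u ^ i / qpoch p p i))"
    unfolding e [symmetric]
    by (rule summable_comparison_test'[OF summable_weight[OF p, of R C]])
       (use f norm_weight_le[OF p f(1)] in auto)
qed

end

text \<open>Multiply Euler's expansions of (-u; p) and (-v; p), p = u v, and collect the index pairs
  with i - j = n. The sum over the minimum m of the pair is the Durfee sum, whose value 1 / (p; p)
  does not depend on n and can be moved to the other side.\<close>

lemma jacobi_triple_product:
  assumes p: "norm (u * v) < 1" and p0: "u * v \<noteq> 0"
  shows "((\<lambda>n. u ^ tri n * v ^ tri (- n)) has_sum
     (qpoch_inf (- u) (u * v) * qpoch_inf (- v) (u * v) * qpoch_inf (u * v) (u * v))) UNIV"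
proof -
  define p where "p = u * v"
  have p1: "norm p < 1" "p \<noteq> 0" using assms by (auto simp: p_def)
  define E where "E = (\<lambda>u i. p ^ (i choose 2) * u ^ i / qpoch p p i)"
  define f where "f = (\<lambda>(n, m). u ^ tri n * v ^ tri (- n) * durfee_term p (nat \<bar>n\<bar>) m)"
  have hs: "((\<lambda>(i, j). E u i * E v j) has_sum (qpoch_inf (- u) p * qpoch_inf (- v) p)) UNIV"
    unfolding E_def by (intro has_sum_times_nat euler_sums p1)
  have 1: "E u (m + k) * E v m = f (int k, m)" for m k
  proof -
    have "E u (m + k) * E v m = (p ^ (((m + k) choose 2) + (m choose 2)) * (u ^ (m + k) * v ^ m)) / (qpoch p p m * qpoch p p (m + k))"
      by (simp add: E_def power_add mult_ac)
    also have "p ^ (((m + k) choose 2) + (m choose 2)) * (u ^ (m + k) * v ^ m)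
        = u ^ (((m + k) choose 2) + (m choose 2) + (m + k)) * v ^ (((m + k) choose 2) + (m choose 2) + m)"
      by (simp add: p_def power_mult_distrib power_add mult_ac)
    also have "\<dots> = u ^ (Suc k choose 2) * v ^ (k choose 2) * p ^ (m * (m + k))"
      unfolding choose_shift by (simp add: p_def power_mult_distrib power_add mult_ac)
    finally show ?thesis by (simp add: f_def tri_int tri_neg durfee_term_def[OF p1(1)])
  qed
  have 2: "E u m * E v (m + k) = f (- int k, m)" for m k
  proof -
    have "E u m * E v (m + k) = (p ^ (((m + k) choose 2) + (m choose 2)) * (u ^ m * v ^ (m + k))) / (qpoch p p m * qpoch p p (m + k))"
      by (simp add: E_def power_add mult_ac)
    also have "p ^ (((m + k) choose 2) + (m choose 2)) * (u ^ m * v ^ (m + k))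
        = u ^ (((m + k) choose 2) + (m choose 2) + m) * v ^ (((m + k) choose 2) + (m choose 2) + (m + k))"
      by (simp add: p_def power_mult_distrib power_add mult_ac)
    also have "\<dots> = v ^ (Suc k choose 2) * u ^ (k choose 2) * p ^ (m * (m + k))"
      unfolding choose_shift by (simp add: p_def power_mult_distrib power_add mult_ac)
    finally show ?thesis by (simp add: f_def tri_int tri_neg durfee_term_def[OF p1(1)] mult_ac)
  qed
  have "(f has_sum (qpoch_inf (- u) p * qpoch_inf (- v) p)) UNIV \<longleftrightarrow>
      ((\<lambda>(i, j). E u i * E v j) has_sum (qpoch_inf (- u) p * qpoch_inf (- v) p)) UNIV"
  proof (rule has_sum_reindex_bij_witness[where i = "\<lambda>(i, j). (int i - int j, min i j)"
        and j = "\<lambda>(n, m). (m + nat n, m + nat (- n))"])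
    fix x :: "int \<times> nat"
    obtain n m where x: "x = (n, m)" by (cases x)
    show "(case case x of (n, m) \<Rightarrow> (m + nat n, m + nat (- n)) of (i, j) \<Rightarrow> E u i * E v j) = f x"
    proof (cases "n \<ge> 0")
      case True
      then obtain k where "n = int k" by (metis nonneg_int_cases)
      thus ?thesis using 1 by (simp add: x)
    next
      case False
      then obtain k where "n = - int k" by (metis nle_le nonpos_int_cases)
      thus ?thesis using 2 by (simp add: x)
    qed
  qed (auto simp: min_def split: prod.splits)
  with hs have "(f has_sum (qpoch_inf (- u) p * qpoch_inf (- v) p)) (UNIV \<times> UNIV)" by simp
  hence "((\<lambda>n. u ^ tri n * v ^ tri (- n) * (1 / qpoch_inf p p)) has_sum (qpoch_inf (- u) p * qpoch_inf (- v) p)) UNIV"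
  proof (rule has_sum_SigmaD)
    fix n :: int
    have h: "(durfee_term p (nat \<bar>n\<bar>) has_sum (1 / qpoch_inf p p)) UNIV"
      by (intro norm_summable_imp_has_sum dterm_summable dterm_sums p1)
    from has_sum_cmult_right[OF h, of "u ^ tri n * v ^ tri (- n)"]
    show "((\<lambda>m. f (n, m)) has_sum u ^ tri n * v ^ tri (- n) * (1 / qpoch_inf p p)) UNIV"
      unfolding f_def by simp
  qed
  from has_sum_cmult_left[OF this, of "qpoch_inf p p"] qpoch_inf_nonzero[OF p1(1) p1(1)]
  show ?thesis by (simp add: p_def)
qed

section \<open>Bressoud's sum for the modulus 6\<close>

text \<open>Folds a bilateral series by pairing n = r with n = -r - 1, the form in which a theta
  series meets the unilateral series of Bressoud.\<close>

lemma has_sum_int_pairs: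
  fixes h :: "int \<Rightarrow> complex"
  assumes "(h has_sum S) UNIV"
  shows "(\<lambda>r. h (int r) + h (- int (Suc r))) sums S"
proof -
  define g where "g = (\<lambda>x. if snd x then int (fst x) else - int (Suc (fst x)))"
  have inj: "inj_on g UNIV" by (auto simp: inj_on_def g_def split: if_splits)
  have surj: "range g = UNIV"
  proof -
    have "n \<in> range g" for n
    proof (cases "n \<ge> 0")
      case True
      hence "n = g (nat n, True)" by (simp add: g_def)
      thus ?thesis by blast
    next
      case False
      hence "n = g (nat (- n - 1), False)" by (simp add: g_def)
      thus ?thesis by blast
    qed
    thus ?thesis by blast
  qed
  have "((h \<circ> g) has_sum S) (Sigma UNIV (\<lambda>_. UNIV))"
    using assms has_sum_reindex[OF inj, of h S] surj by simp
  hence "((\<lambda>r. h (int r) + h (- int (Suc r))) has_sum S) UNIV"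
  proof (rule has_sum_SigmaD)
    fix r :: nat
    have "(\<Sum>b\<in>UNIV. (h \<circ> g) (r, b)) = h (int r) + h (- int (Suc r))"
      by (simp add: UNIV_bool g_def)
    thus "((\<lambda>b. (h \<circ> g) (r, b)) has_sum (h (int r) + h (- int (Suc r)))) UNIV"
      using has_sum_finite[of UNIV "\<lambda>b. (h \<circ> g) (r, b)"] by simp
  qed
  thus ?thesis by (rule has_sum_imp_sums)
qed

lemma has_sum_int_even_odd:
  fixes h :: "int \<Rightarrow> complex"
  assumes 1: "((\<lambda>n. h (2 * n)) has_sum S) UNIV" and 2: "((\<lambda>n. h (- (2 * n) - 1)) has_sum T) UNIV"
  shows "(h has_sum (S + T)) UNIV"
proof -
  have "(h has_sum S) (range (\<lambda>n. 2 * n))"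
    using 1 by (subst has_sum_reindex) (simp_all add: inj_on_def o_def)
  moreover have "(h has_sum T) (range (\<lambda>n. - (2 * n) - 1))"
    using 2 by (subst has_sum_reindex) (simp_all add: inj_on_def o_def)
  moreover have "range (\<lambda>n::int. 2 * n) \<inter> range (\<lambda>n. - (2 * n) - 1) = {}"
    by (auto; presburger)
  ultimately have "(h has_sum (S + T)) (range (\<lambda>n. 2 * n) \<union> range (\<lambda>n. - (2 * n) - 1))"
    by (rule has_sum_Un_disjoint)
  moreover have "range (\<lambda>n::int. 2 * n) \<union> range (\<lambda>n. - (2 * n) - 1) = UNIV"
  proof -
    have "n \<in> range (\<lambda>n. 2 * n) \<union> range (\<lambda>n. - (2 * n) - 1)" for n :: int
    proof (cases "even n")
      case False
      hence "n = - (2 * (- ((n + 1) div 2))) - 1" by presburger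
      thus ?thesis by blast
    qed (auto elim!: evenE)
    thus ?thesis by blast
  qed
  ultimately show ?thesis by simp
qed

lemma qpoch_rec: "qpoch a p (Suc n) = (1 - a) * qpoch (a * p) p n"
  unfolding qpoch_def by (subst prod.lessThan_Suc_shift) (simp add: mult.assoc)

lemma qpoch_add: "qpoch a p (m + n) = qpoch a p m * qpoch (a * p ^ m) p n"
  by (induction n) (simp_all add: qpoch_Suc power_add mult_ac)

lemma qpoch_inf_split:
  assumes "norm p < 1"
  shows "qpoch_inf a p = qpoch a p m * qpoch_inf (a * p ^ m) p"
proof (rule LIMSEQ_unique)
  show "(\<lambda>n. qpoch a p (m + n)) \<longlonglongrightarrow> qpoch_inf a p"
    using LIMSEQ_ignore_initial_segment[OF qpoch_tendsto[OF assms], of a m] by (simp add: add.commute)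
  show "(\<lambda>n. qpoch a p (m + n)) \<longlonglongrightarrow> qpoch a p m * qpoch_inf (a * p ^ m) p"
    unfolding qpoch_add by (intro tendsto_intros qpoch_tendsto assms)
qed

lemma qpoch_inf_dissect:
  assumes p: "norm p < 1" and m: "1 \<le> m"
  shows "qpoch_inf a p = (\<Prod>i<m. qpoch_inf (a * p ^ i) (p ^ m))"
proof (rule LIMSEQ_unique)
  have pm: "norm (p ^ m) < 1" by (rule norm_power_less_1[OF p m])
  have "qpoch a p (n * m) = (\<Prod>i<m. qpoch (a * p ^ i) (p ^ m) n)" for n
  proof (induction n)
    case (Suc n)
    have "qpoch a p (Suc n * m) = qpoch a p (n * m) * qpoch (a * p ^ (n * m)) p m"
      by (simp only: mult_Suc add.commute[of m] qpoch_add)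
    also have "qpoch (a * p ^ (n * m)) p m = (\<Prod>i<m. 1 - a * p ^ i * (p ^ m) ^ n)"
      unfolding qpoch_def by (intro prod.cong) (simp_all add: mult_ac flip: power_mult)
    finally show ?case by (simp add: Suc qpoch_Suc prod.distrib)
  qed simp
  moreover have "(\<lambda>n. qpoch a p (n * m)) \<longlonglongrightarrow> qpoch_inf a p"
    by (rule filterlim_compose[OF qpoch_tendsto[OF p]]) (use m in \<open>auto intro: mult_nat_right_at_top\<close>)
  ultimately show "(\<lambda>n. \<Prod>i<m. qpoch (a * p ^ i) (p ^ m) n) \<longlonglongrightarrow> qpoch_inf a p" by simp
  show "(\<lambda>n. \<Prod>i<m. qpoch (a * p ^ i) (p ^ m) n) \<longlonglongrightarrow> (\<Prod>i<m. qpoch_inf (a * p ^ i) (p ^ m))"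
    by (intro tendsto_prod qpoch_tendsto pm)
qed

lemma qpoch_inf_mult_minus:
  assumes p: "norm p < 1"
  shows "qpoch_inf a p * qpoch_inf (- a) p = qpoch_inf (a ^ 2) (p ^ 2)"
proof (rule LIMSEQ_unique)
  have p2: "norm (p ^ 2) < 1" by (rule norm_power_less_1[OF p]) simp
  have "qpoch a p n * qpoch (- a) p n = qpoch (a ^ 2) (p ^ 2) n" for n
  proof (induction n)
    case (Suc n)
    have "(1 - a * p ^ n) * (1 + a * p ^ n) = 1 - a ^ 2 * (p ^ 2) ^ n"
      by (simp add: algebra_simps power2_eq_square power_mult_distrib)
    thus ?case using Suc by (simp add: qpoch_Suc) (metis (no_types, lifting) mult.assoc mult.left_commute)
  qed simp
  moreover have "(\<lambda>n. qpoch a p n * qpoch (- a) p n) \<longlonglongrightarrow> qpoch_inf a p * qpoch_inf (- a) p"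
    by (intro tendsto_intros qpoch_tendsto p)
  ultimately show "(\<lambda>n. qpoch (a ^ 2) (p ^ 2) n) \<longlonglongrightarrow> qpoch_inf a p * qpoch_inf (- a) p" by simp
  show "(\<lambda>n. qpoch (a ^ 2) (p ^ 2) n) \<longlonglongrightarrow> qpoch_inf (a ^ 2) (p ^ 2)"
    by (rule qpoch_tendsto[OF p2])
qed

lemma norm_qpoch_le:
  assumes "norm a \<le> 1" "norm p \<le> 1"
  shows "norm (qpoch a p n) \<le> 2 ^ n"
proof (induction n)
  case (Suc n)
  have "norm a * norm (p ^ n) \<le> 1"
    using assms by (intro mult_le_one) (auto simp: norm_power power_le_one)
  hence "norm (1 - a * p ^ n) \<le> 2"
    using norm_triangle_ineq4[of 1 "a * p ^ n"] by (simp add: norm_mult)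
  hence "norm (qpoch a p n) * norm (1 - a * p ^ n) \<le> 2 ^ n * 2" using Suc by (intro mult_mono) auto
  thus ?case by (simp add: qpoch_Suc norm_mult mult_ac)
qed simp

lemma dil_dil: "dilate a (dilate b f) = dilate (a * b) f"
  by (rule fps_ext) (simp add: power_mult_distrib mult_ac)

lemma bd_dil:
  assumes "norm a \<le> 1" "coeff_bound C R f"
  shows "coeff_bound C R (dilate a f)"
  unfolding coeff_bound_def
proof
  fix n
  have "norm (a ^ n) * norm (f $ n) \<le> 1 * (C * R ^ n)"
    using assms by (intro mult_mono) (auto simp: coeff_bound_def norm_power power_le_one)
  thus "norm (dilate a f $ n) \<le> C * R ^ n" by (simp add: norm_mult)
qed

lemma geo_dil: "norm a \<le> 1 \<Longrightarrow> geometric f \<Longrightarrow> geometric (dilate a f)"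
  unfolding geometric_def using bd_dil by blast

text \<open>At a = q the two finite products cancel and a theta series remains; the free parameter a
  makes room for a recurrence along a -> a q.\<close>

definition bressoud_term :: "complex \<Rightarrow> complex \<Rightarrow> nat \<Rightarrow> complex" where
  "bressoud_term q a r = (- 1) ^ r * a ^ (2 * r) * q ^ (3 * r ^ 2) * qpoch (a ^ 2) (q ^ 2) r / qpoch (q ^ 2) (q ^ 2) r"

text \<open>Creative telescoping for \<open>bA_rec\<close>: t is the r-th term, Y = q^(2r), and the
  right side is the difference of consecutive values of t (1 - Y) (1 + a - a^2 Y).\<close>

lemma bt_poly:
  fixes a q Y t :: complex
  shows "(1 + a) * (t * (1 - a * Y)) - t * Y * (1 - a ^ 2 * Y) * (1 - a * q * Y)
      - a * q * (t * Y ^ 2 * (1 - a ^ 2 * Y) * (1 - a ^ 2 * q ^ 2 * Y) * (1 - a * q ^ 2 * Y))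
    = t * ((1 - Y) * (1 + a - a ^ 2 * Y))
      - (- (t * a ^ 2 * q ^ 3 * Y ^ 3 * (1 - a ^ 2 * Y))) * (1 + a - a ^ 2 * q ^ 2 * Y)"
  by algebra

context
  fixes q :: complex
  assumes q: "norm q < 1"
begin

lemma L_one: "L q 1 = 1"
proof -
  have "(\<lambda>n. q ^ (Suc n choose 2) * (1 :: complex fps) $ n) sums 1"
    using sums_single[of 0 "\<lambda>n. q ^ (Suc n choose 2) * (1 :: complex fps) $ n"]
    by (simp add: numeral_2_eq_2 if_distrib cong: if_cong)
  with L_sums[OF q geo_1] show ?thesis by (rule sums_unique2)
qed

text \<open>The series g = (-qx; q) / (q x^2; q^2) satisfies (1 + qx) g(qx) = (1 - q x^2) g(x).
  Dilating by q^j and moving x and x^2 through L turns this into the three-term recurrence.\<close>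

lemma bressoud_rec:
  fixes f :: "nat \<Rightarrow> complex"
  defines "f \<equiv> \<lambda>j. L q (dilate (q ^ j) (poch_fps q (- q) 1 * inv_poch_fps q q 2))"
  shows "f j = f (j + 1) + q ^ (j + 2) * (1 + q ^ (j + 2)) * f (j + 2)"
proof -
  define g where "g = poch_fps q (- q) 1 * inv_poch_fps q q 2"
  define G where "G = (\<lambda>j. dilate (q ^ j) g)"
  have qj: "norm (q ^ i) \<le> 1" for i using q by (simp add: norm_power power_le_one)
  have geometric: "geometric (G i)" for i unfolding G_def g_def by (intro geo_dil qj geo_mult geo_np geo_ip q) auto
  have dG: "dilate q (G i) = G (i + 1)" for i by (simp add: G_def dil_dil)
  have LX: "L q (fps_X * G i) = q * L q (G (i + 1))" for i
    using L_X[OF q geometric[of i]] by (simp only: dG)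
  have LXX: "L q (fps_X * (fps_X * G i)) = q ^ 3 * L q (G (i + 2))" for i
  proof -
    have "L q (fps_X * (fps_X * G i)) = q * L q (dilate q (fps_X * G i))"
      by (intro L_X[OF q] geo_mult geo_X geometric)
    also have "dilate q (fps_X * G i) = fps_const q * (fps_X * G (i + 1))"
      by (simp only: dil_mult dil_X dG mult.assoc)
    also have "L q (fps_const q * (fps_X * G (i + 1))) = q * (q * L q (G (i + 1 + 1)))"
      by (simp only: L_const[OF q] geo_mult geo_X geometric LX)
    finally show ?thesis by (simp add: power3_eq_cube)
  qed
  have n1: "poch_fps q (- 1) 1 = (1 + fps_X) * poch_fps q (- q) 1"
    using np_shift'[OF q, of 1 "- q" "- 1"] by (simp flip: fps_const_neg)
  have i1: "inv_poch_fps q (q * q ^ 2) 2 = (1 - fps_const q * fps_X ^ 2) * inv_poch_fps q q 2"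
    using ip_shift'[OF q, of 2 "q * q ^ 2" q] by simp
  have a: "- 1 * q ^ 1 = - q" by simp
  have "dilate q ((1 + fps_X) * g) = dilate q (poch_fps q (- 1) 1 * inv_poch_fps q q 2)"
    by (simp only: n1 g_def mult.assoc)
  also have "\<dots> = (1 - fps_const q * fps_X ^ 2) * g"
    by (simp only: dil_mult dil_np dil_ip a i1 g_def mult.left_commute)
  finally have "dilate (q ^ j) (dilate q ((1 + fps_X) * g)) = dilate (q ^ j) ((1 - fps_const q * fps_X ^ 2) * g)"
    by simp
  moreover have "dilate (q ^ j) (dilate q ((1 + fps_X) * g)) = (1 + fps_const (q ^ (j + 1)) * fps_X) * G (j + 1)"
    by (simp only: dil_dil dil_mult dil_add dil_1 dil_X dil_const G_def power_add power_one_right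
        mult.assoc [symmetric] fps_const_mult mult.commute[of q "q ^ j"])
  moreover have "dilate (q ^ j) ((1 - fps_const q * fps_X ^ 2) * g) = (1 - fps_const (q ^ j * q ^ j * q) * (fps_X * fps_X)) * G j"
  proof -
    have "fps_const q * (fps_const (q ^ j) * fps_X) ^ 2 = fps_const (q ^ j * q ^ j * q) * (fps_X * fps_X)"
      unfolding fps_const_mult [symmetric] power2_eq_square by (simp only: mult_ac)
    thus ?thesis by (simp only: dil_mult dil_diff dil_1 dil_const dil_power dil_X G_def)
  qed
  ultimately have "(1 + fps_const (q ^ (j + 1)) * fps_X) * G (j + 1)
      = (1 - fps_const (q ^ j * q ^ j * q) * (fps_X * fps_X)) * G j"
    by (simp only:)
  hence e: "G (j + 1) + fps_const (q ^ (j + 1)) * (fps_X * G (j + 1))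
      = G j - fps_const (q ^ j * q ^ j * q) * (fps_X * (fps_X * G j))"
    by (simp only: distrib_right left_diff_distrib mult_1 mult.assoc)
  have "L q (G (j + 1) + fps_const (q ^ (j + 1)) * (fps_X * G (j + 1))) = L q (G (j + 1)) + q ^ (j + 1) * (q * L q (G (j + 2)))"
    using LX[of "j + 1"] by (simp add: L_add[OF q] L_const[OF q] geometric geo_mult geo_X geo_const)
  moreover have "L q (G j - fps_const ((q ^ j * q ^ j * q)) * (fps_X * (fps_X * G j)))
      = L q (G j) - (q ^ j * q ^ j * q) * (q ^ 3 * L q (G (j + 2)))"
    by (simp only: L_diff[OF q] L_const[OF q] LXX geometric geo_mult geo_X geo_const)
  ultimately have "L q (G (j + 1)) + q ^ (j + 1) * (q * L q (G (j + 2))) = L q (G j) - (q ^ j * q ^ j * q) * (q ^ 3 * L q (G (j + 2)))"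
    unfolding e by (simp only:)
  moreover have "q ^ (j + 1) * (q * w) = q ^ (j + 2) * w" "q ^ j * q ^ j * q * (q ^ 3 * w) = q ^ (j + 2) * q ^ (j + 2) * w" for w
    by (simp_all add: eval_nat_numeral mult_ac)
  ultimately have "L q (G (j + 1)) + q ^ (j + 2) * L q (G (j + 2)) = L q (G j) - q ^ (j + 2) * q ^ (j + 2) * L q (G (j + 2))"
    by (simp only:)
  moreover have "f i = L q (G i)" for i by (simp only: f_def G_def g_def)
  ultimately show ?thesis by (simp add: algebra_simps)
qed

lemma bt_bound:
  assumes "norm a \<le> 1"
  shows "norm (bressoud_term q a r) \<le> norm q ^ (Suc r choose 2) * (2 / (1 - norm q)) ^ r"
proof -
  \<comment> \<open>Weakens the exponent 3 r^2 to the weight of L, so that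
    \<open>summable_weight\<close> covers these series too.\<close>
  have r: "(Suc r choose 2) \<le> 3 * r ^ 2"
    by (induction r) (auto simp: numeral_2_eq_2 algebra_simps)
  have a2: "norm (a ^ 2) \<le> 1" and q2: "norm (q ^ 2) \<le> 1" and ar: "norm (a ^ (2 * r)) \<le> 1"
    using assms q by (auto simp: norm_power power_le_one)
  have "norm (bressoud_term q a r) = norm (a ^ (2 * r)) * norm q ^ (3 * r ^ 2) * norm (qpoch (a ^ 2) (q ^ 2) r) / norm (qpoch (q ^ 2) (q ^ 2) r)"
    by (simp add: bressoud_term_def norm_mult norm_divide norm_power)
  also have "\<dots> \<le> 1 * norm q ^ (Suc r choose 2) * 2 ^ r / (1 - norm q) ^ r"
    using r q norm_qpoch_power_ge[OF q, of 2 r] ar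
    by (intro frac_le mult_mono norm_qpoch_le a2 q2 power_decreasing) auto
  finally show ?thesis by (simp add: power_divide)
qed

lemma bt_shift:
  "(1 - a ^ 2) * bressoud_term q (a * q) r = bressoud_term q a r * (q ^ 2) ^ r * (1 - a ^ 2 * (q ^ 2) ^ r)"
proof -
  have "(1 - a ^ 2) * qpoch ((a * q) ^ 2) (q ^ 2) r = qpoch (a ^ 2) (q ^ 2) r * (1 - a ^ 2 * (q ^ 2) ^ r)"
    by (simp only: power_mult_distrib qpoch_rec [symmetric] qpoch_Suc)
  moreover have "(a * q) ^ (2 * r) = a ^ (2 * r) * (q ^ 2) ^ r" by (simp add: power_mult power_mult_distrib)
  moreover have "(1 - a ^ 2) * bressoud_term q (a * q) r = (- 1) ^ r * (a * q) ^ (2 * r) * q ^ (3 * r ^ 2)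
      * ((1 - a ^ 2) * qpoch ((a * q) ^ 2) (q ^ 2) r) / qpoch (q ^ 2) (q ^ 2) r"
    by (simp add: bressoud_term_def)
  ultimately show ?thesis by (simp add: bressoud_term_def)
qed

text \<open>The denominator 1 - q^(2r+2) is cleared because the telescoping term of
  \<open>bA_rec\<close> supplies exactly this factor.\<close>

lemma bt_Suc:
  "bressoud_term q a (Suc r) * (1 - (q ^ 2) ^ Suc r)
     = - (bressoud_term q a r * a ^ 2 * q ^ 3 * ((q ^ 2) ^ r) ^ 3 * (1 - a ^ 2 * (q ^ 2) ^ r))"
proof -
  have q2: "norm (q ^ 2) < 1" by (rule norm_power_less_1[OF q]) simp
  have nz: "qpoch (q ^ 2) (q ^ 2) m \<noteq> 0" for m by (rule qpoch_nonzero[OF q2])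
  have w: "1 - q ^ 2 * (q ^ 2) ^ r \<noteq> 0" using nz[of "Suc r"] by (simp add: qpoch_Suc)
  have e: "q ^ (3 * (Suc r) ^ 2) = q ^ (3 * r ^ 2) * q ^ 3 * ((q ^ 2) ^ r) ^ 3"
  proof -
    have "3 * (Suc r) ^ 2 = 3 * r ^ 2 + 3 + 2 * r * 3" by (simp add: power2_eq_square)
    thus ?thesis by (simp only: power_add power_mult)
  qed
  have a: "a ^ (2 * Suc r) = a ^ (2 * r) * a ^ 2" by (simp add: power_add power2_eq_square)
  show ?thesis using w nz[of r]
    unfolding bressoud_term_def e a qpoch_Suc power_Suc[of "q ^ 2"] by (simp add: mult_ac)
qed

definition bressoud_sum :: "complex \<Rightarrow> complex" where
  "bressoud_sum a = (\<Sum>r. bressoud_term q a r * (1 - a * (q ^ 2) ^ r))"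

lemma bA_term_bound:
  assumes "norm a \<le> 1"
  shows "norm (bressoud_term q a r * (1 - a * (q ^ 2) ^ r)) \<le> 2 * (norm q ^ (Suc r choose 2) * (2 / (1 - norm q)) ^ r)"
proof -
  have "norm a * norm ((q ^ 2) ^ r) \<le> 1"
    using assms q by (intro mult_le_one) (auto simp: norm_power power_le_one)
  hence "norm (1 - a * (q ^ 2) ^ r) \<le> 2"
    using norm_triangle_ineq4[of 1 "a * (q ^ 2) ^ r"] by (simp add: norm_mult)
  hence "norm (bressoud_term q a r) * norm (1 - a * (q ^ 2) ^ r) \<le> (norm q ^ (Suc r choose 2) * (2 / (1 - norm q)) ^ r) * 2"
    using bt_bound[OF assms] q by (intro mult_mono) auto
  thus ?thesis by (simp add: norm_mult mult_ac)
qed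

lemma bA_sums:
  assumes "norm a \<le> 1"
  shows "(\<lambda>r. bressoud_term q a r * (1 - a * (q ^ 2) ^ r)) sums bressoud_sum a"
  unfolding bressoud_sum_def
proof (rule summable_sums, rule summable_comparison_test')
  show "summable (\<lambda>r. 2 * (norm q ^ (Suc r choose 2) * (2 / (1 - norm q)) ^ r))"
    using q by (intro summable_weight[OF q]) auto
qed (use bA_term_bound[OF assms] in auto)

lemma bA_rec:
  assumes a: "norm a \<le> 1"
  shows "(1 + a) * bressoud_sum a = (1 - a ^ 2) * bressoud_sum (a * q) + a * q * (1 - a ^ 2) * (1 - a ^ 2 * q ^ 2) * bressoud_sum (a * q ^ 2)"
proof -
  have a1: "norm (a * q) \<le> 1" and a2: "norm (a * q ^ 2) \<le> 1"
    using a q by (auto simp: norm_mult norm_power intro!: mult_le_one power_le_one)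
  \<comment> \<open>Vanishes at r = 0 because of 1 - (q^2)^r and tends to 0 at infinity, so
    telescoping leaves no boundary term.\<close>
  define C where "C = (\<lambda>r. bressoud_term q a r * ((1 - (q ^ 2) ^ r) * (1 + a - a ^ 2 * (q ^ 2) ^ r)))"
  have diff: "(1 + a) * (bressoud_term q a r * (1 - a * (q ^ 2) ^ r)) - (1 - a ^ 2) * (bressoud_term q (a * q) r * (1 - a * q * (q ^ 2) ^ r))
      - a * q * (1 - a ^ 2) * (1 - a ^ 2 * q ^ 2) * (bressoud_term q (a * q ^ 2) r * (1 - a * q ^ 2 * (q ^ 2) ^ r))
      = C r - C (Suc r)" for r
  proof -
    define Y where "Y = (q ^ 2) ^ r"
    define t where "t = bressoud_term q a r"
    have 1: "(1 - a ^ 2) * bressoud_term q (a * q) r = t * Y * (1 - a ^ 2 * Y)"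
      unfolding bt_shift Y_def t_def ..
    have aa: "(a * q) ^ 2 = a ^ 2 * q ^ 2" "a * q * q = a * q ^ 2"
      by (simp_all add: power_mult_distrib power2_eq_square)
    have "(1 - a ^ 2 * q ^ 2) * bressoud_term q (a * q ^ 2) r = bressoud_term q (a * q) r * Y * (1 - a ^ 2 * q ^ 2 * Y)"
      using bt_shift[of "a * q" r] unfolding aa Y_def .
    hence "(1 - a ^ 2) * ((1 - a ^ 2 * q ^ 2) * bressoud_term q (a * q ^ 2) r) = ((1 - a ^ 2) * bressoud_term q (a * q) r) * Y * (1 - a ^ 2 * q ^ 2 * Y)"
      by (simp only: mult.assoc)
    hence 2: "(1 - a ^ 2) * ((1 - a ^ 2 * q ^ 2) * bressoud_term q (a * q ^ 2) r) = t * Y ^ 2 * (1 - a ^ 2 * Y) * (1 - a ^ 2 * q ^ 2 * Y)"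
      unfolding 1 by (simp only: power2_eq_square mult_ac)
    have 3: "bressoud_term q a (Suc r) * (1 - (q ^ 2) ^ Suc r) = - (t * a ^ 2 * q ^ 3 * Y ^ 3 * (1 - a ^ 2 * Y))"
      unfolding bt_Suc Y_def t_def ..
    have "C (Suc r) = (bressoud_term q a (Suc r) * (1 - (q ^ 2) ^ Suc r)) * (1 + a - a ^ 2 * q ^ 2 * Y)"
      unfolding C_def Y_def power_Suc by (simp only: mult.assoc)
    hence C: "C r - C (Suc r) = t * ((1 - Y) * (1 + a - a ^ 2 * Y))
      - (- (t * a ^ 2 * q ^ 3 * Y ^ 3 * (1 - a ^ 2 * Y))) * (1 + a - a ^ 2 * q ^ 2 * Y)"
      unfolding 3 by (simp only: C_def Y_def t_def)
    have "(1 - a ^ 2) * (bressoud_term q (a * q) r * (1 - a * q * Y)) = t * Y * (1 - a ^ 2 * Y) * (1 - a * q * Y)"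
      unfolding 1 [symmetric] by (simp only: mult.assoc)
    moreover have "a * q * (1 - a ^ 2) * (1 - a ^ 2 * q ^ 2) * (bressoud_term q (a * q ^ 2) r * (1 - a * q ^ 2 * Y))
       = a * q * (t * Y ^ 2 * (1 - a ^ 2 * Y) * (1 - a ^ 2 * q ^ 2 * Y) * (1 - a * q ^ 2 * Y))"
      unfolding 2 [symmetric] by (simp only: mult.assoc)
    ultimately show ?thesis
      unfolding C bt_poly [symmetric] Y_def [symmetric] t_def [symmetric] by (simp only:)
  qed
  have Y: "(\<lambda>r. (q ^ 2) ^ r) \<longlonglongrightarrow> 0"
    by (intro LIMSEQ_power_zero norm_power_less_1 q) auto
  have "summable (\<lambda>r. 1 * (norm q ^ (Suc r choose 2) * (2 / (1 - norm q)) ^ r))"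
    using q by (intro summable_weight[OF q]) auto
  hence "summable (bressoud_term q a)"
    by (rule summable_comparison_test') (use bt_bound[OF a] in auto)
  hence "C \<longlonglongrightarrow> 0 * ((1 - 0) * (1 + a - a ^ 2 * 0))"
    unfolding C_def by (intro tendsto_intros Y summable_LIMSEQ_zero)
  hence "C \<longlonglongrightarrow> 0" by simp
  from telescope_sums'[OF this] have "(\<lambda>r. C r - C (Suc r)) sums 0" by (simp add: C_def)
  moreover have "(\<lambda>r. C r - C (Suc r)) sums ((1 + a) * bressoud_sum a - (1 - a ^ 2) * bressoud_sum (a * q)
      - a * q * (1 - a ^ 2) * (1 - a ^ 2 * q ^ 2) * bressoud_sum (a * q ^ 2))"
    unfolding diff [symmetric] by (intro sums_diff sums_mult bA_sums a a1 a2)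
  ultimately have "0 = (1 + a) * bressoud_sum a - (1 - a ^ 2) * bressoud_sum (a * q)
      - a * q * (1 - a ^ 2) * (1 - a ^ 2 * q ^ 2) * bressoud_sum (a * q ^ 2)"
    by (rule sums_unique2)
  thus ?thesis by (simp add: algebra_simps)
qed

end

lemma qpoch_inf_0 [simp]: "qpoch_inf 0 p = 1"
  by (simp add: qpoch_inf_def)

text \<open>At q = 0 the weight 0^(n(n+1)/2) keeps only the constant coefficient. Serves the
  degenerate case of the theorem.\<close>

lemma F_zero: "F 0 0 0 0 0 = 1"
proof -
  have z: "norm (0 :: complex) < 1" by simp
  define g where "g = inv_poch_fps 0 0 1 * (inv_poch_fps 0 0 2 * (inv_poch_fps 0 0 3 * poch_fps 0 0 4))"
  have g: "geometric g" unfolding g_def by (intro geo_mult geo_ip geo_np z) auto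
  have g0: "g $ 0 = 1" by (simp add: g_def fps_mult_nth_0 ip_nth_0 np_nth_0)
  have "(\<lambda>n. 0 ^ (Suc n choose 2) * g $ n) = (\<lambda>n. if n = 0 then g $ 0 else 0)"
    by (auto simp: fun_eq_iff numeral_2_eq_2)
  hence "(\<lambda>n. 0 ^ (Suc n choose 2) * g $ n) sums 1"
    using sums_single[of 0 "\<lambda>_. g $ 0"] g0 by simp
  with L_sums[OF z g] have "L 0 g = 1" by (rule sums_unique2)
  thus ?thesis using F_eq_L[OF z, of 0 0 0 0] by (simp add: g_def)
qed

context
  fixes q :: complex
  assumes q: "norm q < 1"
begin

text \<open>As a -> 0 the factor a^(2r) removes every term except r = 0.\<close>

lemma bA_tendsto: "(\<lambda>j. bressoud_sum q (q ^ (j + 1))) \<longlonglongrightarrow> 1"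
proof -
  define b where "b = (\<lambda>r. bressoud_term q 0 r * (1 - 0 * (q ^ 2) ^ r))"
  have nz: "qpoch (q ^ 2) (q ^ 2) r \<noteq> 0" for r
    by (intro qpoch_nonzero norm_power_less_1 q) auto
  have x: "(\<lambda>j. q ^ (j + 1)) \<longlonglongrightarrow> 0"
    by (rule LIMSEQ_ignore_initial_segment[OF LIMSEQ_power_zero[OF q]])
  have x1: "norm (q ^ (j + 1)) \<le> 1" for j using q by (simp only: norm_power power_le_one norm_ge_zero less_imp_le)
  have lim: "(\<lambda>j. bressoud_term q (q ^ (j + 1)) r * (1 - q ^ (j + 1) * (q ^ 2) ^ r)) \<longlonglongrightarrow> b r" for r
    unfolding b_def bressoud_term_def qpoch_def[of "_ ^ 2" "q ^ 2"]
    using nz[of r] unfolding qpoch_def by (intro tendsto_intros x)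
  have "(\<lambda>j. bressoud_sum q (q ^ (j + 1))) \<longlonglongrightarrow> (\<Sum>r. b r)"
    unfolding bressoud_sum_def[OF q]
    by (rule tannerys_theorem[where M = "\<lambda>r. 2 * (norm q ^ (Suc r choose 2) * (2 / (1 - norm q)) ^ r)",
        THEN conjunct2, THEN conjunct2])
       (use lim bA_term_bound[OF q x1] summable_weight[OF q, of "2 / (1 - norm q)" 2] q in
         \<open>auto intro!: always_eventually\<close>)
  moreover have "b = (\<lambda>r. if r = 0 then 1 else 0)"
    by (auto simp: b_def bressoud_term_def fun_eq_iff)
  hence "(\<Sum>r. b r) = 1"
    using sums_unique[OF sums_single[of 0 "\<lambda>_. 1 :: complex"]] by simp
  ultimately show ?thesis by simp
qed

text \<open>Dilations of the argument by q^j on one side and parameters a = q^(j+1) on the other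
  give two sequences with the same three-term recurrence and the same limit 1;
  \<open>recurrence_zero\<close> identifies them, and j = 0 is the claim.\<close>

lemma L_bressoud: "L q (poch_fps q (- q) 1 * inv_poch_fps q q 2) = bressoud_sum q q / qpoch_inf q q"
proof -
  define g where "g = poch_fps q (- q) 1 * inv_poch_fps q q 2"
  define f where "f = (\<lambda>j. L q (dilate (q ^ j) g))"
  define Z where "Z = (\<lambda>j. qpoch_inf (q ^ (j + 1)) q)"
  \<comment> \<open>Division by (a; q) at a = q^(j+1) absorbs the factors 1 - a and 1 - a q of
    \<open>bA_rec\<close> and leaves the coefficients of \<open>bressoud_rec\<close>.\<close>
  define u where "u = (\<lambda>j. bressoud_sum q (q ^ (j + 1)) / Z j)"
  have qn: "norm (q ^ (j + 1)) < 1" for j by (rule norm_power_less_1[OF q]) simp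
  have Z0: "Z j \<noteq> 0" for j unfolding Z_def by (rule qpoch_inf_nonzero[OF q qn])
  have ZS: "Z j = (1 - q ^ (j + 1)) * Z (j + 1)" for j
    using qpoch_inf_split[OF q, of "q ^ (j + 1)" 1] by (simp add: Z_def qpoch_def mult_ac)
  have f_rec: "f j = f (j + 1) + q ^ (j + 2) * (1 + q ^ (j + 2)) * f (j + 2)" for j
    unfolding f_def g_def by (rule bressoud_rec[OF q])
  have u_rec: "u j = u (j + 1) + q ^ (j + 2) * (1 + q ^ (j + 2)) * u (j + 2)" for j
  proof -
    define a where "a = q ^ (j + 1)"
    define P where "P = Z (j + 2)"
    have an: "norm a < 1" unfolding a_def by (rule qn)
    have aq: "a * q = q ^ (j + 2)" "a * q ^ 2 = q ^ (j + 3)" by (simp_all add: a_def eval_nat_numeral)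
    have a1: "1 + a \<noteq> 0" using an by (metis add_eq_0_iff norm_minus_cancel norm_one order_less_irrefl)
    have Z1: "Z (j + 1) = (1 - a * q) * P" using ZS[of "j + 1"] by (simp add: P_def aq)
    have Zj: "Z j = (1 - a) * ((1 - a * q) * P)" using ZS[of j] Z1 by (simp add: a_def)
    have nz: "1 - a \<noteq> 0" "1 - a * q \<noteq> 0" "P \<noteq> 0" using Z0[of j] unfolding Zj by auto
    have "(1 + a) * bressoud_sum q a = (1 - a ^ 2) * bressoud_sum q (a * q) + a * q * (1 - a ^ 2) * (1 - a ^ 2 * q ^ 2) * bressoud_sum q (a * q ^ 2)"
      using an by (intro bA_rec[OF q]) auto
    also have "\<dots> = (1 + a) * ((1 - a) * bressoud_sum q (a * q) + a * q * (1 - a) * (1 - a * q) * (1 + a * q) * bressoud_sum q (a * q ^ 2))"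
      by algebra
    finally have A: "bressoud_sum q a = (1 - a) * bressoud_sum q (a * q) + a * q * (1 - a) * (1 - a * q) * (1 + a * q) * bressoud_sum q (a * q ^ 2)"
      using a1 by simp
    have "u j = bressoud_sum q a / ((1 - a) * ((1 - a * q) * P))" by (simp add: u_def a_def Zj[unfolded a_def])
    also have "\<dots> = bressoud_sum q (a * q) / ((1 - a * q) * P) + a * q * (1 + a * q) * (bressoud_sum q (a * q ^ 2) / P)"
      unfolding A using nz by (simp add: divide_simps) (simp add: algebra_simps)
    also have "\<dots> = u (j + 1) + q ^ (j + 2) * (1 + q ^ (j + 2)) * u (j + 2)"
      unfolding u_def Z1 P_def [symmetric] aq by (simp add: Z1 P_def aq numeral_3_eq_3 numeral_2_eq_2)
    finally show ?thesis .
  qed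
  have "f \<longlonglongrightarrow> 1"
  proof -
    have "coeff_bound 1 (2 * (1 / (1 - norm q) + 1 / (1 - norm q))) g"
      unfolding g_def using q norm_ge_zero[of q]
      by (intro bd_mult1 bd_np[OF q] bd_ip[OF q]) (auto simp: field_simps simp del: norm_ge_zero)
    hence b: "coeff_bound 1 (2 * (1 / (1 - norm q) + 1 / (1 - norm q))) (dilate (q ^ j) g)" for j
      using q by (intro bd_dil) (auto simp: norm_power power_le_one)
    have g0: "g $ 0 = 1" by (simp add: g_def fps_mult_nth_0 ip_nth_0[OF q] np_nth_0[OF q])
    have "(\<lambda>j. dilate (q ^ j) g $ n) \<longlonglongrightarrow> (1 :: complex fps) $ n" for n
    proof (cases "n = 0")
      case False
      have "(\<lambda>j. (q ^ n) ^ j * g $ n) \<longlonglongrightarrow> 0 * g $ n"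
        using False by (intro tendsto_intros LIMSEQ_power_zero norm_power_less_1 q) auto
      thus ?thesis using False by (simp add: mult.commute[of n] flip: power_mult)
    qed (simp add: g0)
    hence "f \<longlonglongrightarrow> L q 1" unfolding f_def
      using q by (intro L_tendsto[OF q b]) auto
    thus ?thesis by (simp add: L_one[OF q])
  qed
  moreover have "u \<longlonglongrightarrow> 1"
  proof -
    have "qpoch_inf q q = qpoch q q j * Z j" for j
      using qpoch_inf_split[OF q, of q j] by (simp add: Z_def)
    hence Zj: "Z j = qpoch_inf q q / qpoch q q j" for j
      using qpoch_nonzero[OF q, of j] by (simp add: field_simps)
    have "Z \<longlonglongrightarrow> qpoch_inf q q / qpoch_inf q q"
      unfolding Zj by (intro tendsto_intros qpoch_tendsto qpoch_inf_nonzero q)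
    hence "Z \<longlonglongrightarrow> 1" using qpoch_inf_nonzero[OF q q] by simp
    from tendsto_divide[OF bA_tendsto this] show ?thesis by (simp add: u_def)
  qed
  ultimately have lim: "(\<lambda>j. f j - u j) \<longlonglongrightarrow> 0"
    using tendsto_diff by fastforce
  have "f 0 - u 0 = 0"
  proof (rule recurrence_zero[where M = "\<lambda>n. 2 * norm q ^ n" and d = "\<lambda>j. f j - u j"])
    show "summable (\<lambda>n. 2 * norm q ^ n)" using q by (intro summable_mult summable_geometric) auto
    fix n
    define e where "e = q ^ (n + 2) * (1 + q ^ (n + 2))"
    define m where "m = max (norm (f (n + 1) - u (n + 1))) (norm (f (n + 2) - u (n + 2)))"
    have "norm e \<le> 2 * norm q ^ n"
    proof -
      have "norm (1 + q ^ (n + 2)) \<le> 2"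
        using norm_triangle_ineq[of 1 "q ^ (n + 2)"] qn[of "n + 1"] by simp
      moreover have "norm (q ^ (n + 2)) \<le> norm q ^ n"
        unfolding norm_power using q by (intro power_decreasing) auto
      ultimately have "norm (q ^ (n + 2)) * norm (1 + q ^ (n + 2)) \<le> norm q ^ n * 2"
        by (intro mult_mono) auto
      thus ?thesis by (simp add: e_def norm_mult)
    qed
    hence "norm (f (n + 1) - u (n + 1)) + norm e * norm (f (n + 2) - u (n + 2)) \<le> m + 2 * norm q ^ n * m"
      by (intro add_mono mult_mono) (auto simp: m_def)
    moreover have "f n - u n = (f (n + 1) - u (n + 1)) + e * (f (n + 2) - u (n + 2))"
      using f_rec[of n, folded e_def] u_rec[of n, folded e_def] by (simp add: algebra_simps)
    hence "norm (f n - u n) \<le> norm (f (n + 1) - u (n + 1)) + norm e * norm (f (n + 2) - u (n + 2))"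
      using norm_triangle_ineq[of "f (n + 1) - u (n + 1)" "e * (f (n + 2) - u (n + 2))"] by (simp only: norm_mult)
    ultimately show "norm (f n - u n) \<le> (1 + 2 * norm q ^ n) * max (norm (f (n + 1) - u (n + 1))) (norm (f (n + 2) - u (n + 2)))"
      unfolding m_def [symmetric] by (simp add: algebra_simps)
  qed (use lim in auto)
  moreover have "dilate (q ^ 0) g = g" by (rule fps_ext) simp
  ultimately show ?thesis by (simp add: f_def u_def Z_def g_def)
qed

text \<open>The triple product at u = -q^5, v = -q, where u v = q^6: the terms n = r and n = -r - 1
  together give the r-th summand, since the finite products cancel at a = q.\<close>

lemma bA_q:
  assumes q0: "q \<noteq> 0"
  shows "bressoud_sum q q = qpoch_inf (q ^ 5) (q ^ 6) * qpoch_inf q (q ^ 6) * qpoch_inf (q ^ 6) (q ^ 6)"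
proof -
  have uv: "- (q ^ 5) * - q = q ^ 6" by (simp add: eval_nat_numeral)
  have nz: "qpoch (q ^ 2) (q ^ 2) r \<noteq> 0" for r
    by (intro qpoch_nonzero norm_power_less_1 q) auto
  have "norm (- (q ^ 5) * - q) < 1" unfolding uv using norm_power_less_1[OF q] by simp
  moreover have "- (q ^ 5) * - q \<noteq> 0" using q0 by simp
  ultimately have "((\<lambda>n. (- (q ^ 5)) ^ tri n * (- q) ^ tri (- n)) has_sum
     (qpoch_inf (- (- (q ^ 5))) (q ^ 6) * qpoch_inf (- (- q)) (q ^ 6) * qpoch_inf (q ^ 6) (q ^ 6))) UNIV"
    using jacobi_triple_product[of "- (q ^ 5)" "- q"] unfolding uv by blast
  from has_sum_int_pairs[OF this]
  have "(\<lambda>r. (- (q ^ 5)) ^ tri (int r) * (- q) ^ tri (- int r)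
      + (- (q ^ 5)) ^ tri (- int (Suc r)) * (- q) ^ tri (- (- int (Suc r))))
    sums (qpoch_inf (q ^ 5) (q ^ 6) * qpoch_inf q (q ^ 6) * qpoch_inf (q ^ 6) (q ^ 6))"
    by (simp only: minus_minus)
  moreover have "(- (q ^ 5)) ^ tri (int r) * (- q) ^ tri (- int r)
      + (- (q ^ 5)) ^ tri (- int (Suc r)) * (- q) ^ tri (- (- int (Suc r)))
    = bressoud_term q q r * (1 - q * (q ^ 2) ^ r)" for r
  proof -
    define T where "T = (r choose 2)"
    have T1: "Suc r choose 2 = T + r" and T2: "Suc (Suc r) choose 2 = T + r + Suc r"
      by (simp_all add: T_def numeral_2_eq_2)
    have r2: "r ^ 2 = 2 * T + r"
      unfolding T_def by (induction r) (auto simp: numeral_2_eq_2)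
    have A: "(- (q ^ 5)) ^ (T + r) = (- (q ^ 5)) ^ T * ((- 1) ^ r * (q ^ 5) ^ r)"
      by (simp add: power_add power_minus[of "q ^ 5" r])
    have B: "(- (q ^ 5)) ^ T * (- q) ^ T = (q ^ 6) ^ T"
      by (simp only: power_mult_distrib [symmetric] uv)
    have C: "(- q) ^ (T + r + Suc r) = (- q) ^ T * (- (q * (q ^ 2) ^ r))"
    proof -
      have "(- q) ^ (r + r) = (q ^ 2) ^ r" by (simp add: power_mult [symmetric] mult_2 [symmetric] power_even_eq)
      moreover have "T + r + Suc r = T + ((r + r) + 1)" by simp
      ultimately show ?thesis by (simp only: power_add power_one_right) simp
    qed
    have D: "bressoud_term q q r = (- 1) ^ r * ((q ^ 5) ^ r * (q ^ 6) ^ T)"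
    proof -
      have "q ^ (2 * r) * q ^ (3 * r ^ 2) = (q ^ 5) ^ r * (q ^ 6) ^ T"
        unfolding r2 power_mult [symmetric] power_add [symmetric] by (rule arg_cong[where f = "\<lambda>n. q ^ n"]) simp
      thus ?thesis using nz[of r] by (simp add: bressoud_term_def mult.assoc)
    qed
    have "(- (q ^ 5)) ^ (T + r) * (- q) ^ T + (- (q ^ 5)) ^ (T + r) * (- q) ^ (T + r + Suc r)
        = ((- (q ^ 5)) ^ T * (- q) ^ T) * ((- 1) ^ r * (q ^ 5) ^ r) * (1 - q * (q ^ 2) ^ r)"
      unfolding A C by (simp add: algebra_simps)
    thus ?thesis
      unfolding minus_minus tri_int tri_neg T1 T2 T_def [symmetric] B D by (simp add: mult_ac)
  qed
  ultimately have "(\<lambda>r. bressoud_term q q r * (1 - q * (q ^ 2) ^ r)) sums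
      (qpoch_inf (q ^ 5) (q ^ 6) * qpoch_inf q (q ^ 6) * qpoch_inf (q ^ 6) (q ^ 6))"
    by (simp only:)
  moreover have "(\<lambda>r. bressoud_term q q r * (1 - q * (q ^ 2) ^ r)) sums bressoud_sum q q"
    using q by (intro bA_sums[OF q]) auto
  ultimately show ?thesis by (rule sums_unique2[THEN sym])
qed

end

section \<open>The sums as values of L on the two families\<close>

context
  fixes q :: complex
  assumes q: "norm q < 1"
begin

text \<open>Two differences of squares: q^4 x^4 splits into q^2 x^2 and -q^2 x^2, and q^2 x^2 into q
  x and -q x.\<close>

lemma N4: "poch_fps q (q ^ 4) 4 = poch_fps q q 1 * (poch_fps q (- q) 1 * poch_fps q (- (q ^ 2)) 2)"
proof -
  have a: "poch_fps q (q ^ 2) 2 * poch_fps q (- (q ^ 2)) 2 = poch_fps q (q ^ 4) 4"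
    using np_mult_minus[OF q, of 2 "q ^ 2"] by (simp flip: power_mult)
  have b: "poch_fps q q 1 * poch_fps q (- q) 1 = poch_fps q (q ^ 2) 2"
    using np_mult_minus[OF q, of 1 q] by simp
  show ?thesis by (simp only: mult.assoc [symmetric] b a)
qed

text \<open>The factor (qx; q) of \<open>N4\<close> cancels the denominator, so sums with u = q and
  t = q^4 have no (ux; q) left.\<close>

lemma ip_N4: "inv_poch_fps q q 1 * (Y * (Z * poch_fps q (q ^ 4) 4)) = poch_fps q (- q) 1 * (poch_fps q (- (q ^ 2)) 2 * (Z * Y))"
proof -
  have n: "poch_fps q q 1 * inv_poch_fps q q 1 = 1" using np_ip[OF q, of 1 q] by simp
  have "inv_poch_fps q q 1 * (Y * (Z * poch_fps q (q ^ 4) 4))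
      = (poch_fps q q 1 * inv_poch_fps q q 1) * (poch_fps q (- q) 1 * (poch_fps q (- (q ^ 2)) 2 * (Z * Y)))"
    unfolding N4 by (simp only: mult_ac)
  thus ?thesis unfolding n mult_1 .
qed

text \<open>The series shared by the first two sums; not to be confused with the family B(e) of the
  overview.\<close>

definition B where "B = poch_fps q (- q) 1 * (poch_fps q (- (q ^ 2)) 2 * (inv_poch_fps q 1 3 * inv_poch_fps q q 2))"

lemma geo_B: "geometric B" unfolding B_def by (intro geo_mult geo_np geo_ip q) auto

lemma np_1_1: "poch_fps q 1 1 = (1 - fps_X) * poch_fps q q 1"
  using np_shift'[OF q, of 1 q 1] by simp

lemma np_m1_1: "poch_fps q (- 1) 1 = (1 + fps_X) * poch_fps q (- q) 1"
  using np_shift'[OF q, of 1 "- q" "- 1"] by (simp flip: fps_const_neg)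

lemma np_m1_2: "poch_fps q (- 1) 2 = (1 + fps_X ^ 2) * poch_fps q (- (q ^ 2)) 2"
  using np_shift'[OF q, of 2 "- (q ^ 2)" "- 1"] by (simp flip: fps_const_neg)

lemma ip_np_1: "(1 - fps_X) * (poch_fps q q 1 * inv_poch_fps q 1 1) = 1"
  using np_ip[OF q, of 1 1] unfolding np_1_1 by (simp only: mult.assoc)

text \<open>Shifting (q^3 x^3; q^3) to (x^3; q^3) produces 1 - x^3 = (1 - x) (1 + x + x^2), whose
  factor 1 - x cancels against 1 / (x; q).\<close>

lemma F1_eq: "F q q (q ^ 3) (q ^ 6) (q ^ 8) = L q ((1 + fps_X + fps_X ^ 2) * B)"
proof -
  have i3: "inv_poch_fps q (q ^ 3) 3 = (1 - fps_X ^ 3) * inv_poch_fps q 1 3"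
    using ip_shift'[OF q, of 3 "q ^ 3" 1] by simp
  have c: "1 - x ^ 3 = (1 - x) * (1 + x + x ^ 2)" for x :: "complex fps"
    by (simp add: algebra_simps power2_eq_square power3_eq_cube)
  have "inv_poch_fps q 1 1 * (inv_poch_fps q q 2 * (inv_poch_fps q (q ^ 3) 3 * poch_fps q (q ^ 4) 4))
      = ((1 - fps_X) * (poch_fps q q 1 * inv_poch_fps q 1 1)) * ((1 + fps_X + fps_X ^ 2) * B)"
    unfolding i3 c N4 B_def by (simp only: mult_ac)
  hence "inv_poch_fps q 1 1 * (inv_poch_fps q q 2 * (inv_poch_fps q (q ^ 3) 3 * poch_fps q (q ^ 4) 4)) = (1 + fps_X + fps_X ^ 2) * B"
    unfolding ip_np_1 by simp
  moreover have "q * 1 = q" "q ^ 2 * q = q ^ 3" "q ^ 3 * q ^ 3 = q ^ 6" "q ^ 4 * q ^ 4 = q ^ 8"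
    by (simp_all add: eval_nat_numeral)
  ultimately show ?thesis using F_eq_L[OF q, of 1 q "q ^ 3" "q ^ 4"] by (simp only:)
qed

text \<open>The argument of the second sum is \<open>B\<close> dilated by q, and the factor q in
  front is the one from \<open>L_X\<close>.\<close>

lemma F2_eq: "q * F q (q ^ 3) (q ^ 5) (q ^ 6) (q ^ 12) = L q (fps_X * B)"
proof -
  have a: "q * q ^ 1 = q ^ 2" "q * q ^ 2 = q ^ 3" "1 * q ^ 3 = q ^ 3" "q ^ 4 * q ^ 4 = q ^ 8"
    by (simp_all add: eval_nat_numeral)
  have "dilate q (inv_poch_fps q q 1 * (inv_poch_fps q q 2 * (inv_poch_fps q 1 3 * poch_fps q (q ^ 4) 4)))
      = inv_poch_fps q (q ^ 2) 1 * (inv_poch_fps q (q ^ 3) 2 * (inv_poch_fps q (q ^ 3) 3 * poch_fps q (q ^ 8) 4))"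
    by (simp only: dil_mult dil_ip dil_np a)
  hence "dilate q B = inv_poch_fps q (q ^ 2) 1 * (inv_poch_fps q (q ^ 3) 2 * (inv_poch_fps q (q ^ 3) 3 * poch_fps q (q ^ 8) 4))"
    unfolding ip_N4 B_def .
  moreover have "q ^ 2 * q ^ 3 = q ^ 5" "q ^ 3 * q ^ 3 = q ^ 6" "q ^ 4 * q ^ 8 = q ^ 12"
    by (simp_all add: eval_nat_numeral)
  ultimately have "F q (q ^ 3) (q ^ 5) (q ^ 6) (q ^ 12) = L q (dilate q B)"
    using F_eq_L[OF q, of "q ^ 2" "q ^ 3" "q ^ 3" "q ^ 8"] a(2) by (simp only:)
  thus ?thesis using L_X[OF q geo_B] by simp
qed

lemma F3_eq: "F q (q ^ 2) (q ^ 3) (q ^ 5) (q ^ 8) = L q (family_c q (- (q ^ 2)))"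
proof -
  have "q * q = q ^ 2" "q ^ 2 * q = q ^ 3" "q ^ 3 * q ^ 2 = q ^ 5" "q ^ 4 * q ^ 4 = q ^ 8"
    by (simp_all add: eval_nat_numeral)
  hence "F q (q ^ 2) (q ^ 3) (q ^ 5) (q ^ 8) = L q (inv_poch_fps q q 1 * (inv_poch_fps q q 2 * (inv_poch_fps q (q ^ 2) 3 * poch_fps q (q ^ 4) 4)))"
    using F_eq_L[OF q, of q q "q ^ 2" "q ^ 4"] by (simp only:)
  thus ?thesis unfolding ip_N4 family_c_def minus_minus .
qed

text \<open>The prefactors differ by 1 + x^2, which completes (-q^2 x^2; q^2) to (-x^2; q^2), the
  numerator product at c = -1.\<close>

lemma F12_diff:
  "F q q (q ^ 3) (q ^ 6) (q ^ 8) - q * F q (q ^ 3) (q ^ 5) (q ^ 6) (q ^ 12) = L q (family_c q (- 1))"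
proof -
  have "L q ((1 + fps_X + fps_X ^ 2) * B) - L q (fps_X * B) = L q ((1 + fps_X + fps_X ^ 2) * B - fps_X * B)"
    by (intro L_diff[OF q, symmetric] geo_mult geo_add geo_1 geo_X geo_power geo_B)
  also have "(1 + fps_X + fps_X ^ 2) * B - fps_X * B = (1 + fps_X ^ 2) * B"
    by (simp add: algebra_simps)
  also have "\<dots> = family_c q (- 1)"
    unfolding family_c_def np_m1_2 B_def minus_minus by (simp only: mult_ac)
  finally show ?thesis unfolding F1_eq F2_eq .
qed

text \<open>The prefactors add up to (1 + x)^2. One factor is the linear factor of the family at e =
  1; the other completes (-qx; q) to (-x; q), and (x; q) (-x; q) = (x^2; q^2).\<close>

lemma F12_sum:
  "F q q (q ^ 3) (q ^ 6) (q ^ 8) + q * F q (q ^ 3) (q ^ 5) (q ^ 6) (q ^ 12) = L q (family_e q 1)"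
proof -
  have n12: "poch_fps q 1 2 = poch_fps q 1 1 * poch_fps q (- 1) 1"
    using np_mult_minus[OF q, of 1 1] by simp
  have n11: "poch_fps q 1 1 * inv_poch_fps q 1 1 = 1" using np_ip[OF q, of 1 1] by simp
  have "family_e q 1 = (1 + fps_X) * (poch_fps q 1 2 * (poch_fps q (- (q ^ 2)) 2 * (inv_poch_fps q 1 1 * (inv_poch_fps q q 2 * inv_poch_fps q 1 3))))"
    by (simp add: family_e_def)
  also have "\<dots> = (poch_fps q 1 1 * inv_poch_fps q 1 1) * ((1 + fps_X) * ((1 + fps_X) * B))"
    unfolding n12 np_m1_1 B_def by (simp only: mult_ac)
  also have "\<dots> = (1 + fps_X) * ((1 + fps_X) * B)" unfolding n11 by simp
  finally have family_e: "family_e q 1 = (1 + fps_X) * ((1 + fps_X) * B)" .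
  have "L q ((1 + fps_X + fps_X ^ 2) * B) + L q (fps_X * B) = L q ((1 + fps_X + fps_X ^ 2) * B + fps_X * B)"
    by (intro L_add[OF q, symmetric] geo_mult geo_add geo_1 geo_X geo_power geo_B)
  also have "(1 + fps_X + fps_X ^ 2) * B + fps_X * B = (1 + fps_X) * ((1 + fps_X) * B)"
    by (simp add: algebra_simps power2_eq_square)
  finally show ?thesis unfolding F1_eq F2_eq family_e .
qed

text \<open>The four arguments are M(x), M(qx), M(q^2 x), M(q^3 x), and x^k passes through L with
  the factor q^(k(k+1)/2), that is q, q^3, q^6. The combination is therefore L((1 + x + x^2 - q x^3)
  M), where q^7 = q q^6, and \<open>certificate_4\<close> finishes.\<close>

lemma F4_eq:
  assumes q0: "q \<noteq> 0"
  shows "F q (q ^ 2) (q ^ 3) (q ^ 4) (q ^ 8)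
         + q * F q (q ^ 3) (q ^ 5) (q ^ 7) (q ^ 12)
         + q ^ 3 * F q (q ^ 4) (q ^ 7) (q ^ 10) (q ^ 16)
         - q ^ 7 * F q (q ^ 5) (q ^ 9) (q ^ 13) (q ^ 20)
     = L q (family_c q (- (1 / q ^ 2)))"
proof -
  define x where "x = (fps_X :: complex fps)"
  define Q where "Q = fps_const q"
  define i where "i = fps_const (1 / q)"
  define M where "M = inv_poch_fps q q 1 * (inv_poch_fps q q 2 * (inv_poch_fps q q 3 * poch_fps q (q ^ 4) 4))"
  have M': "M = poch_fps q (- q) 1 * (poch_fps q (- (q ^ 2)) 2 * (inv_poch_fps q q 3 * inv_poch_fps q q 2))"
    unfolding M_def ip_N4 ..
  have gM: "geometric M" unfolding M_def by (intro geo_mult geo_np geo_ip q) auto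
  define M1 where "M1 = inv_poch_fps q (q ^ 2) 1 * (inv_poch_fps q (q ^ 3) 2 * (inv_poch_fps q (q ^ 4) 3 * poch_fps q (q ^ 8) 4))"
  define M2 where "M2 = inv_poch_fps q (q ^ 3) 1 * (inv_poch_fps q (q ^ 5) 2 * (inv_poch_fps q (q ^ 7) 3 * poch_fps q (q ^ 12) 4))"
  define M3 where "M3 = inv_poch_fps q (q ^ 4) 1 * (inv_poch_fps q (q ^ 7) 2 * (inv_poch_fps q (q ^ 10) 3 * poch_fps q (q ^ 16) 4))"
  have g1: "geometric M1" and g2: "geometric M2" unfolding M1_def M2_def by (intro geo_mult geo_np geo_ip q; simp)+
  have e: "q ^ a * q ^ b = q ^ (a + b)" "q * q ^ b = q ^ Suc b" for a b
    by (simp_all add: power_add)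
  have d1: "dilate q M = M1" and d2: "dilate q M1 = M2" and d3: "dilate q M2 = M3"
    unfolding M_def M1_def M2_def M3_def dil_mult dil_ip dil_np e by (simp_all add: power2_eq_square)
  have e2: "q * q = q ^ 2" "q ^ 2 * q = q ^ 3" "q ^ 3 * q = q ^ 4" by (simp_all add: eval_nat_numeral)
  have f0: "F q (q ^ 2) (q ^ 3) (q ^ 4) (q ^ 8) = L q M"
    using F_eq_L[OF q, of q q q "q ^ 4"] unfolding e2 e M_def [symmetric] by simp
  have f1: "F q (q ^ 3) (q ^ 5) (q ^ 7) (q ^ 12) = L q M1"
    using F_eq_L[OF q, of "q ^ 2" "q ^ 3" "q ^ 4" "q ^ 8"] unfolding e M1_def [symmetric] by simp
  have f2: "F q (q ^ 4) (q ^ 7) (q ^ 10) (q ^ 16) = L q M2"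
    using F_eq_L[OF q, of "q ^ 3" "q ^ 5" "q ^ 7" "q ^ 12"] unfolding e M2_def [symmetric] by simp
  have f3: "F q (q ^ 5) (q ^ 9) (q ^ 13) (q ^ 20) = L q M3"
    using F_eq_L[OF q, of "q ^ 4" "q ^ 7" "q ^ 10" "q ^ 16"] unfolding e M3_def [symmetric] by simp
  have LX: "L q (fps_X * g) = q * L q (dilate q g)" if "geometric g" for g by (rule L_X[OF q that])
  have dX: "dilate q (fps_X * g) = fps_const q * (fps_X * dilate q g)" for g
    by (simp only: dil_mult dil_X mult.assoc)
  have x1: "L q (fps_X * M) = q * L q M1" using LX[OF gM] d1 by simp
  have x2: "L q (fps_X * (fps_X * M)) = q ^ 3 * L q M2"
  proof -
    have "L q (fps_X * (fps_X * M)) = q * L q (fps_const q * (fps_X * M1))"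
      using LX[of "fps_X * M"] gM by (simp only: dX d1 geo_mult geo_X)
    also have "\<dots> = q * (q * (q * L q M2))"
      using g1 LX[OF g1] by (simp only: L_const[OF q] geo_mult geo_X d2)
    finally show ?thesis by (simp add: power3_eq_cube)
  qed
  have y2: "L q (fps_X * (fps_X * M1)) = q ^ 3 * L q M3"
  proof -
    have "L q (fps_X * (fps_X * M1)) = q * L q (fps_const q * (fps_X * M2))"
      using LX[of "fps_X * M1"] g1 by (simp only: dX d2 geo_mult geo_X)
    also have "\<dots> = q * (q * (q * L q M3))"
      using g2 LX[OF g2] by (simp only: L_const[OF q] geo_mult geo_X d3)
    finally show ?thesis by (simp add: power3_eq_cube)
  qed
  have x3: "L q (fps_X * (fps_X * (fps_X * M))) = q ^ 6 * L q M3"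
  proof -
    have "L q (fps_X * (fps_X * (fps_X * M))) = q * L q (dilate q (fps_X * (fps_X * M)))"
      using gM by (intro LX geo_mult geo_X)
    also have "dilate q (fps_X * (fps_X * M)) = fps_const (q * q) * (fps_X * (fps_X * M1))"
      unfolding dX d1 fps_const_mult [symmetric] by (simp only: mult_ac)
    also have "L q (fps_const (q * q) * (fps_X * (fps_X * M1))) = q * q * (q ^ 3 * L q M3)"
      using g1 by (simp only: L_const[OF q] geo_mult geo_X y2)
    finally show ?thesis by (simp add: eval_nat_numeral)
  qed
  have "(1 + x + x ^ 2 - Q * x ^ 3) * M = M + x * M + x * (x * M) - Q * (x * (x * (x * M)))"
    by (simp add: algebra_simps power2_eq_square power3_eq_cube)
  hence "L q ((1 + x + x ^ 2 - Q * x ^ 3) * M) = L q M + L q (x * M) + L q (x * (x * M)) - q * L q (x * (x * (x * M)))"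
    using gM unfolding x_def Q_def
    by (simp only: L_add[OF q] L_diff[OF q] L_const[OF q] geo_mult geo_X geo_add geo_const)
  hence "L q M + q * L q M1 + q ^ 3 * L q M2 - q ^ 7 * L q M3 = L q ((1 + x + x ^ 2 - Q * x ^ 3) * M)"
    unfolding x_def x1 x2 x3 by (simp add: eval_nat_numeral)
  also have "\<dots> = 1 * L q (family_c q (- (1 / q ^ 2)))"
  proof (rule L_relation[OF q])
    define K where "K = poch_fps q (- q) 1 * (poch_fps q (- (q ^ 2)) 2 * (inv_poch_fps q (1 / q ^ 2) 3 * inv_poch_fps q q 2))"
    define J where "J = poch_fps q (- 1) 1 * (poch_fps q (- 1) 2 * (inv_poch_fps q (1 / q ^ 2) 3 * inv_poch_fps q q 2))"
    define C where "C = i * x * J"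
    have i2: "fps_const (1 / q ^ 2) = i ^ 2" by (simp add: i_def power_one_over)
    have Qi: "Q * i = 1" using q0 by (simp add: Q_def i_def)
    have s3: "inv_poch_fps q q 3 = (1 - i ^ 2 * x ^ 3) * inv_poch_fps q (1 / q ^ 2) 3"
    proof -
      have "q = 1 / q ^ 2 * q ^ 3" using q0 by (simp add: eval_nat_numeral)
      from ip_shift'[OF q _ this] show ?thesis unfolding i2 x_def by simp
    qed
    have s2: "inv_poch_fps q (q * q ^ 2) 2 = (1 - Q * x ^ 2) * inv_poch_fps q q 2"
      using ip_shift'[OF q, of 2 "q * q ^ 2" q] by (simp add: x_def Q_def)
    have n2: "poch_fps q (- (1 / q ^ 2)) 2 = (1 + i ^ 2 * x ^ 2) * poch_fps q (- 1) 2"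
    proof -
      have "- 1 = - (1 / q ^ 2) * q ^ 2" using q0 by simp
      from np_shift'[OF q _ this] show ?thesis
        by (simp add: x_def i2 [symmetric] flip: fps_const_neg)
    qed
    have J: "J = (1 + x) * (1 + x ^ 2) * K"
      unfolding J_def K_def np_m1_1 np_m1_2 x_def by (simp only: mult_ac)
    have a: "- 1 * q ^ 1 = - q" "- 1 * q ^ 2 = - (q ^ 2)" "1 / q ^ 2 * q ^ 3 = q"
      using q0 by (simp_all add: eval_nat_numeral)
    have dJ: "dilate q J = (1 - Q * x ^ 2) * (1 - i ^ 2 * x ^ 3) * K"
      unfolding J_def dil_mult dil_np dil_ip a s2 s3 K_def by (simp only: mult_ac)
    have dix: "dilate q (i * x) = x"
    proof -
      have "dilate q (i * x) = (Q * i) * x" by (simp add: i_def x_def Q_def dil_mult dil_X mult_ac)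
      thus ?thesis unfolding Qi by simp
    qed
    have dC: "dilate q C = x * ((1 - Q * x ^ 2) * (1 - i ^ 2 * x ^ 3) * K)"
      unfolding C_def dil_mult[of q "i * x"] dix dJ ..
    have A: "(1 + x + x ^ 2 - Q * x ^ 3) * M = (1 - i ^ 2 * x ^ 3) * (1 + x + x ^ 2 - Q * x ^ 3) * K"
      unfolding M' s3 K_def by (simp only: mult_ac)
    have G: "family_c q (- (1 / q ^ 2)) = (1 + i ^ 2 * x ^ 2) * (1 + x ^ 2) * K"
      unfolding family_c_def n2 np_m1_2 minus_minus K_def x_def by (simp only: mult_ac)
    show "fps_const q * dilate q C - fps_X * C
        = fps_const q * ((1 + x + x ^ 2 - Q * x ^ 3) * M - fps_const 1 * family_c q (- (1 / q ^ 2)))"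
      using certificate_4[OF Qi, of x K]
      unfolding A G dC Q_def [symmetric] x_def [symmetric] fps_const_1_eq_1 mult_1
      unfolding C_def J by (simp only: mult.assoc)
    show "geometric C" unfolding C_def J_def i_def x_def by (intro geo_mult geo_const geo_X geo_np geo_ip q) auto
    show "geometric ((1 + x + x ^ 2 - Q * x ^ 3) * M)" unfolding x_def Q_def
      by (intro geo_mult geo_diff geo_add geo_1 geo_const geo_X geo_power gM)
    show "geometric (family_c q (- (1 / q ^ 2)))" by (rule geo_Gc[OF q])
  qed (rule q0)
  finally show ?thesis unfolding f0 f1 f2 f3 by simp
qed

end

section \<open>Evaluation of the products\<close>

lemma two_tri: "2 * int (tri n) = n * (n + 1)"
proof -
  have "0 \<le> n * (n + 1)"
    by (cases "n \<ge> 0") (auto intro: mult_nonpos_nonpos)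
  moreover have "even (n * (n + 1))" by simp
  ultimately show ?thesis unfolding tri_def by simp
qed

lemma tri_cancel: "2 * int a = 2 * int b \<Longrightarrow> a = b"
  by simp

text \<open>Exponents of the even and odd terms of a theta series. In the last one
  \<open>tri (- n)\<close> stands on the left because it would otherwise be subtracted.\<close>

lemma tri_double:
  "tri (2 * n) = 3 * tri n + tri (- n)"
  "tri (- (2 * n)) = tri n + 3 * tri (- n)"
  "tri (- (2 * n) - 1) = 3 * tri n + tri (- n)"
  "tri (- (- (2 * n) - 1)) + tri (- n) = 5 * tri n + 1"
proof -
  note t = two_tri[of n] two_tri[of "- n"]
  have "2 * int (tri (2 * n)) = 2 * int (3 * tri n + tri (- n))"
    using two_tri[of "2 * n"] t by (simp add: algebra_simps)
  thus "tri (2 * n) = 3 * tri n + tri (- n)" by (rule tri_cancel)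
  have "2 * int (tri (- (2 * n))) = 2 * int (tri n + 3 * tri (- n))"
    using two_tri[of "- (2 * n)"] t by (simp add: algebra_simps)
  thus "tri (- (2 * n)) = tri n + 3 * tri (- n)" by (rule tri_cancel)
  have "2 * int (tri (- (2 * n) - 1)) = 2 * int (3 * tri n + tri (- n))"
    using two_tri[of "- (2 * n) - 1"] t by (simp add: algebra_simps)
  thus "tri (- (2 * n) - 1) = 3 * tri n + tri (- n)" by (rule tri_cancel)
  have "2 * int (tri (- (- (2 * n) - 1)) + tri (- n)) = 2 * int (5 * tri n + 1)"
    using two_tri[of "- (- (2 * n) - 1)"] t by (simp add: algebra_simps)
  thus "tri (- (- (2 * n) - 1)) + tri (- n) = 5 * tri n + 1" by (rule tri_cancel)
qed

context
  fixes q :: complex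
  assumes q: "norm q < 1" and q0: "q \<noteq> 0"
begin

text \<open>The left side is the theta series with u = s q^2, v = -s q and u v = -q^3, split by the
  parity of n. The sign s survives only in the odd part, so s = 1 and s = -1 give the difference and
  the sum of the same two products.\<close>

lemma theta_dissection:
  assumes s: "s = 1 \<or> s = - 1"
  shows "qpoch_inf (- (s * q ^ 2)) (- (q ^ 3)) * qpoch_inf (s * q) (- (q ^ 3)) * qpoch_inf (- (q ^ 3)) (- (q ^ 3))
    = qpoch_inf (q ^ 5) (q ^ 12) * qpoch_inf (q ^ 7) (q ^ 12) * qpoch_inf (q ^ 12) (q ^ 12)
      - s * q * (qpoch_inf q (q ^ 12) * qpoch_inf (q ^ 11) (q ^ 12) * qpoch_inf (q ^ 12) (q ^ 12))"
proof -
  define u where "u = s * q ^ 2"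
  define v where "v = - (s * q)"
  have ss: "s * s = 1" "s * (s * w) = w" for w using s by auto
  have uv: "u * v = - (q ^ 3)" and u3v: "u ^ 3 * v = - (q ^ 7)" and uv3: "u * v ^ 3 = - (q ^ 5)"
    and u3v5: "u ^ 3 * v ^ 5 = - (q ^ 11)" and qv: "- q * v = u"
    by (simp_all add: u_def v_def eval_nat_numeral mult_ac ss)
  have v0: "v \<noteq> 0" using s q0 by (auto simp: v_def)
  have poch_fps: "norm (q ^ n) < 1" if "1 \<le> n" for n by (rule norm_power_less_1[OF q that])
  define h where "h = (\<lambda>n. u ^ tri n * v ^ tri (- n))"
  have "norm (u * v) < 1" "u * v \<noteq> 0" unfolding uv using poch_fps[of 3] q0 by simp_all
  from jacobi_triple_product[OF this]
  have H: "(h has_sum (qpoch_inf (- u) (- (q ^ 3)) * qpoch_inf (- v) (- (q ^ 3)) * qpoch_inf (- (q ^ 3)) (- (q ^ 3)))) UNIV"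
    unfolding uv h_def .
  have p12: "- (q ^ 7) * - (q ^ 5) = q ^ 12" "- (q ^ 11) * - q = q ^ 12"
    by (simp_all add: eval_nat_numeral)
  have E: "h (2 * n) = (- (q ^ 7)) ^ tri n * (- (q ^ 5)) ^ tri (- n)" for n
  proof -
    have "h (2 * n) = (u ^ 3 * v) ^ tri n * (u * v ^ 3) ^ tri (- n)"
      unfolding h_def tri_double
      by (simp only: power_add power_mult power_mult_distrib) (simp only: mult_ac)
    thus ?thesis unfolding u3v uv3 .
  qed
  \<comment> \<open>The exponent of v is 5 tri n + 1 - tri (- n); both sides are multiplied by
    v^(tri (- n)) to avoid the subtraction, and u = -q v turns the rest into a power of -q.
    Enumerating the odd integers as -2n - 1 makes u / v appear here instead of v / u = -1/q.\<close>
  have O: "h (- (2 * n) - 1) = v * ((- (q ^ 11)) ^ tri n * (- q) ^ tri (- n))" for n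
  proof -
    have "h (- (2 * n) - 1) * v ^ tri (- n) = u ^ (3 * tri n + tri (- n)) * v ^ (5 * tri n + 1)"
      unfolding h_def tri_double(3) tri_double(4)[symmetric] power_add by (simp only: mult.assoc)
    also have "\<dots> = v * (u ^ 3 * v ^ 5) ^ tri n * u ^ tri (- n)"
      by (simp only: power_add power_mult power_mult_distrib power_one_right) (simp only: mult_ac)
    also have "u ^ tri (- n) = (- q) ^ tri (- n) * v ^ tri (- n)"
      unfolding power_mult_distrib [symmetric] qv ..
    finally have "h (- (2 * n) - 1) * v ^ tri (- n) = (v * ((- (q ^ 11)) ^ tri n * (- q) ^ tri (- n))) * v ^ tri (- n)"
      unfolding u3v5 by (simp only: mult.assoc)
    thus ?thesis using v0 by simp
  qed
  have "norm (- (q ^ 7) * - (q ^ 5)) < 1" "- (q ^ 7) * - (q ^ 5) \<noteq> 0"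
    unfolding p12 using poch_fps[of 12] q0 by simp_all
  from jacobi_triple_product[OF this]
  have T1: "((\<lambda>n. h (2 * n)) has_sum (qpoch_inf (q ^ 7) (q ^ 12) * qpoch_inf (q ^ 5) (q ^ 12) * qpoch_inf (q ^ 12) (q ^ 12))) UNIV"
    unfolding p12 E minus_minus .
  have "norm (- (q ^ 11) * - q) < 1" "- (q ^ 11) * - q \<noteq> 0"
    unfolding p12 using poch_fps[of 12] q0 by simp_all
  from has_sum_cmult_right[OF jacobi_triple_product[OF this], of v]
  have T2: "((\<lambda>n. h (- (2 * n) - 1)) has_sum (v * (qpoch_inf (q ^ 11) (q ^ 12) * qpoch_inf q (q ^ 12) * qpoch_inf (q ^ 12) (q ^ 12)))) UNIV"
    unfolding p12 O minus_minus .
  from has_sum_unique[OF H has_sum_int_even_odd[OF T1 T2]]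
  show ?thesis by (simp add: u_def v_def mult_ac)
qed

lemma identities_nonzero:
  "F q q (q ^ 3) (q ^ 6) (q ^ 8) = 1 / qpoch_inf_list [q, q ^ 3, q ^ 4, q ^ 6, q ^ 8, q ^ 9, q ^ 11] (q ^ 12)"
  "F q (q ^ 3) (q ^ 5) (q ^ 6) (q ^ 12) = 1 / qpoch_inf_list [q ^ 3, q ^ 4, q ^ 5, q ^ 6, q ^ 7, q ^ 8, q ^ 9] (q ^ 12)"
  "F q (q ^ 2) (q ^ 3) (q ^ 5) (q ^ 8) = 1 / qpoch_inf_list [q ^ 2, q ^ 3, q ^ 4, q ^ 5, q ^ 8, q ^ 9, q ^ 11] (q ^ 12)"
  "F q (q ^ 2) (q ^ 3) (q ^ 4) (q ^ 8) + q * F q (q ^ 3) (q ^ 5) (q ^ 7) (q ^ 12)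
      + q ^ 3 * F q (q ^ 4) (q ^ 7) (q ^ 10) (q ^ 16) - q ^ 7 * F q (q ^ 5) (q ^ 9) (q ^ 13) (q ^ 20)
    = 1 / qpoch_inf_list [q, q ^ 3, q ^ 4, q ^ 7, q ^ 8, q ^ 9, q ^ 10] (q ^ 12)"
proof -
  \<comment> \<open>Everything is brought down to base q^12; apart from the theta dissection, the
    claims are then cancellations of the factors P a.\<close>
  define P where "P = (\<lambda>a. qpoch_inf (q ^ a) (q ^ 12))"
  define p where "p = (\<lambda>a. qpoch_inf (q ^ a) (q ^ 6))"
  define m where "m = (\<lambda>a. qpoch_inf (- (q ^ a)) (q ^ 6))"
  have nq: "norm (q ^ n) < 1" if "1 \<le> n" for n by (rule norm_power_less_1[OF q that])
  have P0: "P a \<noteq> 0" if "1 \<le> a" for a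
    unfolding P_def using nq that by (intro qpoch_inf_nonzero) auto
  have p0: "p a \<noteq> 0" if "1 \<le> a" for a
    unfolding p_def using nq that by (intro qpoch_inf_nonzero) auto
  have P1: "qpoch_inf q (q ^ 12) = P 1" and p1: "qpoch_inf q (q ^ 6) = p 1" and m1: "qpoch_inf (- q) (q ^ 6) = m 1"
    by (simp_all add: P_def p_def m_def)
  have set: "{..<2::nat} = {0, 1}" "{..<3::nat} = {0, 1, 2}" "{..<6::nat} = {0, 1, 2, 3, 4, 5}"
    by auto
  have pd: "p a = P a * P (a + 6)" for a
    using qpoch_inf_dissect[OF nq[of 6], of 2 "q ^ a"]
    by (simp add: set P_def p_def power_add flip: power_mult)
  have pm: "p a * m a = P (2 * a)" for a
    using qpoch_inf_mult_minus[OF nq[of 6], of "q ^ a"]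
    by (simp add: P_def p_def m_def mult.commute[of a 2] flip: power_mult)
  have mq: "m a = P (2 * a) / (P a * P (a + 6))" if "1 \<le> a" for a
    using pm[of a] pd[of a] p0[OF that] by (simp add: field_simps)
  have qq: "qpoch_inf q q = p 1 * p 2 * p 3 * p 4 * p 5 * p 6"
  proof -
    have "qpoch_inf q q = (\<Prod>i<6. p (Suc i))"
      using qpoch_inf_dissect[OF q, of 6 q] by (simp add: p_def)
    also have "\<dots> = p 1 * p 2 * p 3 * p 4 * p 5 * p 6"
      unfolding set by (simp add: eval_nat_numeral mult_ac)
    finally show ?thesis .
  qed
  \<comment> \<open>In (q, q^5, q^6; q^6) / (q; q) exactly the residues 2, 3, 4 modulo 6 remain in
    the denominator.\<close>
  have W: "L q (poch_fps q (- q) 1 * inv_poch_fps q q 2) = 1 / (p 2 * p 3 * p 4)"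
    unfolding L_bressoud[OF q] bA_q[OF q q0] p1 qq
    using p0[of 1] p0[of 2] p0[of 3] p0[of 4] p0[of 5] p0[of 6] by (simp add: p_def field_simps)
  have family_c: "L q (family_c q c) = qpoch_inf (c * q ^ 3) (q ^ 6) / (p 2 * p 3 * p 4)" for c
    unfolding L_Gc[OF q q0] W by simp
  have e: "- (q ^ 2) * q ^ 3 = - (q ^ 5)" "- (1 / q ^ 2) * q ^ 3 = - q" "- 1 * q ^ 3 = - (q ^ 3)"
    using q0 by (simp_all add: eval_nat_numeral)
  note nz = P0[of 1] P0[of 2] P0[of 3] P0[of 4] P0[of 5] P0[of 6] P0[of 7] P0[of 8] P0[of 9] P0[of 10] P0[of 11] P0[of 12]
  have lst: "qpoch_inf_list [q, q ^ 3, q ^ 4, q ^ 6, q ^ 8, q ^ 9, q ^ 11] (q ^ 12) = P 1 * P 3 * P 4 * P 6 * P 8 * P 9 * P 11"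
    "qpoch_inf_list [q ^ 3, q ^ 4, q ^ 5, q ^ 6, q ^ 7, q ^ 8, q ^ 9] (q ^ 12) = P 3 * P 4 * P 5 * P 6 * P 7 * P 8 * P 9"
    "qpoch_inf_list [q ^ 2, q ^ 3, q ^ 4, q ^ 5, q ^ 8, q ^ 9, q ^ 11] (q ^ 12) = P 2 * P 3 * P 4 * P 5 * P 8 * P 9 * P 11"
    "qpoch_inf_list [q, q ^ 3, q ^ 4, q ^ 7, q ^ 8, q ^ 9, q ^ 10] (q ^ 12) = P 1 * P 3 * P 4 * P 7 * P 8 * P 9 * P 10"
    by (simp_all add: qpoch_inf_list_def P_def mult.assoc)
  have q2: "p 2 = P 2 * P 8" "p 3 = P 3 * P 9" "p 4 = P 4 * P 10" "p 1 = P 1 * P 7" "p 5 = P 5 * P 11" "p 6 = P 6 * P 12"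
    using pd[of 2] pd[of 3] pd[of 4] pd[of 1] pd[of 5] pd[of 6] by simp_all
  have ms: "m 1 = P 2 / (P 1 * P 7)" "m 5 = P 10 / (P 5 * P 11)" "m 2 = P 4 / (P 2 * P 8)" "m 4 = P 8 / (P 4 * P 10)"
    using mq[of 1] mq[of 5] mq[of 2] mq[of 4] by simp_all
  show "F q (q ^ 2) (q ^ 3) (q ^ 5) (q ^ 8) = 1 / qpoch_inf_list [q ^ 2, q ^ 3, q ^ 4, q ^ 5, q ^ 8, q ^ 9, q ^ 11] (q ^ 12)"
  proof -
    have "F q (q ^ 2) (q ^ 3) (q ^ 5) (q ^ 8) = m 5 / (p 2 * p 3 * p 4)"
      unfolding F3_eq[OF q] family_c e by (simp add: m_def)
    thus ?thesis unfolding lst ms q2 using nz by (simp add: field_simps)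
  qed
  show "F q (q ^ 2) (q ^ 3) (q ^ 4) (q ^ 8) + q * F q (q ^ 3) (q ^ 5) (q ^ 7) (q ^ 12)
      + q ^ 3 * F q (q ^ 4) (q ^ 7) (q ^ 10) (q ^ 16) - q ^ 7 * F q (q ^ 5) (q ^ 9) (q ^ 13) (q ^ 20)
    = 1 / qpoch_inf_list [q, q ^ 3, q ^ 4, q ^ 7, q ^ 8, q ^ 9, q ^ 10] (q ^ 12)"
  proof -
    have "L q (family_c q (- (1 / q ^ 2))) = m 1 / (p 2 * p 3 * p 4)"
      unfolding family_c e m1 ..
    thus ?thesis unfolding F4_eq[OF q q0] lst ms q2 using nz by (simp add: field_simps)
  qed
  define X where "X = L q (family_c q (- 1))"
  define Y where "Y = L q (family_e q 1)"
  \<comment> \<open>Chosen so that k t1 and k t2 are the right-hand sides of the first two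
    identities.\<close>
  define k where "k = 1 / (P 1 * P 3 * P 4 * P 5 * P 6 * P 7 * P 8 * P 9 * P 11 * P 12)"
  define t1 where "t1 = P 5 * P 7 * P 12"
  define t2 where "t2 = P 1 * P 11 * P 12"
  \<comment> \<open>Even and odd powers of -q^3 separate, which brings the theta products to base
    q^6.\<close>
  have base3: "qpoch_inf a (- (q ^ 3)) = qpoch_inf a (q ^ 6) * qpoch_inf (- (a * q ^ 3)) (q ^ 6)" for a
  proof -
    have "(- (q ^ 3)) ^ 2 = q ^ 6" by (simp flip: power_mult)
    thus ?thesis using qpoch_inf_dissect[of "- (q ^ 3)" 2 a] nq[of 3] by (simp add: set)
  qed
  have e2: "q ^ 2 * q ^ 3 = q ^ 5" "q * q ^ 3 = q ^ 4" "q ^ 3 * q ^ 3 = q ^ 6"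
    by (simp_all add: eval_nat_numeral)
  have Tm: "m 2 * p 5 * (p 1 * m 4) * (m 3 * p 6) = t1 - q * t2"
    using theta_dissection[of 1] unfolding base3
    by (simp add: m_def p_def P_def t1_def t2_def e2)
  have Tp: "p 2 * m 5 * (m 1 * p 4) * (m 3 * p 6) = t1 + q * t2"
    using theta_dissection[of "- 1"] unfolding base3
    by (simp add: m_def p_def P_def t1_def t2_def e2)
  have X: "X = k * (t1 - q * t2)"
  proof -
    have "X = m 3 / (p 2 * p 3 * p 4)" unfolding X_def family_c e by (simp add: m_def)
    also have "\<dots> = k * (m 2 * p 5 * (p 1 * m 4) * (m 3 * p 6))"
      unfolding k_def ms q2 using nz by (simp add: field_simps)
    finally show ?thesis unfolding Tm .
  qed
  \<comment> \<open>Euler's distinct-odd identity (-z; z) (z; z^2) = 1 at z = q^3; it removes the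
    factor m 6 from the value of B(1).\<close>
  have m36: "m 3 * m 6 * p 3 = 1"
  proof -
    have "qpoch_inf (q ^ 3) (q ^ 3) * qpoch_inf (- (q ^ 3)) (q ^ 3) = p 6"
      using qpoch_inf_mult_minus[OF nq[of 3], of "q ^ 3"] by (simp add: p_def flip: power_mult)
    moreover have "qpoch_inf (q ^ 3) (q ^ 3) = p 3 * p 6" "qpoch_inf (- (q ^ 3)) (q ^ 3) = m 3 * m 6"
      using qpoch_inf_dissect[OF nq[of 3], of 2 "q ^ 3"] qpoch_inf_dissect[OF nq[of 3], of 2 "- (q ^ 3)"]
      by (simp_all add: set p_def m_def e2 flip: power_mult)
    ultimately have "(m 3 * m 6 * p 3) * p 6 = 1 * p 6" by (simp add: mult_ac)
    thus ?thesis using p0[of 6] by simp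
  qed
  have Y: "Y = k * (t1 + q * t2)"
  proof -
    \<comment> \<open>The even part of (-q; q), which cancels the product on the left of
      \<open>L_Ge_1\<close>.\<close>
    define r where "r = qpoch_inf (- (q ^ 2)) (q ^ 2)"
    have r0: "r \<noteq> 0" unfolding r_def using nq[of 2] by (intro qpoch_inf_nonzero) auto
    have d2: "qpoch_inf (- q) q = qpoch_inf (- q) (q ^ 2) * r"
      using qpoch_inf_dissect[OF q, of 2 "- q"] by (simp add: set r_def power2_eq_square)
    have d3: "qpoch_inf (- q) (q ^ 2) = m 1 * m 3 * m 5"
    proof -
      have "- q * q ^ 2 = - (q ^ 3)" "- q * (q ^ 2) ^ 2 = - (q ^ 5)" "(q ^ 2) ^ 3 = q ^ 6"
        by (simp_all add: eval_nat_numeral)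
      thus ?thesis using qpoch_inf_dissect[OF nq[of 2], of 3 "- q"] by (simp add: set m_def mult_ac)
    qed
    have "Y * r = qpoch_inf (- q) (q ^ 2) * qpoch_inf (- (q ^ 6)) (q ^ 6) * (qpoch_inf (- q) (q ^ 2) * r)"
      using L_Ge_1[OF q q0] unfolding d2 Y_def r_def .
    hence "Y * r = ((m 1 * m 3 * m 5) ^ 2 * m 6) * r"
      unfolding d3 by (simp add: m_def power2_eq_square mult_ac)
    hence "Y = (m 1 * m 3 * m 5) ^ 2 * m 6" using r0 by simp
    also have "\<dots> = m 1 ^ 2 * m 5 ^ 2 * m 3 * (m 3 * m 6 * p 3) / p 3"
      using p0[of 3] by (simp add: power2_eq_square)
    also have "\<dots> = m 1 ^ 2 * m 5 ^ 2 * m 3 / p 3" unfolding m36 by simp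
    also have "\<dots> = k * (p 2 * m 5 * (m 1 * p 4) * (m 3 * p 6))"
      unfolding k_def ms q2 using nz by (simp add: field_simps power2_eq_square)
    finally show ?thesis unfolding Tp .
  qed
  define f1 where "f1 = F q q (q ^ 3) (q ^ 6) (q ^ 8)"
  define f2 where "f2 = F q (q ^ 3) (q ^ 5) (q ^ 6) (q ^ 12)"
  have d: "f1 - q * f2 = k * (t1 - q * t2)" and s: "f1 + q * f2 = k * (t1 + q * t2)"
    using F12_diff[OF q] F12_sum[OF q] X Y unfolding X_def Y_def f1_def f2_def by simp_all
  have "2 * f1 = (f1 - q * f2) + (f1 + q * f2)" by simp
  also have "\<dots> = 2 * (k * t1)" unfolding d s by (simp add: algebra_simps)
  finally have f1: "f1 = k * t1" by simp
  have "q * f2 = q * (k * t2)" using s unfolding f1 by (simp add: algebra_simps)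
  hence f2: "f2 = k * t2" using q0 by simp
  show "F q q (q ^ 3) (q ^ 6) (q ^ 8) = 1 / qpoch_inf_list [q, q ^ 3, q ^ 4, q ^ 6, q ^ 8, q ^ 9, q ^ 11] (q ^ 12)"
    unfolding f1_def [symmetric] f1 lst k_def t1_def using nz by (simp add: field_simps)
  show "F q (q ^ 3) (q ^ 5) (q ^ 6) (q ^ 12) = 1 / qpoch_inf_list [q ^ 3, q ^ 4, q ^ 5, q ^ 6, q ^ 7, q ^ 8, q ^ 9] (q ^ 12)"
    unfolding f2_def [symmetric] f2 lst k_def t2_def using nz by (simp add: field_simps)
qed

end

theorem theorem1p2:
  fixes q :: complex
  assumes "norm q < 1"
  shows
    "F q q (q ^ 3) (q ^ 6) (q ^ 8)
       = 1 / qpoch_inf_list [q, q ^ 3, q ^ 4, q ^ 6, q ^ 8, q ^ 9, q ^ 11] (q ^ 12)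
     \<and> F q (q ^ 3) (q ^ 5) (q ^ 6) (q ^ 12)
       = 1 / qpoch_inf_list [q ^ 3, q ^ 4, q ^ 5, q ^ 6, q ^ 7, q ^ 8, q ^ 9] (q ^ 12)
     \<and> F q (q ^ 2) (q ^ 3) (q ^ 5) (q ^ 8)
       = 1 / qpoch_inf_list [q ^ 2, q ^ 3, q ^ 4, q ^ 5, q ^ 8, q ^ 9, q ^ 11] (q ^ 12)
     \<and> F q (q ^ 2) (q ^ 3) (q ^ 4) (q ^ 8)
         + q * F q (q ^ 3) (q ^ 5) (q ^ 7) (q ^ 12)
         + q ^ 3 * F q (q ^ 4) (q ^ 7) (q ^ 10) (q ^ 16)
         - q ^ 7 * F q (q ^ 5) (q ^ 9) (q ^ 13) (q ^ 20)
       = 1 / qpoch_inf_list [q, q ^ 3, q ^ 4, q ^ 7, q ^ 8, q ^ 9, q ^ 10] (q ^ 12)"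
proof (cases "q = 0")
  case True
  show ?thesis unfolding True by (simp add: F_zero qpoch_inf_list_def)
next
  case False
  show ?thesis by (intro conjI identities_nonzero assms False)
qed

end
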